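(* Let $X \subset \mathbb{R}^n$ be an open set that is star-shaped at the origin, and let $\phi : X \to \mathbb{R}$ be a nonsingular DA function on $X$ with nonsingular DA certificate $(p_i,\rho_i)_{i=1}^n$. Then the tuples $(F_R,h_R,z_0)$, $(F_P,h_P,\tilde z_0)$ and $(F_Q,h_Q,\bar z_0)$ produced from this certificate by the construction described in the context are, respectively, an R-FISCIDS, a P-FISCIDS and a Q-FISCIDS representation of $\phi$, and their respective dimensions $N_R$, $N_P$, $N_Q$ satisfy $$N_R \le n + \prod_{i=1}^n (\rho_i + 1), \qquad N_P = N_R + M_R \le N_R + n, \qquad N_Q = |\overline{\mathcal N}_P| - 1 \le \binom{N_P + d_P}{d_P} - 1,$$ where $M_R$ is the number of components of $\tilde\beta$, $\overline{\mathcal N}_P$ is the componentwise downward closure of the set of multi-exponents of the monomials occurring in $F_P$ and $h_P$, and $d_P$ is the maximum total degree of the entries of $F_P$ and $h_P$.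
   Context: A set $X \subset \mathbb{R}^n$ is star-shaped at $\xi_0$ if $\xi_0 + s(\xi - \xi_0) \in X$ for all $\xi \in X$ and $s \in [0,1]$. DA functions. A (real-)analytic $\phi : X \to \mathbb{R}$ on an open set $X\subset\mathbb{R}^n$ is a nonsingular DA function with certificate $(p_i,\rho_i)_{i=1}^n$ if for each $i$, $\rho_i$ is a nonnegative integer and $p_i(\xi,Y_0,\ldots,Y_{\rho_i})$ is a nonzero real polynomial such that, for all $\xi\in X$, evaluating at $Y_\ell = \partial^\ell\phi(\xi)/\partial\xi_i^\ell$ ($0\le \ell\le\rho_i$) gives $p_i = 0$ and $\partial p_i/\partial Y_{\rho_i} \ne 0$. FISCIDS representations. For $\phi : X \to \mathbb{R}^m$, $X \subset \mathbb{R}^n$ open, a tuple $(F,h,z_0)$ with $F : Z \to \mathbb{R}^{N\times n}$, $h : Z \to \mathbb{R}^m$, $Z\subset\mathbb{R}^N$ open, $z_0\in Z$ (independent of $\xi$), is a FISCIDS representation of $\phi$ of dimension $N$ if for every $\xi\in X$ the solution $z(\tau;\xi)$ of $\dot z = F(z)\xi$, $z(0)=z_0$, is defined (in $Z$) for all $\tau\in[0,1]$ and $h(z(1;\xi)) = \phi(\xi)$. It is R-FISCIDS if the entries of $F,h$ are rational functions (with denominators not vanishing on $Z$), P-FISCIDS if they are polynomials, Q-FISCIDS if the entries of $F$ are polynomials of degree at most two and those of $h$ are affine. Construction. (R) Let $\mathcal A_\phi = \{\partial^{|\nu|}\phi/\partial\xi^\nu : \nu\in\mathbb{Z}_{\ge0}^n,\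 0\le\nu_i\le\rho_i,\ i=1,\ldots,n\}$, with $|\nu|=\sum_i\nu_i$, and let $\alpha(\xi)\in\mathbb{R}^{N_R}$ be an ordered vector of all elements of the set of functions $\mathcal A = \{\xi_1,\ldots,\xi_n\}\cup\mathcal A_\phi$. Let $\Delta_{k\rho_k}(z)$ denote the polynomial $\partial p_k/\partial Y_{\rho_k}$ regarded as a polynomial in $z\in\mathbb{R}^{N_R}$ by replacing $\xi_i$ and $Y_\ell$ with the coordinates of $z$ corresponding to the components $\xi_i$ and $\partial^\ell\phi/\partial\xi_k^\ell$ of $\alpha$. For all $j,k$ one takes a rational function $r_{jk}(z)$, with denominator a power of $\Delta_{k\rho_k}(z)$, such that $\partial\alpha_j(\xi)/\partial\xi_k = r_{jk}(\alpha(\xi))$ on $X$ (such $r_{jk}$ exist). Put $F_R(z) = [r_{jk}(z)]$, $h_R(z) = z_\ell$ where $\alpha_\ell = \phi$, and $z_0 = \alpha(0)$. (P) Let $\tilde\beta(z)\in\mathbb{R}^{M_R}$ be the vector of the distinct nonconstant reciprocals $1/\Delta_{k\rho_k}(z)$, $k=1,\ldots,n$, and $\beta(z) = [z^\top,\tilde\beta(z)^\top]^\top$. Let $\tilde F(\tilde z)$ and $\tilde G(\tilde z)$, $\tilde z = (\tilde z_{(1)},\tilde z_{(2)}) \in\mathbb{R}^{N_R}\times\mathbb{R}^{M_R}$, be matrix-valued polynomial maps with $F_R(z) = \tilde F(z,\tilde\beta(z))$ and $\partial\tilde\beta(z)/\partial z = \tilde G(z,\tilde\beta(z))$ (where for the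 latter one uses $\partial (1/d)/\partial z = -(1/d)^2\,\partial d/\partial z$). Put $F_P(\tilde z) = \begin{bmatrix}\tilde F(\tilde z)\\ \tilde G(\tilde z)\tilde F(\tilde z)\end{bmatrix}$, $h_P(\tilde z) = \tilde z_\ell$ (the $\ell$-th coordinate of $\tilde z$), and $\tilde z_0 = \beta(z_0)$. (Q) Let $\mathcal N_P\subset\mathbb{Z}_{\ge0}^{N_P}$ be the set of all multi-exponents of monomials occurring in $F_P$ and $h_P$, and $\overline{\mathcal N}_P = \{\bar\nu\in\mathbb{Z}_{\ge0}^{N_P} : \exists\nu\in\mathcal N_P,\ \nu-\bar\nu\in\mathbb{Z}_{\ge0}^{N_P}\}$. Let $\tilde\gamma(\tilde z)$ be an ordered vector of all monomials $\tilde z^{\bar\nu}$, $\bar\nu\in\overline{\mathcal N}_P\setminus\{0\}$. Let $\bar F,\bar G$ be the matrix-valued affine maps with $F_P(\tilde z) = \bar F(\tilde\gamma(\tilde z))$ and $\partial\tilde\gamma(\tilde z)/\partial\tilde z = \bar G(\tilde\gamma(\tilde z))$. Put $F_Q(\bar z) = \bar G(\bar z)\bar F(\bar z)$, $h_Q(\bar z) = \bar z_q$ where $\tilde\gamma_q(\tilde z) = \tilde z_\ell$, and $\bar z_0 = \tilde\gamma(\tilde z_0)$. *)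

theory Defs
  imports "HOL-Analysis.Analysis" "HOL-Library.Poly_Mapping"
begin

section \<open>Multivariate real polynomials\<close>

text \<open>A polynomial maps each exponent to its coefficient; an exponent maps each variable to its
  power.  The ring structure is that of finitely supported functions under convolution.\<close>

type_synonym 'v expo = "'v \<Rightarrow>\<^sub>0 nat"
type_synonym 'v rpoly = "('v \<Rightarrow>\<^sub>0 nat) \<Rightarrow>\<^sub>0 real"

definition mono_eval :: "('v \<Rightarrow> real) \<Rightarrow> 'v expo \<Rightarrow> real" where
  "mono_eval z m = (\<Prod>v\<in>Poly_Mapping.keys m. z v ^ Poly_Mapping.lookup m v)"

definition poly_eval :: "('v \<Rightarrow> real) \<Rightarrow> 'v rpoly \<Rightarrow> real" where
  "poly_eval z p = (\<Sum>m\<in>Poly_Mapping.keys p. Poly_Mapping.lookup p m * mono_eval z m)"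

definition poly_vars :: "'v rpoly \<Rightarrow> 'v set" where
  "poly_vars p = (\<Union>m\<in>Poly_Mapping.keys p. Poly_Mapping.keys m)"

definition total_degree :: "'v rpoly \<Rightarrow> nat" where
  "total_degree p =
     Max (insert 0 ((\<lambda>m. \<Sum>v\<in>Poly_Mapping.keys m. Poly_Mapping.lookup m v) ` Poly_Mapping.keys p))"

definition poly_var :: "'v \<Rightarrow> 'v rpoly" where
  "poly_var v = Poly_Mapping.single (Poly_Mapping.single v 1) 1"

text \<open>If \<open>v\<close> does not occur in \<open>m\<close>, the truncated subtraction is harmless: the summand is 0.\<close>

definition poly_pderiv :: "'v \<Rightarrow> 'v rpoly \<Rightarrow> 'v rpoly" where
  "poly_pderiv v p = (\<Sum>m\<in>Poly_Mapping.keys p.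
     Poly_Mapping.single (m - Poly_Mapping.single v 1)
       (of_nat (Poly_Mapping.lookup m v) * Poly_Mapping.lookup p m))"

text \<open>The renaming may identify variables, hence the sums.\<close>

definition poly_rename :: "('v \<Rightarrow> 'w) \<Rightarrow> 'v rpoly \<Rightarrow> 'w rpoly" where
  "poly_rename \<sigma> p = (\<Sum>m\<in>Poly_Mapping.keys p.
     Poly_Mapping.single
       (\<Sum>v\<in>Poly_Mapping.keys m. Poly_Mapping.single (\<sigma> v) (Poly_Mapping.lookup m v))
       (Poly_Mapping.lookup p m))"


section \<open>Star-shaped sets, analytic functions, DA functions\<close>

definition star_shaped_at :: "'a::real_vector set \<Rightarrow> 'a \<Rightarrow> bool" where
  "star_shaped_at X \<xi>0 \<longleftrightarrow> (\<forall>\<xi>\<in>X. \<forall>s\<in>{0..1}. \<xi>0 + s *\<^sub>R (\<xi> - \<xi>0) \<in> X)"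

definition real_analytic_on :: "(real^'n \<Rightarrow> real) \<Rightarrow> (real^'n) set \<Rightarrow> bool" where
  "real_analytic_on f X \<longleftrightarrow>
     (\<forall>a\<in>X. \<exists>c. \<exists>r>0. ball a r \<subseteq> X \<and>
        (\<forall>x\<in>ball a r.
           ((\<lambda>\<nu>::'n \<Rightarrow> nat. c \<nu> * (\<Prod>i\<in>UNIV. (x $ i - a $ i) ^ \<nu> i)) has_sum f x) UNIV))"

definition partial_deriv :: "'n \<Rightarrow> (real^'n \<Rightarrow> real) \<Rightarrow> (real^'n \<Rightarrow> real)" where
  "partial_deriv i f = (\<lambda>\<xi>. deriv (\<lambda>t. f (\<xi> + t *\<^sub>R axis i 1)) 0)"

text \<open>The order in which the coordinates are processed is an arbitrary fixed one; it is
  irrelevant for analytic functions, whose mixed partial derivatives commute.\<close>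

definition coord_order :: "'n::finite list" where
  "coord_order = (SOME is. distinct is \<and> set is = UNIV)"

definition multi_deriv :: "('n::finite \<Rightarrow> nat) \<Rightarrow> (real^'n \<Rightarrow> real) \<Rightarrow> (real^'n \<Rightarrow> real)" where
  "multi_deriv \<nu> f = foldr (\<lambda>i g. (partial_deriv i ^^ \<nu> i) g) coord_order f"

text \<open>In the polynomials of a certificate, the variable \<open>Inl j\<close> is \<open>\<xi>\<^sub>j\<close> and \<open>Inr l\<close> is \<open>Y\<^sub>l\<close>.\<close>

definition cert_point :: "(real^'n \<Rightarrow> real) \<Rightarrow> 'n \<Rightarrow> real^'n \<Rightarrow> 'n + nat \<Rightarrow> real" where
  "cert_point \<phi> i \<xi> = case_sum (\<lambda>j. \<xi> $ j) (\<lambda>l. (partial_deriv i ^^ l) \<phi> \<xi>)"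

definition nonsingular_DA_certificate ::
  "(real^'n) set \<Rightarrow> (real^'n \<Rightarrow> real) \<Rightarrow> ('n \<Rightarrow> ('n + nat) rpoly) \<Rightarrow> ('n \<Rightarrow> nat) \<Rightarrow> bool" where
  "nonsingular_DA_certificate X \<phi> p \<rho> \<longleftrightarrow>
     real_analytic_on \<phi> X \<and>
     (\<forall>i. p i \<noteq> 0 \<and> poly_vars (p i) \<subseteq> range Inl \<union> Inr ` {..\<rho> i} \<and>
        (\<forall>\<xi>\<in>X. poly_eval (cert_point \<phi> i \<xi>) (p i) = 0 \<and>
                poly_eval (cert_point \<phi> i \<xi>) (poly_pderiv (Inr (\<rho> i)) (p i)) \<noteq> 0))"


section \<open>FISCIDS representations\<close>

text \<open>The state space of dimension \<open>N\<close> is the library's \<^term>\<open>Euclidean_space N\<close>, whose points are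
  the functions \<open>nat \<Rightarrow> real\<close> vanishing at all arguments \<open>\<ge> N\<close>.  An \<open>N \<times> n\<close> matrix-valued
  map takes a state, a row and a column.\<close>

definition ode_solution ::
  "nat \<Rightarrow> (nat \<Rightarrow> real) set \<Rightarrow> ((nat \<Rightarrow> real) \<Rightarrow> nat \<Rightarrow> 'n \<Rightarrow> real) \<Rightarrow> (nat \<Rightarrow> real) \<Rightarrow> real^'n
    \<Rightarrow> (real \<Rightarrow> nat \<Rightarrow> real) \<Rightarrow> bool" where
  "ode_solution N Z F z0 \<xi> z \<longleftrightarrow>
     z 0 = z0 \<and>
     (\<forall>\<tau>\<in>{0..1}. z \<tau> \<in> Z \<and>
        (\<forall>j<N. ((\<lambda>t. z t j) has_real_derivative (\<Sum>k\<in>UNIV. F (z \<tau>) j k * \<xi> $ k))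
                 (at \<tau> within {0..1})))"

text \<open>Speaking of \<^emph>\<open>the\<close> solution is read as existence and uniqueness on \<open>[0,1]\<close>.\<close>

definition FISCIDS ::
  "nat \<Rightarrow> (nat \<Rightarrow> real) set \<Rightarrow> ((nat \<Rightarrow> real) \<Rightarrow> nat \<Rightarrow> 'n \<Rightarrow> real) \<Rightarrow> ((nat \<Rightarrow> real) \<Rightarrow> real^'m)
    \<Rightarrow> (nat \<Rightarrow> real) \<Rightarrow> (real^'n) set \<Rightarrow> (real^'n \<Rightarrow> real^'m) \<Rightarrow> bool" where
  "FISCIDS N Z F h z0 X \<phi> \<longleftrightarrow>
     openin (Euclidean_space N) Z \<and> z0 \<in> Z \<and>
     (\<forall>\<xi>\<in>X. \<exists>z. ode_solution N Z F z0 \<xi> z \<and>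
        (\<forall>w. ode_solution N Z F z0 \<xi> w \<longrightarrow> (\<forall>\<tau>\<in>{0..1}. w \<tau> = z \<tau>)) \<and>
        h (z 1) = \<phi> \<xi>)"

definition rational_fun :: "nat \<Rightarrow> (nat \<Rightarrow> real) set \<Rightarrow> ((nat \<Rightarrow> real) \<Rightarrow> real) \<Rightarrow> bool" where
  "rational_fun N Z f \<longleftrightarrow>
     (\<exists>a b. poly_vars a \<subseteq> {..<N} \<and> poly_vars b \<subseteq> {..<N} \<and>
        (\<forall>z\<in>Z. poly_eval z b \<noteq> 0 \<and> f z = poly_eval z a / poly_eval z b))"

definition polynomial_fun :: "nat \<Rightarrow> (nat \<Rightarrow> real) set \<Rightarrow> ((nat \<Rightarrow> real) \<Rightarrow> real) \<Rightarrow> bool" where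
  "polynomial_fun N Z f \<longleftrightarrow>
     (\<exists>a. poly_vars a \<subseteq> {..<N} \<and> (\<forall>z\<in>Z. f z = poly_eval z a))"

definition polynomial_fun_deg_le ::
  "nat \<Rightarrow> nat \<Rightarrow> (nat \<Rightarrow> real) set \<Rightarrow> ((nat \<Rightarrow> real) \<Rightarrow> real) \<Rightarrow> bool" where
  "polynomial_fun_deg_le d N Z f \<longleftrightarrow>
     (\<exists>a. poly_vars a \<subseteq> {..<N} \<and> total_degree a \<le> d \<and> (\<forall>z\<in>Z. f z = poly_eval z a))"

definition R_FISCIDS where
  "R_FISCIDS N Z F h z0 X \<phi> \<longleftrightarrow> FISCIDS N Z F h z0 X \<phi> \<and>
     (\<forall>j<N. \<forall>k. rational_fun N Z (\<lambda>z. F z j k)) \<and> (\<forall>i. rational_fun N Z (\<lambda>z. h z $ i))"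

definition P_FISCIDS where
  "P_FISCIDS N Z F h z0 X \<phi> \<longleftrightarrow> FISCIDS N Z F h z0 X \<phi> \<and>
     (\<forall>j<N. \<forall>k. polynomial_fun N Z (\<lambda>z. F z j k)) \<and> (\<forall>i. polynomial_fun N Z (\<lambda>z. h z $ i))"

definition Q_FISCIDS where
  "Q_FISCIDS N Z F h z0 X \<phi> \<longleftrightarrow> FISCIDS N Z F h z0 X \<phi> \<and>
     (\<forall>j<N. \<forall>k. polynomial_fun_deg_le 2 N Z (\<lambda>z. F z j k)) \<and>
     (\<forall>i. polynomial_fun_deg_le 1 N Z (\<lambda>z. h z $ i))"


section \<open>The construction\<close>

definition enumerates :: "'a list \<Rightarrow> 'a set \<Rightarrow> bool" where
  "enumerates xs A \<longleftrightarrow> distinct xs \<and> set xs = A"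

definition position :: "'a list \<Rightarrow> 'a \<Rightarrow> nat" where
  "position xs x = (THE j. j < length xs \<and> xs ! j = x)"

subsection \<open>Step (R)\<close>

text \<open>Functions on \<open>X\<close> are compared after restriction to \<open>X\<close>.\<close>

definition A_phi :: "(real^'n) set \<Rightarrow> (real^'n \<Rightarrow> real) \<Rightarrow> ('n \<Rightarrow> nat) \<Rightarrow> (real^'n \<Rightarrow> real) set" where
  "A_phi X \<phi> \<rho> = {restrict (multi_deriv \<nu> \<phi>) X |\<nu>. \<forall>i. \<nu> i \<le> \<rho> i}"

definition A_all :: "(real^'n) set \<Rightarrow> (real^'n \<Rightarrow> real) \<Rightarrow> ('n \<Rightarrow> nat) \<Rightarrow> (real^'n \<Rightarrow> real) set" where
  "A_all X \<phi> \<rho> = range (\<lambda>i. restrict (\<lambda>\<xi>. \<xi> $ i) X) \<union> A_phi X \<phi> \<rho>"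

definition alpha_vec :: "(real^'n \<Rightarrow> real) list \<Rightarrow> real^'n \<Rightarrow> nat \<Rightarrow> real" where
  "alpha_vec \<alpha> \<xi> = (\<lambda>j. if j < length \<alpha> then (\<alpha> ! j) \<xi> else 0)"

definition Delta ::
  "(real^'n) set \<Rightarrow> (real^'n \<Rightarrow> real) \<Rightarrow> ('n \<Rightarrow> ('n + nat) rpoly) \<Rightarrow> ('n \<Rightarrow> nat)
    \<Rightarrow> (real^'n \<Rightarrow> real) list \<Rightarrow> 'n \<Rightarrow> nat rpoly" where
  "Delta X \<phi> p \<rho> \<alpha> k =
     poly_rename
       (case_sum (\<lambda>i. position \<alpha> (restrict (\<lambda>\<xi>. \<xi> $ i) X))
                 (\<lambda>l. position \<alpha> (restrict ((partial_deriv k ^^ l) \<phi>) X)))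
       (poly_pderiv (Inr (\<rho> k)) (p k))"

text \<open>\<open>num j k\<close> and \<open>ex j k\<close> are the numerator of \<open>r\<^sub>j\<^sub>k\<close> and the exponent of \<open>\<Delta>\<^sub>k\<close> in its
  denominator.\<close>

definition construction_R ::
  "(real^'n) set \<Rightarrow> (real^'n \<Rightarrow> real) \<Rightarrow> ('n \<Rightarrow> ('n + nat) rpoly) \<Rightarrow> ('n \<Rightarrow> nat)
    \<Rightarrow> (real^'n \<Rightarrow> real) list \<Rightarrow> (nat \<Rightarrow> 'n \<Rightarrow> nat rpoly) \<Rightarrow> (nat \<Rightarrow> 'n \<Rightarrow> nat) \<Rightarrow> bool" where
  "construction_R X \<phi> p \<rho> \<alpha> num ex \<longleftrightarrow>
     enumerates \<alpha> (A_all X \<phi> \<rho>) \<and>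
     (\<forall>j<length \<alpha>. \<forall>k. poly_vars (num j k) \<subseteq> {..<length \<alpha>} \<and>
        (\<forall>\<xi>\<in>X. partial_deriv k (\<alpha> ! j) \<xi> =
           poly_eval (alpha_vec \<alpha> \<xi>) (num j k) /
           poly_eval (alpha_vec \<alpha> \<xi>) (Delta X \<phi> p \<rho> \<alpha> k) ^ ex j k))"

definition F_R ::
  "('n \<Rightarrow> nat rpoly) \<Rightarrow> (nat \<Rightarrow> 'n \<Rightarrow> nat rpoly) \<Rightarrow> (nat \<Rightarrow> 'n \<Rightarrow> nat)
    \<Rightarrow> (nat \<Rightarrow> real) \<Rightarrow> nat \<Rightarrow> 'n \<Rightarrow> real" where
  "F_R \<Delta> num ex z j k = poly_eval z (num j k) / poly_eval z (\<Delta> k) ^ ex j k"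

definition Z_R :: "nat \<Rightarrow> ('n \<Rightarrow> nat rpoly) \<Rightarrow> (nat \<Rightarrow> real) set" where
  "Z_R N \<Delta> = {z \<in> topspace (Euclidean_space N). \<forall>k. poly_eval z (\<Delta> k) \<noteq> 0}"

text \<open>All of \<open>h\<^sub>R\<close>, \<open>h\<^sub>P\<close>, \<open>h\<^sub>Q\<close> are coordinate projections.\<close>

definition coord_proj :: "nat \<Rightarrow> (nat \<Rightarrow> real) \<Rightarrow> real^1" where
  "coord_proj l z = vec (z l)"

subsection \<open>Step (P)\<close>

text \<open>The vector of reciprocals \<open>1/\<Delta>\<^sub>k\<close> is given by the list \<open>ds\<close> of its denominators;
  two such reciprocals agree iff the denominators do.\<close>

definition beta_vec :: "nat \<Rightarrow> nat rpoly list \<Rightarrow> (nat \<Rightarrow> real) \<Rightarrow> nat \<Rightarrow> real" where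
  "beta_vec N ds z =
     (\<lambda>i. if i < N then z i
          else if i < N + length ds then 1 / poly_eval z (ds ! (i - N))
          else 0)"

definition construction_P ::
  "nat \<Rightarrow> ('n \<Rightarrow> nat rpoly) \<Rightarrow> (nat \<Rightarrow> 'n \<Rightarrow> nat rpoly) \<Rightarrow> (nat \<Rightarrow> 'n \<Rightarrow> nat)
    \<Rightarrow> nat rpoly list \<Rightarrow> (nat \<Rightarrow> 'n \<Rightarrow> nat rpoly) \<Rightarrow> (nat \<Rightarrow> nat \<Rightarrow> nat rpoly) \<Rightarrow> bool" where
  "construction_P N \<Delta> num ex ds Ft Gt \<longleftrightarrow>
     enumerates ds {\<Delta> k |k. poly_vars (\<Delta> k) \<noteq> {}} \<and>
     (\<forall>j<N. \<forall>k. poly_vars (Ft j k) \<subseteq> {..<N + length ds} \<and>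
        (\<forall>z\<in>Z_R N \<Delta>. F_R \<Delta> num ex z j k = poly_eval (beta_vec N ds z) (Ft j k))) \<and>
     (\<forall>i<length ds. \<forall>j<N. poly_vars (Gt i j) \<subseteq> {..<N + length ds} \<and>
        (\<forall>z\<in>Z_R N \<Delta>.
           ((\<lambda>t. 1 / poly_eval (z(j := t)) (ds ! i)) has_real_derivative
              poly_eval (beta_vec N ds z) (Gt i j)) (at (z j))))"

definition F_P ::
  "nat \<Rightarrow> (nat \<Rightarrow> 'n \<Rightarrow> nat rpoly) \<Rightarrow> (nat \<Rightarrow> nat \<Rightarrow> nat rpoly) \<Rightarrow> nat \<Rightarrow> 'n \<Rightarrow> nat rpoly" where
  "F_P N Ft Gt j k = (if j < N then Ft j k else (\<Sum>l<N. Gt (j - N) l * Ft l k))"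

subsection \<open>Step (Q)\<close>

definition exps_P :: "nat \<Rightarrow> (nat \<Rightarrow> 'n \<Rightarrow> nat rpoly) \<Rightarrow> nat rpoly \<Rightarrow> nat expo set" where
  "exps_P N F h = (\<Union>j<N. \<Union>k. Poly_Mapping.keys (F j k)) \<union> Poly_Mapping.keys h"

definition down_closure :: "'v expo set \<Rightarrow> 'v expo set" where
  "down_closure E =
     {\<mu>. \<exists>\<nu>\<in>E. \<forall>i. Poly_Mapping.lookup \<mu> i \<le> Poly_Mapping.lookup \<nu> i}"

definition max_degree_P :: "nat \<Rightarrow> (nat \<Rightarrow> 'n::finite \<Rightarrow> nat rpoly) \<Rightarrow> nat rpoly \<Rightarrow> nat" where
  "max_degree_P N F h = Max (insert (total_degree h) {total_degree (F j k) |j k. j < N})"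

definition gamma_vec :: "nat expo list \<Rightarrow> (nat \<Rightarrow> real) \<Rightarrow> nat \<Rightarrow> real" where
  "gamma_vec gs z = (\<lambda>i. if i < length gs then mono_eval z (gs ! i) else 0)"

definition construction_Q ::
  "nat \<Rightarrow> (nat \<Rightarrow> 'n \<Rightarrow> nat rpoly) \<Rightarrow> nat rpoly
    \<Rightarrow> nat expo list \<Rightarrow> (nat \<Rightarrow> 'n \<Rightarrow> nat rpoly) \<Rightarrow> (nat \<Rightarrow> nat \<Rightarrow> nat rpoly) \<Rightarrow> bool" where
  "construction_Q N F h gs Fb Gb \<longleftrightarrow>
     enumerates gs (down_closure (exps_P N F h) - {0}) \<and>
     (\<forall>j<N. \<forall>k. poly_vars (Fb j k) \<subseteq> {..<length gs} \<and> total_degree (Fb j k) \<le> 1 \<and>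
        (\<forall>z\<in>topspace (Euclidean_space N).
           poly_eval z (F j k) = poly_eval (gamma_vec gs z) (Fb j k))) \<and>
     (\<forall>i<length gs. \<forall>j<N. poly_vars (Gb i j) \<subseteq> {..<length gs} \<and> total_degree (Gb i j) \<le> 1 \<and>
        (\<forall>z\<in>topspace (Euclidean_space N).
           ((\<lambda>t. mono_eval (z(j := t)) (gs ! i)) has_real_derivative
              poly_eval (gamma_vec gs z) (Gb i j)) (at (z j))))"

definition F_Q ::
  "nat \<Rightarrow> (nat \<Rightarrow> 'n \<Rightarrow> nat rpoly) \<Rightarrow> (nat \<Rightarrow> nat \<Rightarrow> nat rpoly)
    \<Rightarrow> (nat \<Rightarrow> real) \<Rightarrow> nat \<Rightarrow> 'n \<Rightarrow> real" where
  "F_Q N Fb Gb z i k = (\<Sum>l<N. poly_eval z (Gb i l) * poly_eval z (Fb l k))"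

end

theory Submission
  imports Defs
begin

text \<open>By the chain rule, \<open>\<tau> \<mapsto> \<alpha>(\<tau>\<xi>)\<close> solves the equation with right-hand side \<open>F\<^sub>R \<xi>\<close>, and
  composing it with \<open>\<beta>\<close> and then with \<open>\<gamma>\<close> gives solutions for \<open>F\<^sub>P\<close> and \<open>F\<^sub>Q\<close>; uniqueness
  is a Gronwall estimate.  The rational functions \<open>r\<^sub>j\<^sub>k\<close> exist because \<open>\<partial>/\<partial>\<xi>\<^sub>k\<close> maps \<open>\<A>\<close> into the
  algebra generated by \<open>\<A>\<close> and \<open>1/\<Delta>\<^sub>k\<close>: if it leads out of \<open>\<A>\<close>, then by one order in \<open>\<xi>\<^sub>k\<close>, and
  differentiating \<open>p\<^sub>k = 0\<close> brings the result back.  For this the partial derivatives of an analytic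
  function have to commute, which is read off the coefficients of its power series.  The bound
  on \<open>N\<^sub>Q\<close> counts monomials in \<open>N\<^sub>P\<close> variables of degree at most \<open>d\<^sub>P\<close>.\<close>

text \<open>The choices \<open>num\<close>, \<open>Ft\<close>, \<open>Gt\<close>, \<open>Fb\<close>,
  \<open>Gb\<close> are not determined by their defining identities: those for \<open>num\<close>
  hold only on the image of \<alpha>, and in step (P) the new coordinates obey the relation (1/d) d
  = 1. Beyond bounds on variables and degrees, each of them is therefore used only through its
  values along one explicit curve, where the entries of the Jacobians are fixed by uniqueness of
  derivatives. That suitable choices exist is a separate matter.

  The state space of step (R) is open but need not be convex or connected, and the systems of steps
  (P) and (Q) live on all of Euclidean space rather than on the images of \<beta> and \<gamma>.
  Uniqueness must hold against arbitrary competitors there, so solutions cannot simply be pulled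
  back to \<open>X\<close>.

  The delicate point of step (R) is that column k may have only powers of \<Delta>_k in its
  denominators. Hence its algebra contains a single reciprocal; differentiating 1/\<Delta>_k in
  another direction squares it but creates no new denominator.\<close>

section \<open>Multivariate polynomials\<close>

lemma mono_eval_superset:
  assumes "finite V" "Poly_Mapping.keys m \<subseteq> V"
  shows "mono_eval z m = (\<Prod>v\<in>V. z v ^ Poly_Mapping.lookup m v)"
  unfolding mono_eval_def using assms
  by (intro prod.mono_neutral_left) (auto simp: in_keys_iff)

lemma mono_eval_0 [simp]: "mono_eval z 0 = 1"
  by (simp add: mono_eval_def)

lemma mono_eval_single [simp]: "mono_eval z (Poly_Mapping.single v k) = z v ^ k"
  by (simp add: mono_eval_def)

lemma mono_eval_add: "mono_eval z (m + n) = mono_eval z m * mono_eval z n"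
proof -
  let ?V = "Poly_Mapping.keys m \<union> Poly_Mapping.keys n"
  have "mono_eval z (m + n) = (\<Prod>v\<in>?V. z v ^ Poly_Mapping.lookup (m + n) v)"
    by (intro mono_eval_superset keys_add) auto
  also have "\<dots> = (\<Prod>v\<in>?V. z v ^ Poly_Mapping.lookup m v) * (\<Prod>v\<in>?V. z v ^ Poly_Mapping.lookup n v)"
    by (simp add: lookup_add power_add prod.distrib)
  finally show ?thesis
    using mono_eval_superset[of ?V m z] mono_eval_superset[of ?V n z] by simp
qed

lemma mono_eval_sum: "mono_eval z (sum f A) = (\<Prod>a\<in>A. mono_eval z (f a))"
  by (induction A rule: infinite_finite_induct) (auto simp: mono_eval_add)

text \<open>Coefficients of a sum can cancel, so p, q and p + q are evaluated over one common finite
  set; the surplus terms are 0.\<close>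

lemma poly_eval_superset:
  assumes "finite A" "Poly_Mapping.keys p \<subseteq> A"
  shows "poly_eval z p = (\<Sum>m\<in>A. Poly_Mapping.lookup p m * mono_eval z m)"
  unfolding poly_eval_def using assms
  by (intro sum.mono_neutral_left) (auto simp: in_keys_iff)

lemma poly_eval_0 [simp]: "poly_eval z 0 = 0"
  by (simp add: poly_eval_def)

lemma poly_eval_single [simp]: "poly_eval z (Poly_Mapping.single m c) = c * mono_eval z m"
  by (simp add: poly_eval_def)

lemma poly_eval_1 [simp]: "poly_eval z 1 = 1"
  using poly_eval_single[of z 0 1] by simp

lemma poly_eval_var [simp]: "poly_eval z (poly_var v) = z v"
  by (simp add: poly_var_def)

lemma poly_eval_add [simp]: "poly_eval z (p + q) = poly_eval z p + poly_eval z q"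
proof -
  let ?A = "Poly_Mapping.keys p \<union> Poly_Mapping.keys q"
  have "poly_eval z (p + q) = (\<Sum>m\<in>?A. Poly_Mapping.lookup (p + q) m * mono_eval z m)"
    by (intro poly_eval_superset keys_add) auto
  also have "\<dots> = (\<Sum>m\<in>?A. Poly_Mapping.lookup p m * mono_eval z m)
      + (\<Sum>m\<in>?A. Poly_Mapping.lookup q m * mono_eval z m)"
    by (simp add: lookup_add algebra_simps sum.distrib)
  finally show ?thesis
    using poly_eval_superset[of ?A p z] poly_eval_superset[of ?A q z] by simp
qed

lemma poly_eval_sum [simp]: "poly_eval z (sum f A) = (\<Sum>a\<in>A. poly_eval z (f a))"
  by (induction A rule: infinite_finite_induct) auto

text \<open>Splitting both factors into monomials reduces evaluation of a product to
  \<open>mult_single\<close>, without unfolding the convolution.\<close>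

lemma rpoly_sum_monomials:
  "(\<Sum>m\<in>Poly_Mapping.keys p. Poly_Mapping.single m (Poly_Mapping.lookup p m)) = p"
  by (rule poly_mapping_eqI)
    (auto simp: lookup_sum lookup_single when_def sum.delta in_keys_iff)

lemma poly_eval_mult [simp]: "poly_eval z (p * q) = poly_eval z p * poly_eval z q"
proof -
  let ?s = "\<lambda>p m. Poly_Mapping.single m (Poly_Mapping.lookup p m)"
  have "p * q = (\<Sum>m\<in>Poly_Mapping.keys p. ?s p m) * (\<Sum>n\<in>Poly_Mapping.keys q. ?s q n)"
    by (simp only: rpoly_sum_monomials)
  also have "\<dots> = (\<Sum>m\<in>Poly_Mapping.keys p. \<Sum>n\<in>Poly_Mapping.keys q. ?s p m * ?s q n)"
    by (simp only: sum_product)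
  finally have "poly_eval z (p * q) = (\<Sum>m\<in>Poly_Mapping.keys p. \<Sum>n\<in>Poly_Mapping.keys q.
      (Poly_Mapping.lookup p m * mono_eval z m) * (Poly_Mapping.lookup q n * mono_eval z n))"
    by (simp add: mult_single mono_eval_add algebra_simps)
  then show ?thesis
    by (simp add: poly_eval_def sum_product)
qed

lemma poly_eval_power [simp]: "poly_eval z (p ^ k) = poly_eval z p ^ k"
  by (induction k) auto

lemma poly_eval_cong:
  assumes "\<And>v. v \<in> poly_vars p \<Longrightarrow> z v = w v"
  shows "poly_eval z p = poly_eval w p"
  unfolding poly_eval_def mono_eval_def using assms
  by (intro sum.cong arg_cong2[where f = "(*)"] prod.cong refl arg_cong2[where f = power])
    (auto simp: poly_vars_def)

lemma poly_eval_const: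
  assumes "poly_vars p = {}"
  shows "poly_eval z p = poly_eval w p"
  by (rule poly_eval_cong) (use assms in auto)

lemma poly_vars_0 [simp]: "poly_vars 0 = {}"
  by (simp add: poly_vars_def)

lemma poly_vars_single:
  "poly_vars (Poly_Mapping.single m c) = (if c = 0 then {} else Poly_Mapping.keys m)"
  by (simp add: poly_vars_def)

lemma poly_vars_1 [simp]: "poly_vars 1 = {}"
  by (simp add: poly_vars_def)

lemma poly_vars_var [simp]: "poly_vars (poly_var v) = {v}"
  by (simp add: poly_var_def poly_vars_single)

lemma poly_vars_add: "poly_vars (p + q) \<subseteq> poly_vars p \<union> poly_vars q"
  using keys_add[of p q] by (auto simp: poly_vars_def)

lemma poly_vars_mult: "poly_vars (p * q) \<subseteq> poly_vars p \<union> poly_vars q"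
proof
  fix v assume "v \<in> poly_vars (p * q)"
  then obtain m where "m \<in> Poly_Mapping.keys (p * q)" "v \<in> Poly_Mapping.keys m"
    by (auto simp: poly_vars_def)
  then obtain a b where "a \<in> Poly_Mapping.keys p" "b \<in> Poly_Mapping.keys q" "v \<in> Poly_Mapping.keys (a + b)"
    using keys_mult[of p q] by blast
  then show "v \<in> poly_vars p \<union> poly_vars q"
    using keys_add[of a b] by (auto simp: poly_vars_def)
qed

lemma poly_vars_sum: "poly_vars (sum f A) \<subseteq> (\<Union>a\<in>A. poly_vars (f a))"
proof (induction A rule: infinite_finite_induct)
  case (insert a A)
  then show ?case using poly_vars_add[of "f a" "sum f A"] by auto
qed auto

lemma poly_vars_power: "poly_vars (p ^ k) \<subseteq> poly_vars p"
proof (induction k)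
  case (Suc k)
  then show ?case using poly_vars_mult[of p "p ^ k"] by auto
qed auto

lemma finite_poly_vars [simp]: "finite (poly_vars p)"
  by (simp add: poly_vars_def)

text \<open>No injectivity of \<sigma> is required. In \<open>Delta\<close> two certificate
  variables share a position when the functions they stand for agree on \<open>X\<close>.\<close>

lemma poly_eval_rename: "poly_eval z (poly_rename \<sigma> p) = poly_eval (\<lambda>v. z (\<sigma> v)) p"
  unfolding poly_rename_def poly_eval_sum poly_eval_single mono_eval_sum mono_eval_single
  by (simp add: poly_eval_def mono_eval_def)

text \<open>Equality can fail, since monomials merged by \<sigma> may cancel.\<close>

lemma poly_vars_rename:
  fixes \<sigma> :: "'a \<Rightarrow> 'b"
  shows "poly_vars (poly_rename \<sigma> p) \<subseteq> \<sigma> ` poly_vars p"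
proof -
  have *: "Poly_Mapping.keys (\<Sum>v\<in>K. Poly_Mapping.single (\<sigma> v) (f v)) \<subseteq> \<sigma> ` K"
    for K :: "'a set" and f :: "'a \<Rightarrow> nat"
  proof (induction K rule: infinite_finite_induct)
    case (insert a K)
    then show ?case
      using keys_add[of "Poly_Mapping.single (\<sigma> a) (f a)" "\<Sum>v\<in>K. Poly_Mapping.single (\<sigma> v) (f v)"]
      by (auto split: if_splits)
  qed auto
  show ?thesis
    unfolding poly_rename_def
    by (rule subset_trans[OF poly_vars_sum])
      (use * in \<open>fastforce simp: poly_vars_single poly_vars_def split: if_splits\<close>)
qed

lemma poly_vars_pderiv: "poly_vars (poly_pderiv v p) \<subseteq> poly_vars p"
proof -
  have "Poly_Mapping.keys (m - Poly_Mapping.single v 1) \<subseteq> Poly_Mapping.keys m" for m :: "'a expo"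
    by (auto simp: in_keys_iff lookup_minus)
  then show ?thesis
    unfolding poly_pderiv_def
    by (intro subset_trans[OF poly_vars_sum])
      (fastforce simp: poly_vars_single poly_vars_def split: if_splits)
qed

text \<open>The predicate speaks about the evaluation function, not the polynomial, so any property
  of functions that is closed under sums and products is inherited: continuity, Lipschitz estimates,
  membership in an algebra.\<close>

lemma poly_fun_induct:
  assumes vars: "poly_vars p \<subseteq> V"
    and const: "\<And>c. P (\<lambda>z. c)" and var: "\<And>v. v \<in> V \<Longrightarrow> P (\<lambda>z. z v)"
    and add: "\<And>f g. P f \<Longrightarrow> P g \<Longrightarrow> P (\<lambda>z. f z + g z)"
    and mult: "\<And>f g. P f \<Longrightarrow> P g \<Longrightarrow> P (\<lambda>z. f z * g z)"
  shows "P (\<lambda>z. poly_eval z p)"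
proof -
  have pow: "P (\<lambda>z. z v ^ k)" if "v \<in> V" for v and k :: nat
  proof (induction k)
    case (Suc k)
    then show ?case using mult[OF var[OF that] Suc] by simp
  qed (simp add: const)
  have prods: "P (\<lambda>z. \<Prod>v\<in>W. z v ^ e v)" if "W \<subseteq> V" for W and e :: "_ \<Rightarrow> nat"
    using that
  proof (induction W rule: infinite_finite_induct)
    case (insert v W)
    then show ?case using mult[OF pow[of v "e v"] insert.IH] by simp
  qed (simp_all add: const)
  have sums: "P (\<lambda>z. \<Sum>m\<in>A. Poly_Mapping.lookup p m * (\<Prod>v\<in>Poly_Mapping.keys m. z v ^ Poly_Mapping.lookup m v))"
    if "A \<subseteq> Poly_Mapping.keys p" for A
    using that
  proof (induction A rule: infinite_finite_induct)
    case (insert m A)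
    then have "Poly_Mapping.keys m \<subseteq> V"
      using vars by (auto simp: poly_vars_def)
    with insert show ?case
      using add[OF mult[OF const[of "Poly_Mapping.lookup p m"] prods] insert.IH] by simp
  qed (simp_all add: const)
  show ?thesis
    using sums[OF subset_refl] by (simp add: poly_eval_def mono_eval_def)
qed

section \<open>Differentiation of monomials and polynomials along curves\<close>

lemma mono_eval_diff_single:
  assumes "finite V" "Poly_Mapping.keys m \<subseteq> V" "v \<in> V"
  shows "mono_eval z (m - Poly_Mapping.single v 1) =
    z v ^ (Poly_Mapping.lookup m v - 1) * (\<Prod>u\<in>V - {v}. z u ^ Poly_Mapping.lookup m u)"
proof -
  have "mono_eval z (m - Poly_Mapping.single v 1)
      = (\<Prod>u\<in>V. z u ^ (Poly_Mapping.lookup (m - Poly_Mapping.single v 1) u))"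
    by (rule mono_eval_superset) (use assms in \<open>auto simp: in_keys_iff lookup_minus\<close>)
  then show ?thesis
    using assms by (auto simp: prod.remove lookup_minus lookup_single when_def intro!: prod.cong)
qed

lemma mono_eval_chain:
  assumes V: "finite V" "Poly_Mapping.keys m \<subseteq> V"
    and c: "\<And>v. v \<in> V \<Longrightarrow> ((\<lambda>t. c t v) has_real_derivative c' v) (at t within S)"
  shows "((\<lambda>t. mono_eval (c t) m) has_real_derivative
    (\<Sum>v\<in>V. Poly_Mapping.lookup m v * mono_eval (c t) (m - Poly_Mapping.single v 1) * c' v)) (at t within S)"
proof -
  have "((\<lambda>t. \<Prod>v\<in>V. c t v ^ Poly_Mapping.lookup m v) has_derivative
      (\<lambda>h. \<Sum>v\<in>V. (Poly_Mapping.lookup m v * c t v ^ (Poly_Mapping.lookup m v - 1) * c' v * h) *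
          (\<Prod>u\<in>V - {v}. c t u ^ Poly_Mapping.lookup m u))) (at t within S)"
  proof (rule has_derivative_prod)
    fix v assume "v \<in> V"
    have "((\<lambda>t. c t v ^ Poly_Mapping.lookup m v) has_real_derivative
        Poly_Mapping.lookup m v * c t v ^ (Poly_Mapping.lookup m v - 1) * c' v) (at t within S)"
      using c[OF \<open>v \<in> V\<close>] by (auto intro!: derivative_eq_intros)
    then show "((\<lambda>t. c t v ^ Poly_Mapping.lookup m v) has_derivative
        (\<lambda>h. Poly_Mapping.lookup m v * c t v ^ (Poly_Mapping.lookup m v - 1) * c' v * h)) (at t within S)"
      by (simp add: has_field_derivative_def)
  qed
  then show ?thesis
    unfolding has_field_derivative_def mono_eval_superset[OF V]
    by (rule has_derivative_eq_rhs)
      (auto simp: fun_eq_iff mono_eval_diff_single[OF V, unfolded One_nat_def] sum_distrib_right sum_distrib_left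
        algebra_simps intro!: sum.cong)
qed

lemma poly_eval_pderiv:
  "poly_eval z (poly_pderiv v p) = (\<Sum>m\<in>Poly_Mapping.keys p.
     Poly_Mapping.lookup p m * (Poly_Mapping.lookup m v * mono_eval z (m - Poly_Mapping.single v 1)))"
  by (simp add: poly_pderiv_def algebra_simps)

text \<open>The set \<open>S\<close> covers both two-sided derivatives and the one-sided ones at the
  ends of the unit interval. \<open>V\<close> may exceed the variables of p, which allows the index
  set {..<N} for every polynomial.\<close>

lemma poly_eval_chain:
  assumes V: "finite V" "poly_vars p \<subseteq> V"
    and c: "\<And>v. v \<in> V \<Longrightarrow> ((\<lambda>t. c t v) has_real_derivative c' v) (at t within S)"
  shows "((\<lambda>t. poly_eval (c t) p) has_real_derivative
    (\<Sum>v\<in>V. poly_eval (c t) (poly_pderiv v p) * c' v)) (at t within S)"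
proof -
  have "((\<lambda>t. \<Sum>m\<in>Poly_Mapping.keys p. Poly_Mapping.lookup p m * mono_eval (c t) m) has_real_derivative
     (\<Sum>m\<in>Poly_Mapping.keys p. Poly_Mapping.lookup p m *
        (\<Sum>v\<in>V. Poly_Mapping.lookup m v * mono_eval (c t) (m - Poly_Mapping.single v 1) * c' v)))
     (at t within S)"
  proof (intro DERIV_sum DERIV_cmult mono_eval_chain V c)
    fix m assume "m \<in> Poly_Mapping.keys p"
    then show "Poly_Mapping.keys m \<subseteq> V" using V by (auto simp: poly_vars_def)
  qed
  moreover have "(\<Sum>m\<in>Poly_Mapping.keys p. Poly_Mapping.lookup p m *
        (\<Sum>v\<in>V. Poly_Mapping.lookup m v * mono_eval (c t) (m - Poly_Mapping.single v 1) * c' v))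
     = (\<Sum>v\<in>V. poly_eval (c t) (poly_pderiv v p) * c' v)"
    unfolding poly_eval_pderiv sum_distrib_left sum_distrib_right
    by (subst sum.swap) (simp add: algebra_simps)
  ultimately show ?thesis by (simp add: poly_eval_def)
qed

lemma poly_eval_upd_deriv:
  "((\<lambda>t. poly_eval (z(j := t)) p) has_real_derivative poly_eval z (poly_pderiv j p)) (at (z j))"
proof -
  let ?V = "insert j (poly_vars p)"
  have "((\<lambda>t. poly_eval (z(j := t)) p) has_real_derivative
     (\<Sum>v\<in>?V. poly_eval (z(j := z j)) (poly_pderiv v p) * (if v = j then 1 else 0))) (at (z j))"
    by (rule poly_eval_chain) auto
  then show ?thesis
    by (simp add: if_distrib sum.delta cong: if_cong)
qed

section \<open>Degrees of exponents and polynomials\<close>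

abbreviation expo_degree :: "'v expo \<Rightarrow> nat" where
  "expo_degree m \<equiv> (\<Sum>v\<in>Poly_Mapping.keys m. Poly_Mapping.lookup m v)"

lemma expo_degree_superset:
  assumes "finite V" "Poly_Mapping.keys m \<subseteq> V"
  shows "expo_degree m = (\<Sum>v\<in>V. Poly_Mapping.lookup m v)"
  using assms by (intro sum.mono_neutral_left) (auto simp: in_keys_iff)

lemma expo_degree_add: "expo_degree (m + n) = expo_degree m + expo_degree n"
proof -
  let ?V = "Poly_Mapping.keys m \<union> Poly_Mapping.keys n"
  have "expo_degree (m + n) = (\<Sum>v\<in>?V. Poly_Mapping.lookup (m + n) v)"
    by (intro expo_degree_superset keys_add) auto
  then show ?thesis
    using expo_degree_superset[of ?V m] expo_degree_superset[of ?V n]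
    by (simp add: lookup_add sum.distrib)
qed

lemma total_degree_le_iff:
  "total_degree p \<le> d \<longleftrightarrow> (\<forall>m\<in>Poly_Mapping.keys p. expo_degree m \<le> d)"
  unfolding total_degree_def by (subst Max_le_iff) auto

lemma total_degree_add:
  "total_degree p \<le> d \<Longrightarrow> total_degree q \<le> d \<Longrightarrow> total_degree (p + q) \<le> d"
  using keys_add[of p q] by (auto simp: total_degree_le_iff)

lemma total_degree_sum:
  "(\<And>a. a \<in> A \<Longrightarrow> total_degree (f a) \<le> d) \<Longrightarrow> total_degree (sum f A) \<le> d"
proof (induction A rule: infinite_finite_induct)
  case (insert a A)
  then show ?case by (simp add: total_degree_add)
qed (simp_all add: total_degree_def)

lemma total_degree_mult:
  assumes "total_degree p \<le> d" "total_degree q \<le> e"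
  shows "total_degree (p * q) \<le> d + e"
  unfolding total_degree_le_iff
proof
  fix m assume "m \<in> Poly_Mapping.keys (p * q)"
  then obtain a b where "m = a + b" "a \<in> Poly_Mapping.keys p" "b \<in> Poly_Mapping.keys q"
    using keys_mult[of p q] by blast
  with assms show "expo_degree m \<le> d + e"
    by (auto simp: total_degree_le_iff expo_degree_add intro!: add_mono)
qed

section \<open>Real analytic functions and their partial derivatives\<close>

text \<open>The local clause of analyticity without reference to \<open>X\<close>, so that the
  radius can be shrunk freely.\<close>

definition power_series_on ::
  "(real^'n \<Rightarrow> real) \<Rightarrow> real^'n \<Rightarrow> real \<Rightarrow> (('n \<Rightarrow> nat) \<Rightarrow> real) \<Rightarrow> bool" where
  "power_series_on f a r c \<longleftrightarrow>
     (\<forall>x\<in>ball a r. ((\<lambda>\<nu>. c \<nu> * (\<Prod>i\<in>UNIV. (x $ i - a $ i) ^ \<nu> i)) has_sum f x) UNIV)"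

text \<open>Coefficients of the formal derivative in direction i, shifted so that \<nu> again
  indexes the monomial with exponent \<nu>.\<close>

definition deriv_coeff :: "'n \<Rightarrow> (('n \<Rightarrow> nat) \<Rightarrow> real) \<Rightarrow> ('n \<Rightarrow> nat) \<Rightarrow> real" where
  "deriv_coeff i c \<nu> = real (Suc (\<nu> i)) * c (\<nu>(i := Suc (\<nu> i)))"

section \<open>Term-by-term differentiation of multivariate power series\<close>

lemma prod_upd_pred:
  fixes y :: "'n::finite \<Rightarrow> real"
  assumes "0 < \<nu> i"
  shows "(\<Prod>j\<in>UNIV. y j ^ (\<nu>(i := \<nu> i - 1)) j) = y i ^ (\<nu> i - 1) * (\<Prod>j\<in>UNIV - {i}. y j ^ \<nu> j)"
proof -
  have "(\<Prod>j\<in>UNIV. y j ^ (\<nu>(i := \<nu> i - 1)) j)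
      = y i ^ (\<nu> i - 1) * (\<Prod>j\<in>UNIV - {i}. y j ^ (\<nu>(i := \<nu> i - 1)) j)"
    by (subst prod.remove[of UNIV i]) auto
  also have "(\<Prod>j\<in>UNIV - {i}. y j ^ (\<nu>(i := \<nu> i - 1)) j) = (\<Prod>j\<in>UNIV - {i}. y j ^ \<nu> j)"
    by (intro prod.cong) auto
  finally show ?thesis .
qed

text \<open>Halving the radius pays for the factor \<open>\<nu> i\<close> that differentiation brings in, as
  \<open>\<nu> i \<le> 2 ^ (\<Sum>j. \<nu> j)\<close>.\<close>

lemma power_series_term_bound:
  fixes y :: "'n::finite \<Rightarrow> real"
  assumes "0 < t" and y: "\<And>j. \<bar>y j\<bar> \<le> t"
  shows "\<bar>c * (real (\<nu> i) * (\<Prod>j\<in>UNIV. y j ^ (\<nu>(i := \<nu> i - 1)) j))\<bar>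
    \<le> \<bar>c\<bar> * (2 * t) ^ (\<Sum>j\<in>UNIV. \<nu> j) / t"
proof (cases "\<nu> i = 0")
  case True
  then show ?thesis using \<open>0 < t\<close> by simp
next
  case False
  then have pos: "0 < \<nu> i" by simp
  have "\<bar>\<Prod>j\<in>UNIV. y j ^ (\<nu>(i := \<nu> i - 1)) j\<bar> \<le> (\<Prod>j\<in>UNIV. t ^ (\<nu>(i := \<nu> i - 1)) j)"
    unfolding abs_prod by (rule prod_mono) (use y in \<open>auto simp: power_abs intro: power_mono\<close>)
  also have "\<dots> = (\<Prod>j\<in>UNIV. t ^ \<nu> j) / t"
    unfolding prod_upd_pred[of \<nu> i "\<lambda>_. t", OF pos] using pos \<open>0 < t\<close>
    by (subst prod.remove[of UNIV i]) (auto simp: field_simps power_eq_if)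
  also have "\<dots> = t ^ (\<Sum>j\<in>UNIV. \<nu> j) / t"
    by (simp add: power_sum)
  finally have 1: "\<bar>\<Prod>j\<in>UNIV. y j ^ (\<nu>(i := \<nu> i - 1)) j\<bar> \<le> t ^ (\<Sum>j\<in>UNIV. \<nu> j) / t" .
  have "\<nu> i \<le> (\<Sum>j\<in>UNIV. \<nu> j)"
    by (rule member_le_sum) auto
  also have "\<dots> \<le> 2 ^ (\<Sum>j\<in>UNIV. \<nu> j)"
    by (simp add: less_imp_le)
  finally have 2: "real (\<nu> i) \<le> 2 ^ (\<Sum>j\<in>UNIV. \<nu> j)"
    by (metis of_nat_le_iff of_nat_numeral of_nat_power)
  have "real (\<nu> i) * \<bar>\<Prod>j\<in>UNIV. y j ^ (\<nu>(i := \<nu> i - 1)) j\<bar>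
      \<le> 2 ^ (\<Sum>j\<in>UNIV. \<nu> j) * (t ^ (\<Sum>j\<in>UNIV. \<nu> j) / t)"
    by (rule mult_mono[OF 2 1]) auto
  then have "\<bar>c\<bar> * (real (\<nu> i) * \<bar>\<Prod>j\<in>UNIV. y j ^ (\<nu>(i := \<nu> i - 1)) j\<bar>)
      \<le> \<bar>c\<bar> * (2 ^ (\<Sum>j\<in>UNIV. \<nu> j) * (t ^ (\<Sum>j\<in>UNIV. \<nu> j) / t))"
    by (rule mult_left_mono) auto
  then show ?thesis
    by (simp add: abs_mult power_mult_distrib)
qed

lemma has_derivative_monomial:
  fixes a x :: "real^'n"
  shows "((\<lambda>x. c * (\<Prod>j\<in>UNIV. (x $ j - a $ j) ^ \<nu> j)) has_derivative
    (\<lambda>h. \<Sum>i\<in>UNIV. h $ i * (c * (real (\<nu> i) * (\<Prod>j\<in>UNIV. (x $ j - a $ j) ^ (\<nu>(i := \<nu> i - 1)) j)))))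
    (at x within S)"
proof -
  have 1: "((\<lambda>x::real^'n. (x $ j - a $ j) ^ \<nu> j) has_derivative
      (\<lambda>h. real (\<nu> j) * (x $ j - a $ j) ^ (\<nu> j - 1) * h $ j)) (at x within S)" for j
  proof -
    have "((\<lambda>x::real^'n. x $ j) has_derivative (\<lambda>h. h $ j)) (at x within S)"
      by (rule bounded_linear.has_derivative[OF bounded_linear_vec_nth has_derivative_ident])
    then show ?thesis
      by (auto intro!: derivative_eq_intros simp: fun_eq_iff)
  qed
  have "((\<lambda>x. c * (\<Prod>j\<in>UNIV. (x $ j - a $ j) ^ \<nu> j)) has_derivative
     (\<lambda>h. c * (\<Sum>i\<in>UNIV. (real (\<nu> i) * (x $ i - a $ i) ^ (\<nu> i - 1) * h $ i) *
        (\<Prod>j\<in>UNIV - {i}. (x $ j - a $ j) ^ \<nu> j)))) (at x within S)"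
    by (intro has_derivative_mult_right has_derivative_prod 1)
  then show ?thesis
  proof (rule has_derivative_eq_rhs, intro ext, unfold sum_distrib_left, intro sum.cong refl)
    fix h :: "real^'n" and i
    show "c * (real (\<nu> i) * (x $ i - a $ i) ^ (\<nu> i - 1) * h $ i * (\<Prod>j\<in>UNIV - {i}. (x $ j - a $ j) ^ \<nu> j))
      = h $ i * (c * (real (\<nu> i) * (\<Prod>j\<in>UNIV. (x $ j - a $ j) ^ (\<nu>(i := \<nu> i - 1)) j)))"
    proof (cases "\<nu> i = 0")
      \<comment> \<open>Only here is \<nu> i - 1 a genuine predecessor; otherwise the factor \<nu> i
        = 0 kills both sides.\<close>
      case False
      then show ?thesis
        using prod_upd_pred[of \<nu> i "\<lambda>j. x $ j - a $ j"] by simp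
    qed simp
  qed
qed

text \<open>Needed for a bijection from the natural numbers to the multi-indices.\<close>

lemma infinite_multi_indices: "infinite (UNIV :: ('n::finite \<Rightarrow> nat) set)"
proof
  assume fin: "finite (UNIV :: ('n \<Rightarrow> nat) set)"
  have "inj (\<lambda>k::nat. (\<lambda>_::'n. k))"
    by (auto simp: inj_def fun_eq_iff)
  then have "finite (UNIV :: nat set)"
    using fin by (meson finite_imageD finite_subset subset_UNIV)
  then show False by simp
qed

text \<open>One diagonal point suffices: unconditional summability of reals is absolute, and every
  monomial takes a value there that depends only on its total degree.\<close>

lemma power_series_majorant:
  fixes a :: "real^'n"
  assumes "0 < r" and ps: "power_series_on f a r c"
  obtains s where "0 < s" "s \<le> r" "(\<lambda>\<nu>. \<bar>c \<nu>\<bar> * s ^ (\<Sum>j\<in>UNIV. \<nu> j)) summable_on UNIV"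
proof -
  \<comment> \<open>With all coordinates of x - a equal to s, the l1 norm is CARD('n) * s = r / 2,
    which keeps x in the ball.\<close>
  define s where "s = r / (2 * CARD('n))"
  have s: "0 < s" "CARD('n) * s < r"
    using \<open>0 < r\<close> by (auto simp: s_def)
  have "1 * s \<le> CARD('n) * s"
    using s(1) zero_less_card_finite[where 'a = 'n] by (intro mult_right_mono) linarith+
  with s(2) have "s \<le> r" by linarith
  define x where "x = (\<chi> i. a $ i + s)"
  have "norm (x - a) \<le> (\<Sum>i\<in>UNIV. \<bar>(x - a) $ i\<bar>)"
    by (rule norm_le_l1_cart)
  also have "\<dots> < r"
    using s by (simp add: x_def)
  finally have "x \<in> ball a r"
    by (simp add: dist_norm norm_minus_commute)
  then have "(\<lambda>\<nu>. c \<nu> * (\<Prod>i\<in>UNIV. (x $ i - a $ i) ^ \<nu> i)) summable_on UNIV"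
    using ps by (auto simp: power_series_on_def summable_on_def)
  then have "(\<lambda>\<nu>. c \<nu> * s ^ (\<Sum>j\<in>UNIV. \<nu> j)) summable_on UNIV"
    by (simp add: x_def power_sum)
  then have "(\<lambda>\<nu>. norm (c \<nu> * s ^ (\<Sum>j\<in>UNIV. \<nu> j))) summable_on UNIV"
    by (rule summable_on_iff_abs_summable_on_real[THEN iffD1])
  then have "(\<lambda>\<nu>. \<bar>c \<nu>\<bar> * s ^ (\<Sum>j\<in>UNIV. \<nu> j)) summable_on UNIV"
    using s(1) by (simp add: abs_mult)
  then show thesis by (rule that[OF s(1) \<open>s \<le> r\<close>])
qed

text \<open>The majorant at s controls the differentiated series uniformly on the ball of radius s /
  2, so the series may be differentiated termwise there. The result is a total derivative, which the
  chain rule along rays requires.\<close>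

lemma power_series_differentiable:
  fixes a :: "real^'n"
  assumes "0 < r" and ps: "power_series_on f a r c"
  shows "\<exists>g. \<exists>t>0. t \<le> r \<and> (\<forall>i. power_series_on (g i) a t (deriv_coeff i c)) \<and>
    (\<forall>x\<in>ball a t. (f has_derivative (\<lambda>h. \<Sum>i\<in>UNIV. h $ i * g i x)) (at x))"
proof -
  obtain s where s: "0 < s" "s \<le> r" and summ: "(\<lambda>\<nu>. \<bar>c \<nu>\<bar> * s ^ (\<Sum>j\<in>UNIV. \<nu> j)) summable_on UNIV"
    using power_series_majorant[OF assms] .
  define t where "t = s / 2"
  have t: "0 < t" "t \<le> r" "2 * t = s"
    using s by (auto simp: t_def)
  define T where "T = (\<lambda>i \<nu> x. c \<nu> * (real (\<nu> i) * (\<Prod>j\<in>UNIV. (x $ j - a $ j) ^ (\<nu>(i := \<nu> i - 1)) j)))"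
  define M where "M = (\<lambda>\<nu>. \<bar>c \<nu>\<bar> * s ^ (\<Sum>j\<in>UNIV. \<nu> j) / t)"
  have M: "M summable_on UNIV"
    unfolding M_def divide_inverse by (rule summable_on_cmult_left[OF summ])
  have T_le: "norm (T i \<nu> x) \<le> M \<nu>" if "x \<in> ball a t" for i \<nu> x
  proof -
    have "\<bar>x $ j - a $ j\<bar> \<le> t" for j
      using that component_le_norm_cart[of "x - a" j]
      by (auto simp: dist_norm norm_minus_commute)
    then show ?thesis
      using power_series_term_bound[of t "\<lambda>j. x $ j - a $ j" "c \<nu>" \<nu> i] t
      by (simp add: T_def M_def)
  qed
  define g where "g = (\<lambda>i x. \<Sum>\<^sub>\<infinity>\<nu>. T i \<nu> x)"
  have g: "((\<lambda>\<nu>. T i \<nu> x) has_sum g i x) UNIV" if "x \<in> ball a t" for i x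
    unfolding g_def
  proof (rule has_sum_infsum)
    show "(\<lambda>\<nu>. T i \<nu> x) summable_on UNIV"
      by (rule abs_summable_summable, rule summable_on_comparison_test[OF M])
        (use T_le[OF that] in auto)
  qed
  have g_ps: "power_series_on (g i) a t (deriv_coeff i c)" for i
    unfolding power_series_on_def
  proof
    fix x assume x: "x \<in> ball a t"
    \<comment> \<open>Terms whose exponent in direction i is 0 vanish and all others are shifts, so
      reindexing by the shift produces \<open>deriv_coeff\<close>.\<close>
    let ?sh = "\<lambda>\<nu>::'n \<Rightarrow> nat. \<nu>(i := Suc (\<nu> i))"
    have "((\<lambda>\<nu>. T i \<nu> x) has_sum g i x) UNIV = ((\<lambda>\<nu>. T i \<nu> x) has_sum g i x) (range ?sh)"
    proof (rule has_sum_cong_neutral)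
      fix \<nu> :: "'n \<Rightarrow> nat" assume "\<nu> \<in> UNIV - range ?sh"
      moreover have "\<nu> = ?sh (\<nu>(i := \<nu> i - 1))" if "\<nu> i \<noteq> 0"
        using that by auto
      ultimately have "\<nu> i = 0" by blast
      then show "T i \<nu> x = 0" by (simp add: T_def)
    qed auto
    also have "\<dots> = (((\<lambda>\<nu>. T i \<nu> x) \<circ> ?sh) has_sum g i x) UNIV"
      by (intro has_sum_reindex) (auto simp: inj_def fun_eq_iff split: if_splits)
    also have "((\<lambda>\<nu>. T i \<nu> x) \<circ> ?sh) = (\<lambda>\<nu>. deriv_coeff i c \<nu> * (\<Prod>j\<in>UNIV. (x $ j - a $ j) ^ \<nu> j))"
    proof
      fix \<nu> :: "'n \<Rightarrow> nat"
      have "(?sh \<nu>)(i := ?sh \<nu> i - 1) = \<nu>"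
        by (simp add: fun_eq_iff)
      then show "((\<lambda>\<nu>. T i \<nu> x) \<circ> ?sh) \<nu> = deriv_coeff i c \<nu> * (\<Prod>j\<in>UNIV. (x $ j - a $ j) ^ \<nu> j)"
        unfolding T_def deriv_coeff_def o_def by simp
    qed
    finally show "((\<lambda>\<nu>. deriv_coeff i c \<nu> * (\<Prod>j\<in>UNIV. (x $ j - a $ j) ^ \<nu> j)) has_sum g i x) UNIV"
      using g[OF x] by simp
  qed
  \<comment> \<open>\<open>has_derivative_series\<close> sums over natural numbers; by unconditional
    summability the enumeration of the multi-indices is immaterial.\<close>
  define e where "e = from_nat_into (UNIV :: ('n \<Rightarrow> nat) set)"
  have e: "bij_betw e UNIV UNIV"
    unfolding e_def by (rule bij_betw_from_nat_into) (auto simp: infinite_multi_indices)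
  have sums: "(\<lambda>n. u (e n)) sums l" if "(u has_sum l) UNIV" for u :: "('n \<Rightarrow> nat) \<Rightarrow> real" and l
    using has_sum_reindex_bij_betw[OF e, of u l] that by (intro has_sum_imp_sums) simp
  have M_e: "summable (\<lambda>n. M (e n))"
    using sums M unfolding summable_on_def summable_def by blast
  have unif: "uniform_limit (ball a t) (\<lambda>n x. \<Sum>k<n. T i (e k) x) (g i) sequentially" for i
  proof -
    have "uniform_limit (ball a t) (\<lambda>n x. \<Sum>k<n. T i (e k) x) (\<lambda>x. suminf (\<lambda>k. T i (e k) x)) sequentially"
      by (rule Weierstrass_m_test[OF _ M_e]) (rule T_le)
    then show ?thesis
      by (rule uniform_limit_cong'[THEN iffD1, rotated -1])
        (use g[THEN sums] in \<open>auto simp: sums_iff\<close>)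
  qed
  \<comment> \<open>The hypothesis of \<open>has_derivative_series\<close> concerns linear maps: an
    error below \<epsilon> / CARD('n) in each component adds up to at most \<epsilon> * norm
    h.\<close>
  have lim: "\<forall>\<^sub>F n in sequentially. \<forall>x\<in>ball a t. \<forall>h.
      norm ((\<Sum>k<n. \<Sum>i\<in>UNIV. h $ i * T i (e k) x) - (\<Sum>i\<in>UNIV. h $ i * g i x)) \<le> \<epsilon> * norm h"
    if "0 < \<epsilon>" for \<epsilon>
  proof -
    have "\<forall>\<^sub>F n in sequentially. \<forall>i. \<forall>x\<in>ball a t.
        dist (\<Sum>k<n. T i (e k) x) (g i x) < \<epsilon> / CARD('n)"
      using unif[THEN uniform_limitD, of "\<epsilon> / CARD('n)"] that
      by (intro eventually_all_finite) (auto simp: zero_less_card_finite)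
    then show ?thesis
    proof (rule eventually_mono, intro ballI allI)
      fix n x and h :: "real^'n"
      assume *: "\<forall>i. \<forall>x\<in>ball a t. dist (\<Sum>k<n. T i (e k) x) (g i x) < \<epsilon> / CARD('n)"
        and x: "x \<in> ball a t"
      have "(\<Sum>k<n. \<Sum>i\<in>UNIV. h $ i * T i (e k) x) - (\<Sum>i\<in>UNIV. h $ i * g i x)
          = (\<Sum>i\<in>UNIV. h $ i * ((\<Sum>k<n. T i (e k) x) - g i x))"
        by (subst sum.swap) (simp add: right_diff_distrib sum_subtractf sum_distrib_left)
      also have "norm \<dots> \<le> (\<Sum>i\<in>(UNIV::'n set). norm h * (\<epsilon> / CARD('n)))"
      proof (intro sum_norm_le)
        fix i :: 'n
        show "norm (h $ i * ((\<Sum>k<n. T i (e k) x) - g i x)) \<le> norm h * (\<epsilon> / CARD('n))"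
          unfolding norm_mult using *[rule_format, OF x, of i] component_le_norm_cart[of h i]
          by (intro mult_mono) (auto simp: dist_norm)
      qed
      also have "\<dots> = \<epsilon> * norm h"
        by simp
      finally show "norm ((\<Sum>k<n. \<Sum>i\<in>UNIV. h $ i * T i (e k) x) - (\<Sum>i\<in>UNIV. h $ i * g i x)) \<le> \<epsilon> * norm h" .
    qed
  qed
  have f_sums: "(\<lambda>n. c (e n) * (\<Prod>j\<in>UNIV. (x $ j - a $ j) ^ e n j)) sums f x" if "x \<in> ball a t" for x
    by (rule sums) (use ps that t in \<open>auto simp: power_series_on_def\<close>)
  have a: "a \<in> ball a t" using t by simp
  note series = has_derivative_series[where S = "ball a t"
      and f = "\<lambda>n x. c (e n) * (\<Prod>j\<in>UNIV. (x $ j - a $ j) ^ e n j)"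
      and f' = "\<lambda>n x h. \<Sum>i\<in>UNIV. h $ i * T i (e n) x"
      and g' = "\<lambda>x h. \<Sum>i\<in>UNIV. h $ i * g i x"]
  have "\<exists>F. \<forall>x\<in>ball a t. (\<lambda>n. c (e n) * (\<Prod>j\<in>UNIV. (x $ j - a $ j) ^ e n j)) sums F x \<and>
      (F has_derivative (\<lambda>h. \<Sum>i\<in>UNIV. h $ i * g i x)) (at x within ball a t)"
  proof (rule series[OF convex_ball _ _ a f_sums[OF a]])
    fix \<epsilon> :: real assume "0 < \<epsilon>"
    then show "\<forall>\<^sub>F n in sequentially. \<forall>x\<in>ball a t. \<forall>h.
        norm ((\<Sum>k<n. \<Sum>i\<in>UNIV. h $ i * T i (e k) x) - (\<Sum>i\<in>UNIV. h $ i * g i x)) \<le> \<epsilon> * norm h"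
      by (rule lim)
  qed (unfold T_def, rule has_derivative_monomial)
  then obtain F where F: "\<And>x. x \<in> ball a t \<Longrightarrow>
      (\<lambda>n. c (e n) * (\<Prod>j\<in>UNIV. (x $ j - a $ j) ^ e n j)) sums F x"
    "\<And>x. x \<in> ball a t \<Longrightarrow> (F has_derivative (\<lambda>h. \<Sum>i\<in>UNIV. h $ i * g i x)) (at x within ball a t)"
    by blast
  \<comment> \<open>The theorem on series yields some antiderivative F; uniqueness of sums
    identifies it with f on the ball.\<close>
  have "\<forall>x\<in>ball a t. (f has_derivative (\<lambda>h. \<Sum>i\<in>UNIV. h $ i * g i x)) (at x)"
  proof
    fix x assume x: "x \<in> ball a t"
    have "(F has_derivative (\<lambda>h. \<Sum>i\<in>UNIV. h $ i * g i x)) (at x)"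
      using F(2)[OF x] at_within_open[OF x open_ball] by simp
    then show "(f has_derivative (\<lambda>h. \<Sum>i\<in>UNIV. h $ i * g i x)) (at x)"
      by (rule has_derivative_transform_within_open[OF _ open_ball x])
        (rule sums_unique2[OF F(1) f_sums])
  qed
  then show ?thesis
    by (intro exI[of _ g] exI[of _ t] conjI allI t g_ps)
qed

section \<open>Partial derivatives of analytic functions\<close>

lemma has_derivative_axis:
  fixes f :: "real^'n \<Rightarrow> real"
  assumes "(f has_derivative (\<lambda>h. \<Sum>i\<in>UNIV. h $ i * G i)) (at x)"
  shows "((\<lambda>t. f (x + t *\<^sub>R axis i 1)) has_real_derivative G i) (at 0)"
proof -
  have 1: "((\<lambda>t::real. x + t *\<^sub>R axis i 1) has_derivative (\<lambda>t. t *\<^sub>R axis i 1)) (at 0)"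
    by (auto intro!: derivative_eq_intros)
  have "(f has_derivative (\<lambda>h. \<Sum>i\<in>UNIV. h $ i * G i)) (at (x + (0::real) *\<^sub>R axis i 1))"
    using assms by simp
  from has_derivative_compose[OF 1 this] show ?thesis
    unfolding has_field_derivative_def
    by (rule has_derivative_eq_rhs)
      (auto simp: fun_eq_iff axis_def if_distrib if_distribR sum.delta cong: if_cong)
qed

text \<open>\<open>deriv\<close> is meaningful only where a derivative exists, so values of
  \<open>partial_deriv\<close> are read off the components of a total derivative.\<close>

lemma partial_deriv_eqI:
  fixes f :: "real^'n \<Rightarrow> real"
  assumes "(f has_derivative (\<lambda>h. \<Sum>i\<in>UNIV. h $ i * G i)) (at x)"
  shows "partial_deriv i f x = G i"
  unfolding partial_deriv_def using DERIV_imp_deriv[OF has_derivative_axis[OF assms]] .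

text \<open>Openness keeps x + t e_i inside \<open>X\<close> for small t. This is what makes it
  legitimate to compare functions after restriction to \<open>X\<close>.\<close>

lemma partial_deriv_cong:
  fixes f g :: "real^'n \<Rightarrow> real"
  assumes X: "open X" "x \<in> X" and eq: "\<And>y. y \<in> X \<Longrightarrow> f y = g y"
  shows "partial_deriv i f x = partial_deriv i g x"
proof -
  have "((\<lambda>t::real. x + t *\<^sub>R axis i 1) \<longlongrightarrow> x + 0 *\<^sub>R axis i 1) (nhds 0)"
    by (intro tendsto_intros filterlim_ident)
  then have "\<forall>\<^sub>F t::real in nhds 0. x + t *\<^sub>R axis i 1 \<in> X"
    using X by (intro topological_tendstoD) auto
  then have "\<forall>\<^sub>F t::real in nhds 0. f (x + t *\<^sub>R axis i 1) = g (x + t *\<^sub>R axis i 1)"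
    by eventually_elim (rule eq)
  then show ?thesis
    unfolding partial_deriv_def by (rule deriv_cong_ev) simp
qed

lemma power_series_partial_deriv:
  fixes a :: "real^'n"
  assumes "0 < r" and "power_series_on f a r c"
  shows "\<exists>t>0. t \<le> r \<and> (\<forall>i. power_series_on (partial_deriv i f) a t (deriv_coeff i c)) \<and>
    (\<forall>x\<in>ball a t. (f has_derivative (\<lambda>h. \<Sum>i\<in>UNIV. h $ i * partial_deriv i f x)) (at x))"
proof -
  obtain g t where t: "0 < t" "t \<le> r" and g: "\<And>i. power_series_on (g i) a t (deriv_coeff i c)"
    and d: "\<And>x. x \<in> ball a t \<Longrightarrow> (f has_derivative (\<lambda>h. \<Sum>i\<in>UNIV. h $ i * g i x)) (at x)"
    using power_series_differentiable[OF assms] by blast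
  have eq: "partial_deriv i f x = g i x" if "x \<in> ball a t" for i x
    using partial_deriv_eqI[OF d[OF that]] .
  have 1: "power_series_on (partial_deriv i f) a t (deriv_coeff i c)" for i
    using g[of i] by (simp add: power_series_on_def eq)
  have 2: "(f has_derivative (\<lambda>h. \<Sum>i\<in>UNIV. h $ i * partial_deriv i f x)) (at x)"
    if "x \<in> ball a t" for x
    using d[OF that] by (simp add: eq[OF that])
  show ?thesis
    by (intro exI[of _ t] conjI allI ballI t 1 2)
qed

lemma real_analytic_on_iff:
  "real_analytic_on f X \<longleftrightarrow> (\<forall>a\<in>X. \<exists>c. \<exists>r>0. ball a r \<subseteq> X \<and> power_series_on f a r c)"
  by (simp add: real_analytic_on_def power_series_on_def)

lemma real_analytic_on_has_derivative:
  assumes "real_analytic_on f X" "x \<in> X"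
  shows "(f has_derivative (\<lambda>h. \<Sum>i\<in>UNIV. h $ i * partial_deriv i f x)) (at x)"
proof -
  obtain c r where "0 < r" "power_series_on f x r c"
    using assms unfolding real_analytic_on_iff by blast
  then obtain t where "0 < t"
    "\<forall>y\<in>ball x t. (f has_derivative (\<lambda>h. \<Sum>i\<in>UNIV. h $ i * partial_deriv i f y)) (at y)"
    using power_series_partial_deriv by blast
  then show ?thesis by simp
qed

lemma real_analytic_on_partial_deriv:
  assumes "real_analytic_on f X"
  shows "real_analytic_on (partial_deriv i f) X"
  unfolding real_analytic_on_iff
proof
  fix a assume "a \<in> X"
  then obtain c r where r: "0 < r" "ball a r \<subseteq> X" "power_series_on f a r c"
    using assms unfolding real_analytic_on_iff by blast
  obtain t where t: "0 < t" "t \<le> r" "\<And>i. power_series_on (partial_deriv i f) a t (deriv_coeff i c)"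
    using power_series_partial_deriv[OF r(1,3)] by auto
  then have "ball a t \<subseteq> X"
    using r(2) by auto
  with t show "\<exists>c. \<exists>r>0. ball a r \<subseteq> X \<and> power_series_on (partial_deriv i f) a r c"
    by blast
qed

lemma deriv_coeff_commute: "deriv_coeff i (deriv_coeff j c) = deriv_coeff j (deriv_coeff i c)"
  by (cases "i = j") (auto simp: deriv_coeff_def fun_eq_iff fun_upd_twist algebra_simps)

text \<open>Both iterated derivatives have power series at a with the same coefficients. Comparing
  them at the centre alone is enough, so their different radii never have to be reconciled.\<close>

lemma partial_deriv_commute:
  assumes "real_analytic_on f X" "a \<in> X"
  shows "partial_deriv i (partial_deriv j f) a = partial_deriv j (partial_deriv i f) a"
proof -
  obtain c r where r: "0 < r" "power_series_on f a r c"
    using assms unfolding real_analytic_on_iff by blast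
  obtain t where t: "0 < t" "\<And>i. power_series_on (partial_deriv i f) a t (deriv_coeff i c)"
    using power_series_partial_deriv[OF r] by auto
  have *: "((\<lambda>\<nu>. deriv_coeff i (deriv_coeff j c) \<nu> * (\<Prod>l\<in>UNIV. (a $ l - a $ l) ^ \<nu> l))
      has_sum partial_deriv i (partial_deriv j f) a) UNIV" for i j
  proof -
    obtain u where "0 < u" "power_series_on (partial_deriv i (partial_deriv j f)) a u
        (deriv_coeff i (deriv_coeff j c))"
      using power_series_partial_deriv[OF t(1) t(2)[of j]] by auto
    then show ?thesis
      unfolding power_series_on_def using centre_in_ball[of a u] by blast
  qed
  show ?thesis
    using *[of i j] *[of j i, unfolded deriv_coeff_commute[of j i]] by (rule has_sum_unique)
qed

section \<open>Mixed partial derivatives of higher order\<close>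

lemma real_analytic_on_funpow:
  assumes "real_analytic_on f X"
  shows "real_analytic_on ((partial_deriv i ^^ k) f) X"
  by (induction k) (auto intro: real_analytic_on_partial_deriv assms)

lemma funpow_partial_deriv_cong:
  assumes "open X" "\<And>y. y \<in> X \<Longrightarrow> f y = g y" "x \<in> X"
  shows "(partial_deriv i ^^ k) f x = (partial_deriv i ^^ k) g x"
  using assms(3)
proof (induction k arbitrary: x)
  case (Suc k)
  have "partial_deriv i ((partial_deriv i ^^ k) f) x = partial_deriv i ((partial_deriv i ^^ k) g) x"
    by (rule partial_deriv_cong[OF assms(1) Suc.prems Suc.IH])
  then show ?case by simp
qed (simp add: assms)

lemma partial_deriv_funpow_commute:
  assumes "open X" "real_analytic_on f X" "x \<in> X"
  shows "partial_deriv k ((partial_deriv i ^^ m) f) x = (partial_deriv i ^^ m) (partial_deriv k f) x"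
  using assms(3)
proof (induction m arbitrary: x)
  case (Suc m)
  have "partial_deriv k (partial_deriv i ((partial_deriv i ^^ m) f)) x
      = partial_deriv i (partial_deriv k ((partial_deriv i ^^ m) f)) x"
    by (rule partial_deriv_commute[OF real_analytic_on_funpow[OF assms(2)] Suc.prems])
  also have "\<dots> = partial_deriv i ((partial_deriv i ^^ m) (partial_deriv k f)) x"
    by (rule partial_deriv_cong[OF assms(1) Suc.prems Suc.IH])
  finally show ?case by simp
qed simp

lemma real_analytic_on_foldr:
  assumes "real_analytic_on f X"
  shows "real_analytic_on (foldr (\<lambda>i g. (partial_deriv i ^^ \<nu> i) g) is f) X"
proof (induction "is")
  case (Cons i "is")
  then show ?case by (simp add: real_analytic_on_funpow)
qed (simp add: assms)

lemma
  shows distinct_coord_order: "distinct (coord_order :: 'n::finite list)"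
    and set_coord_order: "set (coord_order :: 'n list) = UNIV"
proof -
  have "\<exists>is :: 'n list. distinct is \<and> set is = UNIV"
    using finite_distinct_list[of "UNIV :: 'n set"] by auto
  then have "distinct (coord_order :: 'n list) \<and> set (coord_order :: 'n list) = UNIV"
    unfolding coord_order_def by (rule someI_ex)
  then show "distinct (coord_order :: 'n list)" "set (coord_order :: 'n list) = UNIV" by auto
qed

text \<open>The derivative in direction k is moved inwards past the blocks of other directions until
  it meets its own block, where it raises the order by one.\<close>

lemma partial_deriv_foldr:
  assumes X: "open X" and f: "real_analytic_on f X"
    and "distinct is" "k \<in> set is" "x \<in> X"
  shows "partial_deriv k (foldr (\<lambda>i g. (partial_deriv i ^^ \<nu> i) g) is f) x
    = foldr (\<lambda>i g. (partial_deriv i ^^ (\<nu>(k := Suc (\<nu> k))) i) g) is f x"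
  using assms(3-)
proof (induction "is" arbitrary: x)
  case (Cons i "is")
  let ?F = "\<lambda>\<nu>. foldr (\<lambda>i g. (partial_deriv i ^^ \<nu> i) g) is f"
  show ?case
  proof (cases "i = k")
    case True
    \<comment> \<open>By distinctness k does not recur in the tail, which therefore does not see the
      update.\<close>
    then have "?F (\<nu>(k := Suc (\<nu> k))) = ?F \<nu>"
      using Cons.prems by (intro foldr_cong) auto
    with True show ?thesis by simp
  next
    case False
    have "partial_deriv k ((partial_deriv i ^^ \<nu> i) (?F \<nu>)) x
        = (partial_deriv i ^^ \<nu> i) (partial_deriv k (?F \<nu>)) x"
      by (rule partial_deriv_funpow_commute[OF X real_analytic_on_foldr[OF f] Cons.prems(3)])
    also have "\<dots> = (partial_deriv i ^^ \<nu> i) (?F (\<nu>(k := Suc (\<nu> k)))) x"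
    proof (rule funpow_partial_deriv_cong[OF X _ Cons.prems(3)])
      fix y assume "y \<in> X"
      with False Cons.prems(1,2) show "partial_deriv k (?F \<nu>) y = ?F (\<nu>(k := Suc (\<nu> k))) y"
        by (intro Cons.IH) auto
    qed
    finally show ?thesis using False by simp
  qed
qed simp

lemma real_analytic_on_multi_deriv:
  "real_analytic_on f X \<Longrightarrow> real_analytic_on (multi_deriv \<nu> f) X"
  unfolding multi_deriv_def by (rule real_analytic_on_foldr)

lemma partial_deriv_multi_deriv:
  assumes "open X" "real_analytic_on f X" "x \<in> X"
  shows "partial_deriv k (multi_deriv \<nu> f) x = multi_deriv (\<nu>(k := Suc (\<nu> k))) f x"
  unfolding multi_deriv_def
  by (rule partial_deriv_foldr[OF assms(1,2) distinct_coord_order _ assms(3)]) (simp add: set_coord_order)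

lemma multi_deriv_single: "multi_deriv ((\<lambda>_. 0)(k := l)) f = (partial_deriv k ^^ l) f"
proof -
  have "foldr (\<lambda>i g. (partial_deriv i ^^ ((\<lambda>_. 0)(k := l)) i) g) is f
      = (if k \<in> set is then (partial_deriv k ^^ l) f else f)" if "distinct is" for "is"
    using that by (induction "is") auto
  then show ?thesis
    by (simp add: multi_deriv_def distinct_coord_order set_coord_order)
qed

section \<open>Uniqueness of solutions\<close>

text \<open>Controlling differences only along the two curves under comparison avoids any convexity
  assumption on the state space.\<close>

definition lipschitz_along ::
  "nat \<Rightarrow> (real \<Rightarrow> nat \<Rightarrow> real) \<Rightarrow> (real \<Rightarrow> nat \<Rightarrow> real) \<Rightarrow> ((nat \<Rightarrow> real) \<Rightarrow> real) \<Rightarrow> bool" where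
  "lipschitz_along N w z u \<longleftrightarrow>
     continuous_on {0..1} (\<lambda>\<tau>. u (w \<tau>)) \<and> continuous_on {0..1} (\<lambda>\<tau>. u (z \<tau>)) \<and>
     (\<exists>L. \<forall>\<tau>\<in>{0..1}. \<bar>u (w \<tau>) - u (z \<tau>)\<bar> \<le> L * (\<Sum>j<N. \<bar>w \<tau> j - z \<tau> j\<bar>))"

section \<open>Lipschitz estimates along a pair of curves\<close>

lemma continuous_on_unit_bounded:
  assumes "continuous_on {0..1::real} (f :: real \<Rightarrow> real)"
  obtains B where "\<And>\<tau>. \<tau> \<in> {0..1} \<Longrightarrow> \<bar>f \<tau>\<bar> \<le> B" "0 \<le> B"
proof -
  have "bounded (f ` {0..1})"
    using compact_continuous_image[OF assms] by (intro compact_imp_bounded) simp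
  then obtain B where "0 < B" "\<forall>x\<in>f ` {0..1}. norm x \<le> B"
    unfolding bounded_pos by blast
  then show thesis using that[of B] by auto
qed

lemma lipschitz_alongI:
  assumes "continuous_on {0..1} (\<lambda>\<tau>. u (w \<tau>))" "continuous_on {0..1} (\<lambda>\<tau>. u (z \<tau>))"
    and "\<And>\<tau>. \<tau> \<in> {0..1} \<Longrightarrow> \<bar>u (w \<tau>) - u (z \<tau>)\<bar> \<le> L * (\<Sum>j<N. \<bar>w \<tau> j - z \<tau> j\<bar>)"
  shows "lipschitz_along N w z u"
  unfolding lipschitz_along_def by (intro conjI exI[of _ L] ballI assms)

lemma lipschitz_along_continuous:
  assumes "lipschitz_along N w z u"
  shows "continuous_on {0..1} (\<lambda>\<tau>. u (w \<tau>))" "continuous_on {0..1} (\<lambda>\<tau>. u (z \<tau>))"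
  using assms unfolding lipschitz_along_def by auto

lemma lipschitz_along_cong:
  assumes "lipschitz_along N w z u"
    and "\<And>\<tau>. \<tau> \<in> {0..1} \<Longrightarrow> u (w \<tau>) = v (w \<tau>)" "\<And>\<tau>. \<tau> \<in> {0..1} \<Longrightarrow> u (z \<tau>) = v (z \<tau>)"
  shows "lipschitz_along N w z v"
proof -
  have "continuous_on {0..1} (\<lambda>\<tau>. u (w \<tau>)) = continuous_on {0..1} (\<lambda>\<tau>. v (w \<tau>))"
    "continuous_on {0..1} (\<lambda>\<tau>. u (z \<tau>)) = continuous_on {0..1} (\<lambda>\<tau>. v (z \<tau>))"
    using assms by (auto intro!: continuous_on_cong)
  with assms show ?thesis unfolding lipschitz_along_def by simp
qed

lemma lipschitz_along_const: "lipschitz_along N w z (\<lambda>_. c)"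
  unfolding lipschitz_along_def by (auto intro!: exI[of _ 0])

lemma lipschitz_along_coord:
  assumes "continuous_on {0..1} (\<lambda>\<tau>. w \<tau> j)" "continuous_on {0..1} (\<lambda>\<tau>. z \<tau> j)" "j < N"
  shows "lipschitz_along N w z (\<lambda>x. x j)"
proof -
  have "\<bar>w \<tau> j - z \<tau> j\<bar> \<le> 1 * (\<Sum>j<N. \<bar>w \<tau> j - z \<tau> j\<bar>)" for \<tau>
    using member_le_sum[of j "{..<N}" "\<lambda>j. \<bar>w \<tau> j - z \<tau> j\<bar>"] assms(3) by simp
  then show ?thesis by (rule lipschitz_alongI[rotated 2]) (rule assms)+
qed

lemma lipschitz_along_add:
  assumes "lipschitz_along N w z u" "lipschitz_along N w z v"
  shows "lipschitz_along N w z (\<lambda>x. u x + v x)"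
proof -
  obtain L M where L: "\<forall>\<tau>\<in>{0..1}. \<bar>u (w \<tau>) - u (z \<tau>)\<bar> \<le> L * (\<Sum>j<N. \<bar>w \<tau> j - z \<tau> j\<bar>)"
    and M: "\<forall>\<tau>\<in>{0..1}. \<bar>v (w \<tau>) - v (z \<tau>)\<bar> \<le> M * (\<Sum>j<N. \<bar>w \<tau> j - z \<tau> j\<bar>)"
    using assms unfolding lipschitz_along_def by blast
  have "\<bar>(u (w \<tau>) + v (w \<tau>)) - (u (z \<tau>) + v (z \<tau>))\<bar> \<le> (L + M) * (\<Sum>j<N. \<bar>w \<tau> j - z \<tau> j\<bar>)"
    if "\<tau> \<in> {0..1}" for \<tau>
    using L[rule_format, OF that] M[rule_format, OF that] unfolding distrib_right by linarith
  then show ?thesis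
    by (rule lipschitz_alongI[rotated 2])
      (assumption | rule continuous_on_add lipschitz_along_continuous[OF assms(1)]
        lipschitz_along_continuous[OF assms(2)])+
qed

text \<open>The estimate needs bounds on the factors themselves. This is why
  \<open>lipschitz_along\<close> includes continuity along both curves: compactness of the interval
  then supplies B and C.\<close>

lemma lipschitz_along_mult:
  assumes "lipschitz_along N w z u" "lipschitz_along N w z v"
  shows "lipschitz_along N w z (\<lambda>x. u x * v x)"
proof -
  obtain L M where L: "\<forall>\<tau>\<in>{0..1}. \<bar>u (w \<tau>) - u (z \<tau>)\<bar> \<le> L * (\<Sum>j<N. \<bar>w \<tau> j - z \<tau> j\<bar>)"
    and M: "\<forall>\<tau>\<in>{0..1}. \<bar>v (w \<tau>) - v (z \<tau>)\<bar> \<le> M * (\<Sum>j<N. \<bar>w \<tau> j - z \<tau> j\<bar>)"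
    using assms unfolding lipschitz_along_def by blast
  obtain B where B: "\<And>\<tau>. \<tau> \<in> {0..1} \<Longrightarrow> \<bar>u (w \<tau>)\<bar> \<le> B" "0 \<le> B"
    using continuous_on_unit_bounded[OF lipschitz_along_continuous(1)[OF assms(1)]] by metis
  obtain C where C: "\<And>\<tau>. \<tau> \<in> {0..1} \<Longrightarrow> \<bar>v (z \<tau>)\<bar> \<le> C" "0 \<le> C"
    using continuous_on_unit_bounded[OF lipschitz_along_continuous(2)[OF assms(2)]] by metis
  have "\<bar>u (w \<tau>) * v (w \<tau>) - u (z \<tau>) * v (z \<tau>)\<bar> \<le> (B * M + C * L) * (\<Sum>j<N. \<bar>w \<tau> j - z \<tau> j\<bar>)"
    if \<tau>: "\<tau> \<in> {0..1}" for \<tau>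
  proof -
    have "u (w \<tau>) * v (w \<tau>) - u (z \<tau>) * v (z \<tau>)
        = u (w \<tau>) * (v (w \<tau>) - v (z \<tau>)) + v (z \<tau>) * (u (w \<tau>) - u (z \<tau>))"
      by (simp add: algebra_simps)
    then have "\<bar>u (w \<tau>) * v (w \<tau>) - u (z \<tau>) * v (z \<tau>)\<bar>
        \<le> \<bar>u (w \<tau>)\<bar> * \<bar>v (w \<tau>) - v (z \<tau>)\<bar> + \<bar>v (z \<tau>)\<bar> * \<bar>u (w \<tau>) - u (z \<tau>)\<bar>"
      by (metis abs_mult abs_triangle_ineq)
    also have "\<dots> \<le> B * (M * (\<Sum>j<N. \<bar>w \<tau> j - z \<tau> j\<bar>)) + C * (L * (\<Sum>j<N. \<bar>w \<tau> j - z \<tau> j\<bar>))"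
      using B C L M \<tau> by (intro add_mono mult_mono) auto
    finally show ?thesis by (simp add: algebra_simps)
  qed
  then show ?thesis
    by (rule lipschitz_alongI[rotated 2])
      (assumption | rule continuous_on_mult lipschitz_along_continuous[OF assms(1)]
        lipschitz_along_continuous[OF assms(2)])+
qed

text \<open>The denominator need not be bounded away from 0 on the state space; along the two curves
  compactness bounds its inverse.\<close>

lemma lipschitz_along_inverse:
  assumes u: "lipschitz_along N w z u"
    and nz: "\<And>\<tau>. \<tau> \<in> {0..1} \<Longrightarrow> u (w \<tau>) \<noteq> 0" "\<And>\<tau>. \<tau> \<in> {0..1} \<Longrightarrow> u (z \<tau>) \<noteq> 0"
  shows "lipschitz_along N w z (\<lambda>x. inverse (u x))"
proof -
  have cw: "continuous_on {0..1} (\<lambda>\<tau>. inverse (u (w \<tau>)))"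
    and cz: "continuous_on {0..1} (\<lambda>\<tau>. inverse (u (z \<tau>)))"
    using assms unfolding lipschitz_along_def by (auto intro!: continuous_on_inverse)
  obtain L where L: "\<forall>\<tau>\<in>{0..1}. \<bar>u (w \<tau>) - u (z \<tau>)\<bar> \<le> L * (\<Sum>j<N. \<bar>w \<tau> j - z \<tau> j\<bar>)"
    using u unfolding lipschitz_along_def by blast
  obtain B where B: "\<And>\<tau>. \<tau> \<in> {0..1} \<Longrightarrow> \<bar>inverse (u (w \<tau>))\<bar> \<le> B" "0 \<le> B"
    using continuous_on_unit_bounded[OF cw] by metis
  obtain C where C: "\<And>\<tau>. \<tau> \<in> {0..1} \<Longrightarrow> \<bar>inverse (u (z \<tau>))\<bar> \<le> C" "0 \<le> C"
    using continuous_on_unit_bounded[OF cz] by metis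
  have "\<bar>inverse (u (w \<tau>)) - inverse (u (z \<tau>))\<bar> \<le> (B * C * L) * (\<Sum>j<N. \<bar>w \<tau> j - z \<tau> j\<bar>)"
    if \<tau>: "\<tau> \<in> {0..1}" for \<tau>
  proof -
    have "inverse (u (w \<tau>)) - inverse (u (z \<tau>))
        = - (inverse (u (w \<tau>)) * (u (w \<tau>) - u (z \<tau>)) * inverse (u (z \<tau>)))"
      using nz[OF \<tau>] by (simp add: field_simps)
    then have "\<bar>inverse (u (w \<tau>)) - inverse (u (z \<tau>))\<bar>
        = (\<bar>inverse (u (w \<tau>))\<bar> * \<bar>inverse (u (z \<tau>))\<bar>) * \<bar>u (w \<tau>) - u (z \<tau>)\<bar>"
      by (simp add: abs_mult)
    also have "\<dots> \<le> (B * C) * (L * (\<Sum>j<N. \<bar>w \<tau> j - z \<tau> j\<bar>))"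
      using B C L \<tau> by (intro mult_mono) auto
    finally show ?thesis by (simp add: algebra_simps)
  qed
  then show ?thesis by (rule lipschitz_alongI[rotated 2]) (assumption | rule cw cz)+
qed

lemma lipschitz_along_sum:
  "(\<And>a. a \<in> A \<Longrightarrow> lipschitz_along N w z (f a)) \<Longrightarrow> lipschitz_along N w z (\<lambda>x. \<Sum>a\<in>A. f a x)"
proof (induction A rule: infinite_finite_induct)
  case (insert a A)
  then show ?case using lipschitz_along_add[of N w z "f a" "\<lambda>x. \<Sum>a\<in>A. f a x"] by simp
qed (simp_all add: lipschitz_along_const)

lemma lipschitz_along_poly_eval:
  assumes "\<And>j. j < N \<Longrightarrow> continuous_on {0..1} (\<lambda>\<tau>. w \<tau> j)"
    and "\<And>j. j < N \<Longrightarrow> continuous_on {0..1} (\<lambda>\<tau>. z \<tau> j)"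
    and "poly_vars p \<subseteq> {..<N}"
  shows "lipschitz_along N w z (\<lambda>x. poly_eval x p)"
  by (rule poly_fun_induct[OF assms(3)])
    (auto intro: lipschitz_along_const lipschitz_along_coord lipschitz_along_add
      lipschitz_along_mult assms)

lemma lipschitz_along_rational_fun:
  assumes "\<And>j. j < N \<Longrightarrow> continuous_on {0..1} (\<lambda>\<tau>. w \<tau> j)"
    and "\<And>j. j < N \<Longrightarrow> continuous_on {0..1} (\<lambda>\<tau>. z \<tau> j)"
    and "\<And>\<tau>. \<tau> \<in> {0..1} \<Longrightarrow> w \<tau> \<in> Z" "\<And>\<tau>. \<tau> \<in> {0..1} \<Longrightarrow> z \<tau> \<in> Z"
    and "rational_fun N Z f"
  shows "lipschitz_along N w z f"
proof -
  obtain a b where ab: "poly_vars a \<subseteq> {..<N}" "poly_vars b \<subseteq> {..<N}"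
    "\<forall>x\<in>Z. poly_eval x b \<noteq> 0 \<and> f x = poly_eval x a / poly_eval x b"
    using assms(5) unfolding rational_fun_def by blast
  have "lipschitz_along N w z (\<lambda>x. poly_eval x a * inverse (poly_eval x b))"
    using assms(3,4) ab
    by (intro lipschitz_along_mult lipschitz_along_inverse lipschitz_along_poly_eval assms(1,2)) auto
  then show ?thesis
    by (rule lipschitz_along_cong) (use assms(3,4) ab in \<open>auto simp: divide_inverse\<close>)
qed

text \<open>The factor exp (- K t) absorbs K E, so the product cannot increase; it starts at 0 and
  stays nonnegative, hence vanishes.\<close>

lemma gronwall_zero:
  fixes E :: "real \<Rightarrow> real"
  assumes E: "\<And>\<tau>. \<tau> \<in> {0..1} \<Longrightarrow> (E has_real_derivative E' \<tau>) (at \<tau> within {0..1})"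
    and bd: "\<And>\<tau>. \<tau> \<in> {0..1} \<Longrightarrow> E' \<tau> \<le> K * E \<tau>"
    and nonneg: "\<And>\<tau>. \<tau> \<in> {0..1} \<Longrightarrow> 0 \<le> E \<tau>" and "E 0 = 0" and \<tau>: "\<tau> \<in> {0..1}"
  shows "E \<tau> = 0"
proof -
  define g where "g = (\<lambda>t. E t * exp (- K * t))"
  have g: "(g has_real_derivative (E' t - K * E t) * exp (- K * t)) (at t within {0..\<tau>})"
    if "t \<in> {0..\<tau>}" for t
  proof -
    have "(E has_real_derivative E' t) (at t within {0..\<tau>})"
      by (rule DERIV_subset[OF E]) (use that \<tau> in auto)
    then show ?thesis
      unfolding g_def by (auto intro!: derivative_eq_intros simp: algebra_simps)
  qed
  obtain s where s: "s \<in> {0..\<tau>}" "g \<tau> - g 0 = (E' s - K * E s) * exp (- K * s) * (\<tau> - 0)"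
    using mvt_very_simple[of 0 \<tau> g "\<lambda>t h. (E' t - K * E t) * exp (- K * t) * h"] g \<tau>
    by (auto simp: has_field_derivative_def)
  have "E' s \<le> K * E s" using bd s \<tau> by auto
  then have "g \<tau> - g 0 \<le> 0"
    unfolding s(2) using \<tau> by (intro mult_nonpos_nonneg) auto
  then have "E \<tau> * exp (- K * \<tau>) \<le> 0"
    using \<open>E 0 = 0\<close> by (simp add: g_def)
  then have "E \<tau> \<le> 0"
    by (simp add: mult_le_0_iff)
  then show ?thesis using nonneg[OF \<tau>] by simp
qed

text \<open>Gronwall is applied to the sum of squares E, which, unlike the sum of absolute values,
  is differentiable. Rationality of F supplies the Lipschitz constants.\<close>

lemma ode_solution_unique:
  fixes F :: "(nat \<Rightarrow> real) \<Rightarrow> nat \<Rightarrow> 'n::finite \<Rightarrow> real"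
  assumes Z: "Z \<subseteq> topspace (Euclidean_space N)"
    and F: "\<And>j k. j < N \<Longrightarrow> rational_fun N Z (\<lambda>x. F x j k)"
    and w: "ode_solution N Z F z0 \<xi> w" and z: "ode_solution N Z F z0 \<xi> z" and \<tau>: "\<tau> \<in> {0..1}"
  shows "w \<tau> = z \<tau>"
proof -
  have inZ: "w t \<in> Z" "z t \<in> Z" if "t \<in> {0..1}" for t
    using w z that by (auto simp: ode_solution_def)
  define G where "G = (\<lambda>j x. \<Sum>k\<in>UNIV. F x j k * \<xi> $ k)"
  have dw: "((\<lambda>t. w t j) has_real_derivative G j (w t)) (at t within {0..1})"
    and dz: "((\<lambda>t. z t j) has_real_derivative G j (z t)) (at t within {0..1})"
    if "j < N" "t \<in> {0..1}" for j t
    using w z that by (auto simp: ode_solution_def G_def)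
  have cont: "continuous_on {0..1} (\<lambda>\<tau>. w \<tau> j)" "continuous_on {0..1} (\<lambda>\<tau>. z \<tau> j)" if "j < N" for j
    using DERIV_continuous_on[OF dw[OF that]] DERIV_continuous_on[OF dz[OF that]] by auto
  have "lipschitz_along N w z (G j)" if "j < N" for j
    unfolding G_def
    by (intro lipschitz_along_sum lipschitz_along_mult lipschitz_along_const
        lipschitz_along_rational_fun[where Z = Z] cont inZ F that)
  then have "\<forall>j<N. \<exists>L. \<forall>t\<in>{0..1}. \<bar>G j (w t) - G j (z t)\<bar> \<le> L * (\<Sum>i<N. \<bar>w t i - z t i\<bar>)"
    by (simp add: lipschitz_along_def)
  then obtain L where L: "\<And>j t. j < N \<Longrightarrow> t \<in> {0..1} \<Longrightarrow>
      \<bar>G j (w t) - G j (z t)\<bar> \<le> L j * (\<Sum>i<N. \<bar>w t i - z t i\<bar>)"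
    by metis
  \<comment> \<open>A single nonnegative constant that dominates every \<open>L j\<close>.\<close>
  define M where "M = (\<Sum>j<N. \<bar>L j\<bar>)"
  define E where "E = (\<lambda>t. \<Sum>j<N. (w t j - z t j)\<^sup>2)"
  define E' where "E' = (\<lambda>t. \<Sum>j<N. 2 * (w t j - z t j) * (G j (w t) - G j (z t)))"
  have "E \<tau> = 0"
  \<comment> \<open>The 2 comes from differentiating squares, M from the Lipschitz estimate, and N
    from bounding the squared sum of absolute values by N * E.\<close>
  proof (rule gronwall_zero[of E E' "2 * M * N"])
    fix t :: real assume t: "t \<in> {0..1}"
    show "(E has_real_derivative E' t) (at t within {0..1})"
      unfolding E_def E'_def
      by (rule DERIV_sum) (use dw dz t in \<open>auto intro!: derivative_eq_intros\<close>)
    let ?D = "\<Sum>i<N. \<bar>w t i - z t i\<bar>"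
    have "E' t \<le> (\<Sum>j<N. 2 * (\<bar>w t j - z t j\<bar> * (M * ?D)))"
      unfolding E'_def
    proof (rule sum_mono)
      fix j assume "j \<in> {..<N}"
      then have j: "j < N" by simp
      have "L j \<le> M"
        using member_le_sum[of j "{..<N}" "\<lambda>j. \<bar>L j\<bar>"] j by (simp add: M_def)
      then have "\<bar>G j (w t) - G j (z t)\<bar> \<le> M * ?D"
        using L[OF j t] by (meson mult_right_mono order_trans sum_nonneg abs_ge_zero)
      then have "\<bar>w t j - z t j\<bar> * \<bar>G j (w t) - G j (z t)\<bar> \<le> \<bar>w t j - z t j\<bar> * (M * ?D)"
        by (rule mult_left_mono) simp
      moreover have "(w t j - z t j) * (G j (w t) - G j (z t)) \<le> \<bar>w t j - z t j\<bar> * \<bar>G j (w t) - G j (z t)\<bar>"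
        by (metis abs_ge_self abs_mult)
      ultimately show "2 * (w t j - z t j) * (G j (w t) - G j (z t)) \<le> 2 * (\<bar>w t j - z t j\<bar> * (M * ?D))"
        by linarith
    qed
    also have "\<dots> = 2 * M * ?D\<^sup>2"
      by (simp add: sum_distrib_left sum_distrib_right power2_eq_square algebra_simps)
    also have "\<dots> \<le> 2 * M * (N * E t)"
    proof (rule mult_left_mono)
      show "?D\<^sup>2 \<le> N * E t"
        using sum_squared_le_sum_of_squares[of "\<lambda>i. \<bar>w t i - z t i\<bar>" "{..<N}"]
        by (simp add: E_def mult.commute)
      show "0 \<le> 2 * M" by (simp add: M_def sum_nonneg)
    qed
    finally show "E' t \<le> 2 * M * N * E t" by (simp add: algebra_simps)
    show "0 \<le> E t" by (simp add: E_def sum_nonneg)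
  next
    show "E 0 = 0"
      using w z by (simp add: E_def ode_solution_def)
  qed (rule \<tau>)
  then have "\<forall>j<N. w \<tau> j = z \<tau> j"
    by (simp add: E_def sum_nonneg_eq_0_iff)
  \<comment> \<open>E controls only the first N coordinates; the rest vanish for points of
    \<open>Euclidean_space N\<close>.\<close>
  moreover have "w \<tau> j = z \<tau> j" if "N \<le> j" for j
  proof -
    have "w \<tau> \<in> topspace (Euclidean_space N)" "z \<tau> \<in> topspace (Euclidean_space N)"
      using inZ[OF \<tau>] Z by auto
    with that show ?thesis by (simp add: topspace_Euclidean_space)
  qed
  ultimately show ?thesis
    by (metis ext not_le_imp_less)
qed

section \<open>From an explicit curve to a FISCIDS representation\<close>

lemma FISCIDS_I:
  fixes F :: "(nat \<Rightarrow> real) \<Rightarrow> nat \<Rightarrow> 'n::finite \<Rightarrow> real"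
  assumes "openin (Euclidean_space N) Z" "z0 \<in> Z"
    and "\<And>j k. j < N \<Longrightarrow> rational_fun N Z (\<lambda>x. F x j k)"
    and "\<And>\<xi>. \<xi> \<in> X \<Longrightarrow> ode_solution N Z F z0 \<xi> (c \<xi>)"
    and "\<And>\<xi>. \<xi> \<in> X \<Longrightarrow> h (c \<xi> 1) = \<phi> \<xi>"
  shows "FISCIDS N Z F h z0 X \<phi>"
  unfolding FISCIDS_def
proof (intro conjI ballI assms(1,2))
  fix \<xi> assume \<xi>: "\<xi> \<in> X"
  show "\<exists>z. ode_solution N Z F z0 \<xi> z \<and>
      (\<forall>w. ode_solution N Z F z0 \<xi> w \<longrightarrow> (\<forall>\<tau>\<in>{0..1}. w \<tau> = z \<tau>)) \<and> h (z 1) = \<phi> \<xi>"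
  proof (intro exI[of _ "c \<xi>"] conjI allI impI ballI)
    show "ode_solution N Z F z0 \<xi> (c \<xi>)" "h (c \<xi> 1) = \<phi> \<xi>"
      using assms(4,5)[OF \<xi>] by auto
    show "w \<tau> = c \<xi> \<tau>" if "ode_solution N Z F z0 \<xi> w" "\<tau> \<in> {0..1}" for w \<tau>
      by (rule ode_solution_unique[of Z N F, OF openin_subset[OF assms(1)] assms(3) that(1) assms(4)[OF \<xi>] that(2)])
  qed
qed

lemma polynomial_fun_imp_rational_fun: "polynomial_fun N Z f \<Longrightarrow> rational_fun N Z f"
proof -
  assume "polynomial_fun N Z f"
  then obtain a where "poly_vars a \<subseteq> {..<N}" "\<forall>z\<in>Z. f z = poly_eval z a"
    unfolding polynomial_fun_def by blast
  then show ?thesis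
    unfolding rational_fun_def by (intro exI[of _ a] exI[of _ 1]) simp
qed

lemma polynomial_fun_deg_le_imp_polynomial_fun:
  "polynomial_fun_deg_le d N Z f \<Longrightarrow> polynomial_fun N Z f"
  unfolding polynomial_fun_def polynomial_fun_deg_le_def by blast

text \<open>Nonvanishing of finitely many polynomials is open in the product topology, and
  \<open>Z_R\<close> is the trace of this set on the Euclidean subspace.\<close>

lemma openin_Z_R:
  fixes d :: "'n::finite \<Rightarrow> nat rpoly"
  shows "openin (Euclidean_space N) (Z_R N d)"
proof -
  have "continuous_on UNIV (\<lambda>z::nat \<Rightarrow> real. poly_eval z p)" for p
    by (rule poly_fun_induct[OF subset_UNIV])
      (auto intro!: continuous_intros continuous_on_product_coordinates)
  then have "open {z. poly_eval z (d k) \<noteq> 0}" for k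
    by (intro open_Collect_neq) auto
  then have "open (\<Inter>k. {z. poly_eval z (d k) \<noteq> 0})"
    by (intro open_INT) auto
  moreover have "Z_R N d = (\<Inter>k. {z. poly_eval z (d k) \<noteq> 0}) \<inter> {x. \<forall>i\<ge>N. x i = 0}"
    by (auto simp: Z_R_def topspace_Euclidean_space)
  ultimately show ?thesis
    unfolding Euclidean_space_def openin_subtopology euclidean_product_topology
    by (intro exI conjI) (auto simp: open_openin[symmetric])
qed

section \<open>The algebra generated by the derivatives\<close>

text \<open>This is total differentiability, with the derivative expressed through
  \<open>partial_deriv\<close>; mere existence of partial derivatives would not give the chain rule
  along rays.\<close>

definition partially_differentiable :: "(real^'n \<Rightarrow> real) \<Rightarrow> real^'n \<Rightarrow> bool" where
  "partially_differentiable f x \<longleftrightarrow>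
     (f has_derivative (\<lambda>h. \<Sum>i\<in>UNIV. h $ i * partial_deriv i f x)) (at x)"

lemma partially_differentiableI:
  assumes "(f has_derivative (\<lambda>h. \<Sum>i\<in>UNIV. h $ i * G i)) (at x)"
  shows "partially_differentiable f x"
  using assms partial_deriv_eqI[OF assms] by (simp add: partially_differentiable_def)

section \<open>Differentiation rules in terms of partial derivatives\<close>

lemma has_derivative_cong_open:
  assumes "(f has_derivative D) (at x)" "open X" "x \<in> X" "\<And>y. y \<in> X \<Longrightarrow> f y = g y"
  shows "(g has_derivative D) (at x)"
  using has_derivative_transform_within_open[OF assms(1-3)] assms(4) by blast

lemma partially_differentiable_cong:
  assumes "partially_differentiable f x" "open X" "x \<in> X" "\<And>y. y \<in> X \<Longrightarrow> f y = g y"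
  shows "partially_differentiable g x"
  using has_derivative_cong_open[OF assms(1)[unfolded partially_differentiable_def] assms(2-4)]
  by (rule partially_differentiableI)

lemma has_derivative_coord:
  "((\<lambda>x::real^'n. x $ i) has_derivative (\<lambda>h. \<Sum>j\<in>UNIV. h $ j * (if j = i then 1 else 0))) (at x)"
  using bounded_linear.has_derivative[OF bounded_linear_vec_nth has_derivative_ident, of i]
  by (simp add: if_distrib sum.delta cong: if_cong)

lemma has_derivative_const_partial:
  "((\<lambda>x::real^'n. c) has_derivative (\<lambda>h. \<Sum>j\<in>UNIV. h $ j * 0)) (at x)"
  by simp

lemma has_derivative_add_partial:
  assumes "partially_differentiable f x" "partially_differentiable g x"
  shows "((\<lambda>x. f x + g x) has_derivative
    (\<lambda>h. \<Sum>i\<in>UNIV. h $ i * (partial_deriv i f x + partial_deriv i g x))) (at x)"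
  by (rule has_derivative_eq_rhs[OF has_derivative_add[OF assms[unfolded partially_differentiable_def]]])
    (simp add: fun_eq_iff distrib_left sum.distrib)

lemma has_derivative_mult_partial:
  assumes "partially_differentiable f x" "partially_differentiable g x"
  shows "((\<lambda>x. f x * g x) has_derivative
    (\<lambda>h. \<Sum>i\<in>UNIV. h $ i * (f x * partial_deriv i g x + partial_deriv i f x * g x))) (at x)"
  by (rule has_derivative_eq_rhs[OF has_derivative_mult[OF assms[unfolded partially_differentiable_def]]])
    (simp add: fun_eq_iff distrib_left sum.distrib sum_distrib_left sum_distrib_right algebra_simps)

lemma has_derivative_inverse_partial:
  assumes "partially_differentiable f x" "f x \<noteq> 0"
  shows "((\<lambda>x. 1 / f x) has_derivative
    (\<lambda>h. \<Sum>i\<in>UNIV. h $ i * (- (1 / f x * (1 / f x)) * partial_deriv i f x))) (at x)"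
proof -
  have "((\<lambda>x. inverse (f x)) has_derivative
     (\<lambda>h. - (inverse (f x) * (\<Sum>i\<in>UNIV. h $ i * partial_deriv i f x) * inverse (f x)))) (at x)"
    by (rule Deriv.has_derivative_inverse[OF assms(2) assms(1)[unfolded partially_differentiable_def]])
  then have "((\<lambda>x. 1 / f x) has_derivative
     (\<lambda>h. - (inverse (f x) * (\<Sum>i\<in>UNIV. h $ i * partial_deriv i f x) * inverse (f x)))) (at x)"
    by (simp add: divide_inverse)
  then show ?thesis
    by (rule has_derivative_eq_rhs)
      (simp add: fun_eq_iff sum_distrib_left sum_distrib_right sum_negf[symmetric] divide_inverse algebra_simps)
qed

text \<open>The velocity of the ray is \<xi> itself, so the derivative is the row of partial
  derivatives times \<xi>. This is the origin of the form z' = F(z) \<xi>.\<close>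

lemma partially_differentiable_ray:
  fixes f :: "real^'n \<Rightarrow> real"
  assumes "partially_differentiable f (\<tau> *\<^sub>R \<xi>)"
  shows "((\<lambda>t. f (t *\<^sub>R \<xi>)) has_real_derivative (\<Sum>k\<in>UNIV. partial_deriv k f (\<tau> *\<^sub>R \<xi>) * \<xi> $ k)) (at \<tau>)"
proof -
  have 1: "((\<lambda>t::real. t *\<^sub>R \<xi>) has_derivative (\<lambda>t. t *\<^sub>R \<xi>)) (at \<tau>)"
    by (auto intro!: derivative_eq_intros)
  show ?thesis
    unfolding has_field_derivative_def
    by (rule has_derivative_eq_rhs[OF has_derivative_compose[OF 1 assms[unfolded partially_differentiable_def]]])
      (simp add: fun_eq_iff sum_distrib_left sum_distrib_right algebra_simps)
qed

text \<open>The rule \<open>cong\<close> identifies functions that agree on \<open>X\<close>, so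
  total functions can serve as functions on \<open>X\<close> with arbitrary values
  elsewhere.\<close>

inductive fun_alg :: "'a set \<Rightarrow> ('a \<Rightarrow> real) set \<Rightarrow> ('a \<Rightarrow> real) \<Rightarrow> bool" for X G where
  gen: "g \<in> G \<Longrightarrow> fun_alg X G g"
| const: "fun_alg X G (\<lambda>_. c)"
| add: "fun_alg X G f \<Longrightarrow> fun_alg X G g \<Longrightarrow> fun_alg X G (\<lambda>x. f x + g x)"
| mult: "fun_alg X G f \<Longrightarrow> fun_alg X G g \<Longrightarrow> fun_alg X G (\<lambda>x. f x * g x)"
| cong: "fun_alg X G f \<Longrightarrow> (\<And>x. x \<in> X \<Longrightarrow> f x = g x) \<Longrightarrow> fun_alg X G g"

lemma fun_alg_mono:
  assumes "fun_alg X G f" "G \<subseteq> H"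
  shows "fun_alg X H f"
  using assms(1)
proof induction
  case (cong f g)
  show ?case by (rule fun_alg.cong[OF cong.IH cong.hyps(2)])
qed (use assms(2) in \<open>auto intro: fun_alg.gen fun_alg.const fun_alg.add fun_alg.mult\<close>)

lemma fun_alg_sum:
  "(\<And>a. a \<in> A \<Longrightarrow> fun_alg X G (f a)) \<Longrightarrow> fun_alg X G (\<lambda>x. \<Sum>a\<in>A. f a x)"
proof (induction A rule: infinite_finite_induct)
  case (insert a A)
  then show ?case using fun_alg.add[of X G "f a" "\<lambda>x. \<Sum>a\<in>A. f a x"] by simp
qed (simp_all add: fun_alg.const)

lemma fun_alg_poly_eval:
  assumes "poly_vars p \<subseteq> V" "\<And>v. v \<in> V \<Longrightarrow> fun_alg X G (\<lambda>x. c x v)"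
  shows "fun_alg X G (\<lambda>x. poly_eval (c x) p)"
  by (rule poly_fun_induct[OF assms(1)]) (auto intro: fun_alg.const fun_alg.add fun_alg.mult assms(2))

text \<open>By the Leibniz rule a derivation is determined by the generators. \<open>H\<close> may
  differ from \<open>G\<close> because differentiation raises orders. Differentiability and
  membership in \<open>H\<close> are carried along since the product rule consumes both.\<close>

lemma fun_alg_partial_deriv:
  fixes X :: "(real^'n) set"
  assumes X: "open X" and f: "fun_alg X G f"
    and diff: "\<And>g x. g \<in> G \<Longrightarrow> x \<in> X \<Longrightarrow> partially_differentiable g x"
    and GH: "\<And>g. g \<in> G \<Longrightarrow> fun_alg X H g"
    and dGH: "\<And>g. g \<in> G \<Longrightarrow> fun_alg X H (partial_deriv i g)"
  shows "(\<forall>x\<in>X. partially_differentiable f x) \<and> fun_alg X H f \<and> fun_alg X H (partial_deriv i f)"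
  using f
proof induction
  case (gen g)
  then show ?case using diff GH dGH by blast
next
  case (const c)
  have "partial_deriv i (\<lambda>_. c) = (\<lambda>_. 0)"
    using partial_deriv_eqI[OF has_derivative_const_partial] by blast
  then show ?case
    using partially_differentiableI[OF has_derivative_const_partial] by (auto intro: fun_alg.const)
next
  case (add f g)
  have d: "((\<lambda>x. f x + g x) has_derivative
      (\<lambda>h. \<Sum>i\<in>UNIV. h $ i * (partial_deriv i f x + partial_deriv i g x))) (at x)" if "x \<in> X" for x
    using add.IH that by (intro has_derivative_add_partial) auto
  have "fun_alg X H (partial_deriv i (\<lambda>x. f x + g x))"
    by (rule fun_alg.cong[of X H "\<lambda>x. partial_deriv i f x + partial_deriv i g x"])
      (use add.IH partial_deriv_eqI[OF d] in \<open>auto intro: fun_alg.add\<close>)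
  then show ?case
    using add.IH partially_differentiableI[OF d] by (auto intro: fun_alg.add)
next
  case (mult f g)
  have d: "((\<lambda>x. f x * g x) has_derivative
      (\<lambda>h. \<Sum>i\<in>UNIV. h $ i * (f x * partial_deriv i g x + partial_deriv i f x * g x))) (at x)" if "x \<in> X" for x
    using mult.IH that by (intro has_derivative_mult_partial) auto
  have "fun_alg X H (partial_deriv i (\<lambda>x. f x * g x))"
    by (rule fun_alg.cong[of X H "\<lambda>x. f x * partial_deriv i g x + partial_deriv i f x * g x"])
      (use mult.IH partial_deriv_eqI[OF d] in \<open>auto intro!: fun_alg.add fun_alg.mult\<close>)
  then show ?case
    using mult.IH partially_differentiableI[OF d] by (auto intro: fun_alg.mult)
next
  case (cong f g)
  have "partial_deriv i f x = partial_deriv i g x" if "x \<in> X" for x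
    by (rule partial_deriv_cong[OF X that cong.hyps(2)])
  then have "fun_alg X H (partial_deriv i g)"
    using cong.IH fun_alg.cong by blast
  moreover have "fun_alg X H g"
    using cong.IH cong.hyps(2) fun_alg.cong by blast
  moreover have "partially_differentiable g x" if "x \<in> X" for x
    using cong.IH that by (intro partially_differentiable_cong[OF _ X that cong.hyps(2)]) auto
  ultimately show ?case by blast
qed

text \<open>The set \<A> before restriction to \<open>X\<close>, with the bound on the orders as a
  parameter, since the induction on orders has to vary it.\<close>

definition base_gens :: "(real^'n \<Rightarrow> real) \<Rightarrow> ('n \<Rightarrow> nat) \<Rightarrow> (real^'n \<Rightarrow> real) set" where
  "base_gens \<phi> \<nu> = range (\<lambda>i x. x $ i) \<union> {multi_deriv \<mu> \<phi> |\<mu>. \<forall>i. \<mu> i \<le> \<nu> i}"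

text \<open>The name is the one of differential algebra. \<open>Delta\<close> is the same polynomial
  with its variables renamed to state coordinates.\<close>

definition separant ::
  "(real^'n \<Rightarrow> real) \<Rightarrow> ('n \<Rightarrow> ('n + nat) rpoly) \<Rightarrow> ('n \<Rightarrow> nat) \<Rightarrow> 'n \<Rightarrow> real^'n \<Rightarrow> real" where
  "separant \<phi> p \<rho> k x = poly_eval (cert_point \<phi> k x) (poly_pderiv (Inr (\<rho> k)) (p k))"

lemma base_gens_mono: "(\<And>i. \<nu> i \<le> \<mu> i) \<Longrightarrow> base_gens \<phi> \<nu> \<subseteq> base_gens \<phi> \<mu>"
  unfolding base_gens_def by (intro Un_mono subset_refl) (blast intro: order_trans)

lemma partially_differentiable_base_gens:
  assumes "real_analytic_on \<phi> X" "g \<in> base_gens \<phi> \<nu>" "x \<in> X"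
  shows "partially_differentiable g x"
  using assms(2)
proof (unfold base_gens_def, elim UnE)
  assume "g \<in> range (\<lambda>i x. x $ i)"
  then show ?thesis using partially_differentiableI[OF has_derivative_coord] by auto
next
  assume "g \<in> {multi_deriv \<mu> \<phi> |\<mu>. \<forall>i. \<mu> i \<le> \<nu> i}"
  then show ?thesis
    using real_analytic_on_has_derivative[OF real_analytic_on_multi_deriv[OF assms(1)] assms(3)]
    by (auto simp: partially_differentiable_def)
qed

lemma fun_alg_partial_deriv_base_gens:
  assumes X: "open X" "real_analytic_on \<phi> X" and g: "g \<in> base_gens \<phi> \<nu>"
    and H: "base_gens \<phi> (\<nu>(i := Suc (\<nu> i))) \<subseteq> H"
  shows "fun_alg X H (partial_deriv i g)"
  using g
proof (unfold base_gens_def, elim UnE)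
  assume "g \<in> range (\<lambda>i x. x $ i)"
  then obtain j where "g = (\<lambda>x. x $ j)" by auto
  then have "partial_deriv i g = (\<lambda>_. if i = j then 1 else 0)"
    using partial_deriv_eqI[OF has_derivative_coord] by blast
  then show ?thesis by (simp add: fun_alg.const)
next
  assume "g \<in> {multi_deriv \<mu> \<phi> |\<mu>. \<forall>i. \<mu> i \<le> \<nu> i}"
  then obtain \<mu> where \<mu>: "g = multi_deriv \<mu> \<phi>" "\<forall>i. \<mu> i \<le> \<nu> i" by auto
  show ?thesis
  proof (rule fun_alg.cong)
    show "fun_alg X H (multi_deriv (\<mu>(i := Suc (\<mu> i))) \<phi>)"
      using \<mu>(2) H by (intro fun_alg.gen) (force simp: base_gens_def)
    show "multi_deriv (\<mu>(i := Suc (\<mu> i))) \<phi> x = partial_deriv i g x" if "x \<in> X" for x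
      using partial_deriv_multi_deriv[OF X that] \<mu>(1) by simp
  qed
qed

lemma funpow_partial_deriv_in_base_gens:
  "l \<le> \<nu> k \<Longrightarrow> (partial_deriv k ^^ l) \<phi> \<in> base_gens \<phi> \<nu>"
  unfolding base_gens_def multi_deriv_single[symmetric] by auto

lemma fun_alg_cert_poly:
  fixes k :: "'n::finite"
  assumes "poly_vars q \<subseteq> range Inl \<union> Inr ` {..\<nu> k}" "base_gens \<phi> \<nu> \<subseteq> H"
  shows "fun_alg X H (\<lambda>x. poly_eval (cert_point \<phi> k x) q)"
proof (rule fun_alg_poly_eval[OF assms(1)])
  fix v :: "'n + nat" assume "v \<in> range Inl \<union> Inr ` {..\<nu> k}"
  then have "(\<lambda>x. cert_point \<phi> k x v) \<in> base_gens \<phi> \<nu>"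
  proof
    assume "v \<in> range Inl"
    then show ?thesis by (auto simp: cert_point_def base_gens_def)
  next
    assume "v \<in> Inr ` {..\<nu> k}"
    then show ?thesis by (auto simp: cert_point_def funpow_partial_deriv_in_base_gens)
  qed
  then show "fun_alg X H (\<lambda>x. cert_point \<phi> k x v)"
    using assms(2) by (intro fun_alg.gen) auto
qed

section \<open>Consequences of a nonsingular DA certificate\<close>

context
  fixes X :: "(real^'n) set" and \<phi> :: "real^'n \<Rightarrow> real"
    and p :: "'n \<Rightarrow> ('n + nat) rpoly" and \<rho> :: "'n \<Rightarrow> nat"
  assumes X: "open X" and cert: "nonsingular_DA_certificate X \<phi> p \<rho>"
begin

lemma certificate_analytic: "real_analytic_on \<phi> X"
  using cert by (simp add: nonsingular_DA_certificate_def)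

lemma certificate_vars: "poly_vars (p k) \<subseteq> range Inl \<union> Inr ` {..\<rho> k}"
  using cert by (simp add: nonsingular_DA_certificate_def)

lemma certificate_vanishes: "x \<in> X \<Longrightarrow> poly_eval (cert_point \<phi> k x) (p k) = 0"
  using cert by (simp add: nonsingular_DA_certificate_def)

lemma separant_nonzero: "x \<in> X \<Longrightarrow> separant \<phi> p \<rho> k x \<noteq> 0"
  using cert by (simp add: nonsingular_DA_certificate_def separant_def)

text \<open>p_k vanishes along the line through x in direction k, so its derivative there is 0. By
  the chain rule the derivative of order \<rho> k + 1 enters linearly, with the separant as its
  coefficient.\<close>

lemma certificate_differentiated:
  assumes x: "x \<in> X"
  shows "separant \<phi> p \<rho> k x * (partial_deriv k ^^ Suc (\<rho> k)) \<phi> x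
    = - (poly_eval (cert_point \<phi> k x) (poly_pderiv (Inl k) (p k)) +
        (\<Sum>l<\<rho> k. poly_eval (cert_point \<phi> k x) (poly_pderiv (Inr l) (p k)) * (partial_deriv k ^^ Suc l) \<phi> x))"
proof -
  define V :: "('n + nat) set" where "V = range Inl \<union> Inr ` {..\<rho> k}"
  define c where "c = (\<lambda>t::real. cert_point \<phi> k (x + t *\<^sub>R axis k 1))"
  \<comment> \<open>Velocity of the certificate point: among the coordinates only \<xi>_k moves, and
    each Y_l moves with the derivative of next order.\<close>
  define c' where "c' = case_sum (\<lambda>j. if j = k then 1 else 0) (\<lambda>l. (partial_deriv k ^^ Suc l) \<phi> x)"
  have c0: "c 0 = cert_point \<phi> k x" by (simp add: c_def)
  have "((\<lambda>t. poly_eval (c t) (p k)) has_real_derivative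
      (\<Sum>v\<in>V. poly_eval (c 0) (poly_pderiv v (p k)) * c' v)) (at 0)"
  proof (rule poly_eval_chain)
    show "finite V" "poly_vars (p k) \<subseteq> V"
      using certificate_vars by (auto simp: V_def)
    fix v assume "v \<in> V"
    show "((\<lambda>t. c t v) has_real_derivative c' v) (at 0)"
    proof (cases v)
      case (Inl j)
      have "((\<lambda>t. (x + t *\<^sub>R axis k 1) $ j) has_real_derivative (if k = j then 1 else 0)) (at 0)"
        by (rule has_derivative_axis[OF has_derivative_coord])
      then show ?thesis
        by (simp add: Inl c_def c'_def cert_point_def eq_commute)
    next
      case (Inr l)
      show ?thesis
        using has_derivative_axis[OF real_analytic_on_has_derivative[OF
              real_analytic_on_funpow[OF certificate_analytic] x]]
        by (simp add: Inr c_def c'_def cert_point_def)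
    qed
  qed
  moreover have "((\<lambda>t. poly_eval (c t) (p k)) has_real_derivative 0) (at 0)"
  proof -
    have "((\<lambda>t::real. x + t *\<^sub>R axis k 1) \<longlongrightarrow> x + 0 *\<^sub>R axis k 1) (nhds 0)"
      by (intro tendsto_intros filterlim_ident)
    then have "\<forall>\<^sub>F t::real in nhds 0. x + t *\<^sub>R axis k 1 \<in> X"
      using X x by (intro topological_tendstoD) auto
    then have "\<forall>\<^sub>F t::real in nhds 0. poly_eval (c t) (p k) = 0"
      by eventually_elim (simp add: c_def certificate_vanishes)
    then show ?thesis
      by (subst DERIV_cong_ev[OF refl _ refl, where g = "\<lambda>_. 0"]) auto
  qed
  ultimately have "(\<Sum>v\<in>V. poly_eval (c 0) (poly_pderiv v (p k)) * c' v) = 0"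
    by (rule DERIV_unique)
  also have "(\<Sum>v\<in>V. poly_eval (c 0) (poly_pderiv v (p k)) * c' v)
      = (\<Sum>j\<in>UNIV. poly_eval (c 0) (poly_pderiv (Inl j) (p k)) * c' (Inl j))
      + (\<Sum>l\<le>\<rho> k. poly_eval (c 0) (poly_pderiv (Inr l) (p k)) * c' (Inr l))"
    unfolding V_def by (subst sum.union_disjoint) (auto simp: sum.reindex)
  \<comment> \<open>The summand l = \<rho> k carries the separant; the others involve orders at most
    \<rho> k.\<close>
  finally show ?thesis
    by (simp add: c'_def c0 separant_def if_distrib sum.delta lessThan_Suc_atMost[symmetric] cong: if_cong)
qed

text \<open>Differentiating \<open>p\<^sub>k = 0\<close> along \<open>\<xi>\<^sub>k\<close> gives the case \<open>\<nu> = 0\<close>.  A further \<open>\<partial>/\<partial>\<xi>\<^sub>i\<close> with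
  \<open>i \<noteq> k\<close> raises only the orders of differentiation in \<open>\<xi>\<^sub>i\<close>, so the order in \<open>\<xi>\<^sub>k\<close> never
  exceeds \<open>\<rho> k\<close> on the right-hand side.\<close>

lemma highest_derivative_in_alg:
  "fun_alg X (insert (\<lambda>x. 1 / separant \<phi> p \<rho> k x) (base_gens \<phi> (\<nu>(k := \<rho> k))))
     (multi_deriv (\<nu>(k := Suc (\<rho> k))) \<phi>)"
\<comment> \<open>The induction is on the total order in the variables other than \<xi>_k; the entry
  \<nu> k is overwritten throughout and does not count.\<close>
proof (induction "\<Sum>i\<in>UNIV - {k}. \<nu> i" arbitrary: \<nu>)
  case 0
  then have *: "\<nu>(k := m) = (\<lambda>_. 0)(k := m)" for m by auto
  let ?H = "insert (\<lambda>x. 1 / separant \<phi> p \<rho> k x) (base_gens \<phi> (\<nu>(k := \<rho> k)))"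
  let ?ev = "\<lambda>v x. poly_eval (cert_point \<phi> k x) (poly_pderiv v (p k))"
  have vars: "poly_vars (poly_pderiv v (p k)) \<subseteq> range Inl \<union> Inr ` {..(\<nu>(k := \<rho> k)) k}" for v
    using poly_vars_pderiv[of v "p k"] certificate_vars[of k] by auto
  have ev: "fun_alg X ?H (?ev v)" for v
    by (rule fun_alg_cert_poly[where \<nu> = "\<nu>(k := \<rho> k)"]) (use vars in auto)
  have gen: "fun_alg X ?H (\<lambda>x. (partial_deriv k ^^ Suc l) \<phi> x)" if "l < \<rho> k" for l
    by (rule fun_alg.gen) (use funpow_partial_deriv_in_base_gens[of "Suc l" "\<nu>(k := \<rho> k)" k \<phi>] that in simp)
  show ?case
    unfolding *[of "Suc (\<rho> k)"] multi_deriv_single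
  proof (rule fun_alg.cong)
    show "fun_alg X ?H (\<lambda>x. (1 / separant \<phi> p \<rho> k x) *
        ((-1) * (?ev (Inl k) x + (\<Sum>l<\<rho> k. ?ev (Inr l) x * (partial_deriv k ^^ Suc l) \<phi> x))))"
      by (intro fun_alg.mult fun_alg.add fun_alg_sum fun_alg.const ev gen) (auto intro: fun_alg.gen)
    fix x assume "x \<in> X"
    then show "(1 / separant \<phi> p \<rho> k x) *
        ((-1) * (?ev (Inl k) x + (\<Sum>l<\<rho> k. ?ev (Inr l) x * (partial_deriv k ^^ Suc l) \<phi> x)))
      = (partial_deriv k ^^ Suc (\<rho> k)) \<phi> x"
      using certificate_differentiated[of x k] separant_nonzero[of x k] by (simp add: field_simps)
  qed
next
  case (Suc n)
  \<comment> \<open>A positive sum provides a direction other than k; lowering its order by one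
    gives the instance \<mu> of the induction hypothesis.\<close>
  then obtain i where i: "i \<noteq> k" "\<nu> i \<noteq> 0"
    by (metis (no_types, lifting) DiffD2 Zero_not_Suc insertI1 sum.neutral)
  define \<mu> where "\<mu> = \<nu>(i := \<nu> i - 1)"
  have \<nu>\<mu>: "\<nu> = \<mu>(i := Suc (\<mu> i))" using i by (simp add: \<mu>_def)
  have "(\<Sum>j\<in>UNIV - {k}. \<nu> j) = Suc (\<Sum>j\<in>UNIV - {k}. \<mu> j)"
  proof -
    have "(\<Sum>j\<in>UNIV - {k} - {i}. \<nu> j) = (\<Sum>j\<in>UNIV - {k} - {i}. \<mu> j)"
      by (intro sum.cong) (auto simp: \<mu>_def)
    then show ?thesis
      using i by (simp add: sum.remove[of "UNIV - {k}" i] \<mu>_def)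
  qed
  with Suc.hyps(2) have IH: "fun_alg X (insert (\<lambda>x. 1 / separant \<phi> p \<rho> k x) (base_gens \<phi> (\<mu>(k := \<rho> k))))
     (multi_deriv (\<mu>(k := Suc (\<rho> k))) \<phi>)"
    by (intro Suc.hyps(1)) simp
  let ?S = "separant \<phi> p \<rho> k"
  let ?H = "insert (\<lambda>x. 1 / ?S x) (base_gens \<phi> (\<nu>(k := \<rho> k)))"
  have upd: "(\<mu>(k := m))(i := Suc ((\<mu>(k := m)) i)) = \<nu>(k := m)" for m
    using i(1) by (auto simp: \<nu>\<mu>)
  have base: "fun_alg X ?H g" "fun_alg X ?H (partial_deriv i g)" if "g \<in> base_gens \<phi> (\<mu>(k := \<rho> k))" for g
  proof -
    have "base_gens \<phi> (\<mu>(k := \<rho> k)) \<subseteq> base_gens \<phi> (\<nu>(k := \<rho> k))"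
      by (rule base_gens_mono) (simp add: \<nu>\<mu>)
    with that show "fun_alg X ?H g" by (intro fun_alg.gen) auto
    show "fun_alg X ?H (partial_deriv i g)"
      by (rule fun_alg_partial_deriv_base_gens[OF X certificate_analytic that]) (unfold upd, auto)
  qed
  \<comment> \<open>The separant contains only pure derivatives in \<xi>_k of order at most \<rho>
    k, so it lies in the algebra without reciprocal, and one derivative in \<xi>_i stays within the
    orders allowed by \<nu>.\<close>
  have "fun_alg X (base_gens \<phi> (\<mu>(k := \<rho> k))) ?S"
    unfolding separant_def
    by (rule fun_alg_cert_poly[OF _ subset_refl]) (use poly_vars_pderiv certificate_vars in force)
  from fun_alg_partial_deriv[OF X this partially_differentiable_base_gens[OF certificate_analytic] base]
  have S: "\<forall>x\<in>X. partially_differentiable ?S x" "fun_alg X ?H (partial_deriv i ?S)" by auto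
  have inv: "((\<lambda>x. 1 / ?S x) has_derivative
      (\<lambda>h. \<Sum>i\<in>UNIV. h $ i * (- (1 / ?S x * (1 / ?S x)) * partial_deriv i ?S x))) (at x)" if "x \<in> X" for x
    using S(1) that separant_nonzero by (intro has_derivative_inverse_partial) auto
  have H_inv: "fun_alg X ?H (\<lambda>x. 1 / ?S x)"
    by (rule fun_alg.gen) simp
  \<comment> \<open>The derivative of 1/S is -(1/S)^2 times that of S, so no second denominator
    arises.\<close>
  have d_inv: "fun_alg X ?H (partial_deriv i (\<lambda>x. 1 / ?S x))"
  proof (rule fun_alg.cong)
    show "fun_alg X ?H (\<lambda>x. ((-1) * ((1 / ?S x) * (1 / ?S x))) * partial_deriv i ?S x)"
      by (intro fun_alg.mult fun_alg.const H_inv S(2))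
  qed (use partial_deriv_eqI[OF inv] in simp)
  have "fun_alg X ?H (partial_deriv i (multi_deriv (\<mu>(k := Suc (\<rho> k))) \<phi>))"
    using fun_alg_partial_deriv[OF X IH, of ?H i] base H_inv d_inv
      partially_differentiable_base_gens[OF certificate_analytic] partially_differentiableI[OF inv]
    by blast
  then show ?case
  proof (rule fun_alg.cong)
    fix x assume "x \<in> X"
    show "partial_deriv i (multi_deriv (\<mu>(k := Suc (\<rho> k))) \<phi>) x = multi_deriv (\<nu>(k := Suc (\<rho> k))) \<phi> x"
      using partial_deriv_multi_deriv[OF X certificate_analytic \<open>x \<in> X\<close>, of i "\<mu>(k := Suc (\<rho> k))"]
      unfolding upd .
  qed
qed

text \<open>Below order \<rho> k in \<xi>_k the derivative is again a generator. At order \<rho> k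
  it is a highest derivative, and the orders needed to express it stay below \<rho> because those of
  \<mu> do.\<close>

lemma partial_deriv_in_alg:
  assumes g: "g \<in> base_gens \<phi> \<rho>"
  shows "fun_alg X (insert (\<lambda>x. 1 / separant \<phi> p \<rho> k x) (base_gens \<phi> \<rho>)) (partial_deriv k g)"
proof (rule UnE[OF g[unfolded base_gens_def]])
  assume "g \<in> range (\<lambda>i x. x $ i)"
  then obtain j where "g = (\<lambda>x. x $ j)" by auto
  then have "partial_deriv k g = (\<lambda>_. if k = j then 1 else 0)"
    using partial_deriv_eqI[OF has_derivative_coord] by blast
  then show ?thesis by (simp add: fun_alg.const)
next
  let ?H = "insert (\<lambda>x. 1 / separant \<phi> p \<rho> k x) (base_gens \<phi> \<rho>)"
  assume "g \<in> {multi_deriv \<mu> \<phi> |\<mu>. \<forall>i. \<mu> i \<le> \<rho> i}"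
  then obtain \<mu> where \<mu>: "g = multi_deriv \<mu> \<phi>" "\<And>i. \<mu> i \<le> \<rho> i" by auto
  have "fun_alg X ?H (multi_deriv (\<mu>(k := Suc (\<mu> k))) \<phi>)"
  proof (cases "\<mu> k = \<rho> k")
    case True
    have "base_gens \<phi> (\<mu>(k := \<rho> k)) \<subseteq> base_gens \<phi> \<rho>"
      by (rule base_gens_mono) (simp add: \<mu>(2))
    then have "fun_alg X ?H (multi_deriv (\<mu>(k := Suc (\<rho> k))) \<phi>)"
      by (intro fun_alg_mono[OF highest_derivative_in_alg[of k \<mu>]]) auto
    with True show ?thesis by simp
  next
    case False
    with \<mu>(2)[of k] have "Suc (\<mu> k) \<le> \<rho> k" by simp
    with \<mu>(2) show ?thesis
      by (intro fun_alg.gen) (auto simp: base_gens_def)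
  qed
  then show ?thesis
    by (rule fun_alg.cong) (simp add: \<mu>(1) partial_deriv_multi_deriv[OF X certificate_analytic])
qed

end

section \<open>Step (R)\<close>

lemma nth_position:
  assumes "distinct xs" "x \<in> set xs"
  shows "position xs x < length xs" "xs ! position xs x = x"
proof -
  have "\<exists>!j. j < length xs \<and> xs ! j = x"
    using assms by (metis distinct_Ex1)
  then have "position xs x < length xs \<and> xs ! position xs x = x"
    unfolding position_def by (rule theI')
  then show "position xs x < length xs" "xs ! position xs x = x" by auto
qed

lemma A_all_eq: "A_all X \<phi> \<rho> = (\<lambda>g. restrict g X) ` base_gens \<phi> \<rho>"
  by (auto simp: A_all_def A_phi_def base_gens_def)

lemma A_phi_eq: "A_phi X \<phi> \<rho> = (\<lambda>\<nu>. restrict (multi_deriv \<nu> \<phi>) X) ` Pi\<^sub>E UNIV (\<lambda>i. {..\<rho> i})"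
  by (auto simp: A_phi_def PiE_def)

lemma finite_A_phi: "finite (A_phi X \<phi> \<rho>)"
  unfolding A_phi_eq by (intro finite_imageI finite_PiE) auto

lemma finite_A_all: "finite (A_all X \<phi> \<rho>)"
  unfolding A_all_def by (simp add: finite_A_phi)

text \<open>Distinct multi-indices may give the same function on \<open>X\<close>, and a derivative
  of \<phi> may coincide with a coordinate; hence only an upper bound.\<close>

lemma card_A_all:
  fixes X :: "(real^'n) set"
  shows "card (A_all X \<phi> \<rho>) \<le> CARD('n) + (\<Prod>i\<in>UNIV. \<rho> i + 1)"
proof -
  have "card (A_phi X \<phi> \<rho>) \<le> card (Pi\<^sub>E UNIV (\<lambda>i. {..\<rho> i}))"
    unfolding A_phi_eq by (intro card_image_le finite_PiE) auto
  also have "\<dots> = (\<Prod>i\<in>UNIV. \<rho> i + 1)"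
    by (simp add: card_PiE)
  finally have "card (A_phi X \<phi> \<rho>) \<le> (\<Prod>i\<in>UNIV. \<rho> i + 1)" .
  moreover have "card (range (\<lambda>i. restrict (\<lambda>\<xi>. \<xi> $ i) X)) \<le> CARD('n)"
    by (rule card_image_le) simp
  ultimately show ?thesis
    unfolding A_all_def using card_Un_le[of "range (\<lambda>i. restrict (\<lambda>\<xi>. \<xi> $ i) X)" "A_phi X \<phi> \<rho>"]
    by linarith
qed

section \<open>The state vector \<alpha> and its differential equation\<close>

context
  fixes X :: "(real^'n) set" and \<phi> :: "real^'n \<Rightarrow> real"
    and p :: "'n \<Rightarrow> ('n + nat) rpoly" and \<rho> :: "'n \<Rightarrow> nat" and \<alpha> :: "(real^'n \<Rightarrow> real) list"
  assumes X: "open X" and cert: "nonsingular_DA_certificate X \<phi> p \<rho>"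
    and enum: "enumerates \<alpha> (A_all X \<phi> \<rho>)"
begin

lemma position_base_gens:
  assumes "g \<in> base_gens \<phi> \<rho>"
  shows "position \<alpha> (restrict g X) < length \<alpha>"
    and "x \<in> X \<Longrightarrow> alpha_vec \<alpha> x (position \<alpha> (restrict g X)) = g x"
proof -
  have *: "distinct \<alpha>" "restrict g X \<in> set \<alpha>"
    using enum assms by (auto simp: enumerates_def A_all_eq)
  show "position \<alpha> (restrict g X) < length \<alpha>"
    by (rule nth_position[OF *])
  then show "alpha_vec \<alpha> x (position \<alpha> (restrict g X)) = g x" if "x \<in> X"
    using nth_position(2)[OF *] that by (simp add: alpha_vec_def)
qed

lemma alpha_nth:
  assumes "j < length \<alpha>"
  shows "\<exists>g\<in>base_gens \<phi> \<rho>. \<forall>x\<in>X. g x = (\<alpha> ! j) x"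
proof -
  have "\<alpha> ! j \<in> set \<alpha>"
    using assms by (rule nth_mem)
  also have "set \<alpha> = (\<lambda>g. restrict g X) ` base_gens \<phi> \<rho>"
    using enum unfolding enumerates_def A_all_eq by (rule conjunct2)
  finally obtain g where g: "\<alpha> ! j = restrict g X" "g \<in> base_gens \<phi> \<rho>"
    by (rule imageE)
  show ?thesis
    by (rule bexI[OF _ g(2)]) (simp add: g(1))
qed

lemma coord_in_base_gens: "(\<lambda>x. x $ i) \<in> base_gens \<phi> \<rho>"
  by (auto simp: base_gens_def)

lemma pure_deriv_in_base_gens: "l \<le> \<rho> k \<Longrightarrow> (partial_deriv k ^^ l) \<phi> \<in> base_gens \<phi> \<rho>"
  by (rule funpow_partial_deriv_in_base_gens)

lemma separant_vars: "poly_vars (poly_pderiv v (p k)) \<subseteq> range Inl \<union> Inr ` {..\<rho> k}"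
  by (rule order_trans[OF poly_vars_pderiv certificate_vars[OF X cert]])

text \<open>Transports nonvanishing of the separant on \<open>X\<close> to \<Delta>_k along
  \<alpha>, which keeps the curve in \<open>Z_R\<close>.\<close>

lemma Delta_eval:
  assumes x: "x \<in> X"
  shows "poly_eval (alpha_vec \<alpha> x) (Delta X \<phi> p \<rho> \<alpha> k) = separant \<phi> p \<rho> k x"
  unfolding Delta_def poly_eval_rename separant_def
proof (rule poly_eval_cong)
  fix v assume "v \<in> poly_vars (poly_pderiv (Inr (\<rho> k)) (p k))"
  then have "v \<in> range Inl \<union> Inr ` {..\<rho> k}"
    by (rule subsetD[OF separant_vars])
  then show "alpha_vec \<alpha> x (case_sum (\<lambda>i. position \<alpha> (restrict (\<lambda>\<xi>. \<xi> $ i) X))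
       (\<lambda>l. position \<alpha> (restrict ((partial_deriv k ^^ l) \<phi>) X)) v) = cert_point \<phi> k x v"
  proof
    assume "v \<in> range Inl"
    then obtain i where "v = Inl i" by (rule rangeE)
    then show ?thesis
      using position_base_gens(2)[OF coord_in_base_gens[of i] x] by (simp add: cert_point_def)
  next
    assume "v \<in> Inr ` {..\<rho> k}"
    then obtain l where l: "v = Inr l" "l \<le> \<rho> k" by (elim imageE) simp
    then show ?thesis
      using position_base_gens(2)[OF pure_deriv_in_base_gens[OF l(2)] x]
      by (simp add: cert_point_def)
  qed
qed

lemma Delta_vars: "poly_vars (Delta X \<phi> p \<rho> \<alpha> k) \<subseteq> {..<length \<alpha>}"
proof -
  have "poly_vars (Delta X \<phi> p \<rho> \<alpha> k) \<subseteq>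
      case_sum (\<lambda>i. position \<alpha> (restrict (\<lambda>\<xi>. \<xi> $ i) X))
       (\<lambda>l. position \<alpha> (restrict ((partial_deriv k ^^ l) \<phi>) X)) ` (range Inl \<union> Inr ` {..\<rho> k})"
    unfolding Delta_def
    by (rule subset_trans[OF poly_vars_rename image_mono[OF separant_vars]])
  also have "\<dots> \<subseteq> {..<length \<alpha>}"
    unfolding image_Un image_image
    by (intro Un_least image_subsetI)
      (simp_all add: position_base_gens(1) coord_in_base_gens pure_deriv_in_base_gens)
  finally show ?thesis .
qed

lemma Delta_nonzero: "x \<in> X \<Longrightarrow> poly_eval (alpha_vec \<alpha> x) (Delta X \<phi> p \<rho> \<alpha> k) \<noteq> 0"
  by (simp add: Delta_eval separant_nonzero[OF X cert])

text \<open>A power of \<Delta>_k serves as common denominator: sums are cross-multiplied, which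
  uses that \<Delta>_k is nonzero on \<alpha>(X), and exponents add up in sums as well as
  products.\<close>

lemma fun_alg_fraction:
  assumes "fun_alg X (insert (\<lambda>x. 1 / separant \<phi> p \<rho> k x) (base_gens \<phi> \<rho>)) f"
  shows "\<exists>P e. poly_vars P \<subseteq> {..<length \<alpha>} \<and> (\<forall>x\<in>X. f x =
    poly_eval (alpha_vec \<alpha> x) P / poly_eval (alpha_vec \<alpha> x) (Delta X \<phi> p \<rho> \<alpha> k) ^ e)"
  using assms
proof induction
  case (gen g)
  show ?case
  proof (cases "g \<in> base_gens \<phi> \<rho>")
    case True
    then show ?thesis
      using position_base_gens[OF True]
      by (intro exI[of _ "poly_var (position \<alpha> (restrict g X))"] exI[of _ 0]) auto
  next
    case False
    with gen have "g = (\<lambda>x. 1 / separant \<phi> p \<rho> k x)" by simp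
    then show ?thesis
      by (intro exI[of _ 1]) (simp add: Delta_eval)
  qed
next
  case (const c)
  show ?case
    by (intro exI[of _ "Poly_Mapping.single 0 c"] exI[of _ 0]) (simp add: poly_vars_single)
next
  case (add f g)
  let ?D = "Delta X \<phi> p \<rho> \<alpha> k"
  obtain P d Q e where P: "poly_vars P \<subseteq> {..<length \<alpha>}"
      "\<forall>x\<in>X. f x = poly_eval (alpha_vec \<alpha> x) P / poly_eval (alpha_vec \<alpha> x) ?D ^ d"
    and Q: "poly_vars Q \<subseteq> {..<length \<alpha>}"
      "\<forall>x\<in>X. g x = poly_eval (alpha_vec \<alpha> x) Q / poly_eval (alpha_vec \<alpha> x) ?D ^ e"
    using add.IH by blast
  show ?case
  proof (intro exI conjI ballI)
    show "poly_vars (P * ?D ^ e + Q * ?D ^ d) \<subseteq> {..<length \<alpha>}"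
      using poly_vars_add[of "P * ?D ^ e" "Q * ?D ^ d"] poly_vars_mult[of P "?D ^ e"]
        poly_vars_mult[of Q "?D ^ d"] poly_vars_power[of ?D] Delta_vars[of k] P(1) Q(1)
      by blast
    show "f x + g x = poly_eval (alpha_vec \<alpha> x) (P * ?D ^ e + Q * ?D ^ d)
        / poly_eval (alpha_vec \<alpha> x) ?D ^ (d + e)" if "x \<in> X" for x
      using P(2) Q(2) that Delta_nonzero[OF that, of k] by (simp add: field_simps power_add)
  qed
next
  case (mult f g)
  let ?D = "Delta X \<phi> p \<rho> \<alpha> k"
  obtain P d Q e where P: "poly_vars P \<subseteq> {..<length \<alpha>}"
      "\<forall>x\<in>X. f x = poly_eval (alpha_vec \<alpha> x) P / poly_eval (alpha_vec \<alpha> x) ?D ^ d"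
    and Q: "poly_vars Q \<subseteq> {..<length \<alpha>}"
      "\<forall>x\<in>X. g x = poly_eval (alpha_vec \<alpha> x) Q / poly_eval (alpha_vec \<alpha> x) ?D ^ e"
    using mult.IH by blast
  show ?case
  proof (intro exI conjI ballI)
    show "poly_vars (P * Q) \<subseteq> {..<length \<alpha>}"
      using poly_vars_mult[of P Q] P(1) Q(1) by blast
    show "f x * g x = poly_eval (alpha_vec \<alpha> x) (P * Q) / poly_eval (alpha_vec \<alpha> x) ?D ^ (d + e)"
      if "x \<in> X" for x
      using P(2) Q(2) that by (simp add: power_add)
  qed
next
  case (cong f g)
  then show ?case by metis
qed

lemma alpha_partially_differentiable:
  assumes "j < length \<alpha>" "x \<in> X"
  shows "partially_differentiable (\<alpha> ! j) x"
proof -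
  obtain g where "g \<in> base_gens \<phi> \<rho>" "\<forall>x\<in>X. g x = (\<alpha> ! j) x"
    using alpha_nth[OF assms(1)] by (rule bexE)
  then show ?thesis
    using partially_differentiable_base_gens[OF certificate_analytic[OF X cert]] assms(2) X
    by (intro partially_differentiable_cong[of g x X "\<alpha> ! j"]) auto
qed

lemma construction_R_exists: "\<exists>num ex. construction_R X \<phi> p \<rho> \<alpha> num ex"
proof -
  have "\<exists>P e. poly_vars P \<subseteq> {..<length \<alpha>} \<and> (\<forall>x\<in>X. partial_deriv k (\<alpha> ! j) x =
      poly_eval (alpha_vec \<alpha> x) P / poly_eval (alpha_vec \<alpha> x) (Delta X \<phi> p \<rho> \<alpha> k) ^ e)"
    if j: "j < length \<alpha>" for j k
  proof -
    obtain g where g: "g \<in> base_gens \<phi> \<rho>" "\<forall>x\<in>X. g x = (\<alpha> ! j) x"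
      using alpha_nth[OF j] by (rule bexE)
    have "partial_deriv k (\<alpha> ! j) x = partial_deriv k g x" if "x \<in> X" for x
      by (rule partial_deriv_cong[OF X that]) (simp add: g(2))
    then show ?thesis
      using fun_alg_fraction[OF partial_deriv_in_alg[OF X cert g(1), of k]] by simp
  qed
  then obtain num ex where "\<forall>j<length \<alpha>. \<forall>k. poly_vars (num j k) \<subseteq> {..<length \<alpha>} \<and>
      (\<forall>x\<in>X. partial_deriv k (\<alpha> ! j) x =
      poly_eval (alpha_vec \<alpha> x) (num j k) / poly_eval (alpha_vec \<alpha> x) (Delta X \<phi> p \<rho> \<alpha> k) ^ ex j k)"
    by metis
  then show ?thesis
    unfolding construction_R_def using enum by blast
qed

text \<open>Star-shapedness keeps the segment from 0 to \<xi> in \<open>X\<close>, and the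
  identities defining r_jk are needed only on its image under \<alpha>.\<close>

lemma alpha_curve:
  assumes star: "star_shaped_at X 0" and R: "construction_R X \<phi> p \<rho> \<alpha> num ex" and \<xi>: "\<xi> \<in> X"
  shows "ode_solution (length \<alpha>) (Z_R (length \<alpha>) (Delta X \<phi> p \<rho> \<alpha>)) (F_R (Delta X \<phi> p \<rho> \<alpha>) num ex)
    (alpha_vec \<alpha> 0) \<xi> (\<lambda>\<tau>. alpha_vec \<alpha> (\<tau> *\<^sub>R \<xi>))"
  unfolding ode_solution_def
proof (intro conjI ballI allI impI)
  show "alpha_vec \<alpha> (0 *\<^sub>R \<xi>) = alpha_vec \<alpha> 0" by simp
  fix \<tau> :: real assume "\<tau> \<in> {0..1}"
  then have inX: "\<tau> *\<^sub>R \<xi> \<in> X"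
    using star \<xi> by (force simp: star_shaped_at_def)
  show "alpha_vec \<alpha> (\<tau> *\<^sub>R \<xi>) \<in> Z_R (length \<alpha>) (Delta X \<phi> p \<rho> \<alpha>)"
    using Delta_nonzero[OF inX] by (auto simp: Z_R_def topspace_Euclidean_space alpha_vec_def)
  fix j assume j: "j < length \<alpha>"
  have "((\<lambda>t. (\<alpha> ! j) (t *\<^sub>R \<xi>)) has_real_derivative
      (\<Sum>k\<in>UNIV. partial_deriv k (\<alpha> ! j) (\<tau> *\<^sub>R \<xi>) * \<xi> $ k)) (at \<tau> within {0..1})"
    by (rule has_field_derivative_at_within[OF partially_differentiable_ray[OF
          alpha_partially_differentiable[OF j inX]]])
  moreover have "partial_deriv k (\<alpha> ! j) (\<tau> *\<^sub>R \<xi>)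
      = F_R (Delta X \<phi> p \<rho> \<alpha>) num ex (alpha_vec \<alpha> (\<tau> *\<^sub>R \<xi>)) j k" for k
    using R j inX by (simp add: construction_R_def F_R_def)
  ultimately show "((\<lambda>t. alpha_vec \<alpha> (t *\<^sub>R \<xi>) j) has_real_derivative
      (\<Sum>k\<in>UNIV. F_R (Delta X \<phi> p \<rho> \<alpha>) num ex (alpha_vec \<alpha> (\<tau> *\<^sub>R \<xi>)) j k * \<xi> $ k)) (at \<tau> within {0..1})"
    using j by (simp add: alpha_vec_def)
qed

lemma position_phi:
  shows "position \<alpha> (restrict \<phi> X) < length \<alpha>"
    and "x \<in> X \<Longrightarrow> alpha_vec \<alpha> x (position \<alpha> (restrict \<phi> X)) = \<phi> x"
  \<comment> \<open>\<phi> is its own 0-fold derivative in any direction, so an arbitrary coordinate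
    will do.\<close>
  using position_base_gens[OF funpow_partial_deriv_in_base_gens[of 0 \<rho> undefined \<phi>]] by auto

lemma R_FISCIDS_alpha:
  assumes star: "star_shaped_at X 0" and "X \<noteq> {}" and R: "construction_R X \<phi> p \<rho> \<alpha> num ex"
  shows "R_FISCIDS (length \<alpha>) (Z_R (length \<alpha>) (Delta X \<phi> p \<rho> \<alpha>)) (F_R (Delta X \<phi> p \<rho> \<alpha>) num ex)
    (coord_proj (position \<alpha> (restrict \<phi> X))) (alpha_vec \<alpha> 0) X (\<lambda>\<xi>. vec (\<phi> \<xi>))"
proof -
  let ?D = "Delta X \<phi> p \<rho> \<alpha>"
  let ?N = "length \<alpha>"
  \<comment> \<open>Scaling any point of the nonempty set by s = 0 gives the origin, where the
    initial state is taken.\<close>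
  have "0 \<in> X"
    using star \<open>X \<noteq> {}\<close> by (force simp: star_shaped_at_def)
  then have z0: "alpha_vec \<alpha> 0 \<in> Z_R ?N ?D"
    using Delta_nonzero by (auto simp: Z_R_def topspace_Euclidean_space alpha_vec_def)
  have F: "rational_fun ?N (Z_R ?N ?D) (\<lambda>z. F_R ?D num ex z j k)" if "j < ?N" for j k
    unfolding rational_fun_def
  proof (intro exI conjI ballI)
    show "poly_vars (num j k) \<subseteq> {..<?N}"
      using R that by (simp add: construction_R_def)
    show "poly_vars (?D k ^ ex j k) \<subseteq> {..<?N}"
      by (rule subset_trans[OF poly_vars_power Delta_vars])
  qed (auto simp: F_R_def Z_R_def)
  have "rational_fun ?N (Z_R ?N ?D) (\<lambda>z. coord_proj (position \<alpha> (restrict \<phi> X)) z $ i)" for i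
    unfolding rational_fun_def
    by (rule exI[of _ "poly_var (position \<alpha> (restrict \<phi> X))"], rule exI[of _ 1])
      (simp add: coord_proj_def position_phi)
  moreover have "FISCIDS ?N (Z_R ?N ?D) (F_R ?D num ex)
    (coord_proj (position \<alpha> (restrict \<phi> X))) (alpha_vec \<alpha> 0) X (\<lambda>\<xi>. vec (\<phi> \<xi>))"
    by (rule FISCIDS_I[OF openin_Z_R z0 F alpha_curve[OF star R]])
      (simp_all add: coord_proj_def position_phi)
  ultimately show ?thesis
    unfolding R_FISCIDS_def using F by blast
qed

end

section \<open>Step (P)\<close>

text \<open>Associativity of the matrix product: the chain rule yields G (F \<xi>), whereas
  \<open>F_P\<close> and \<open>F_Q\<close> are built from G F.\<close>

lemma sum_matrix_product:
  fixes a :: "nat \<Rightarrow> real"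
  shows "(\<Sum>l<N. a l * (\<Sum>k\<in>UNIV. b l k * x k)) = (\<Sum>k\<in>UNIV. (\<Sum>l<N. a l * b l k) * x k)"
  unfolding sum_distrib_left sum_distrib_right by (subst sum.swap) (simp add: mult.assoc)

lemma poly_eval_beta_vec:
  assumes "poly_vars q \<subseteq> {..<N}"
  shows "poly_eval (beta_vec N ds z) q = poly_eval z q"
  by (rule poly_eval_cong) (use assms in \<open>auto simp: beta_vec_def\<close>)

lemma has_derivative_reciprocal_upd:
  assumes "poly_eval z d \<noteq> 0"
  shows "((\<lambda>t. 1 / poly_eval (z(j := t)) d) has_real_derivative
    - (poly_eval z (poly_pderiv j d) / (poly_eval z d)\<^sup>2)) (at (z j))"
  using poly_eval_upd_deriv[of z j d] assms
  by (auto intro!: derivative_eq_intros simp: power2_eq_square)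

section \<open>Existence of the data of step (P)\<close>

context
  fixes N :: nat and \<Delta> :: "'n::finite \<Rightarrow> nat rpoly" and num :: "nat \<Rightarrow> 'n \<Rightarrow> nat rpoly"
    and ex :: "nat \<Rightarrow> 'n \<Rightarrow> nat"
  assumes \<Delta>_vars: "\<And>k. poly_vars (\<Delta> k) \<subseteq> {..<N}"
begin

lemma nonconstant_\<Delta>_finite: "finite {\<Delta> k |k. poly_vars (\<Delta> k) \<noteq> {}}"
  by (rule finite_subset[of _ "range \<Delta>"]) auto

text \<open>Appending reciprocals leaves the old coordinates untouched, so \<open>num\<close> is
  reused as it stands and each factor 1/\<Delta>_k becomes a polynomial in the enlarged
  state.\<close>

lemma construction_P_exists:
  assumes num_vars: "\<And>j k. j < N \<Longrightarrow> poly_vars (num j k) \<subseteq> {..<N}"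
  shows "\<exists>ds Ft Gt. construction_P N \<Delta> num ex ds Ft Gt"
proof -
  obtain ds where ds: "set ds = {\<Delta> k |k. poly_vars (\<Delta> k) \<noteq> {}}" "distinct ds"
    using finite_distinct_list[OF nonconstant_\<Delta>_finite] by blast
  have pos: "position ds (\<Delta> k) < length ds" "ds ! position ds (\<Delta> k) = \<Delta> k" if "poly_vars (\<Delta> k) \<noteq> {}" for k
  proof -
    have "\<Delta> k \<in> set ds" using ds(1) that by blast
    then show "position ds (\<Delta> k) < length ds" "ds ! position ds (\<Delta> k) = \<Delta> k"
      using nth_position[OF ds(2)] by auto
  qed
  have ds_nth: "\<exists>k. ds ! i = \<Delta> k" if "i < length ds" for i
    using nth_mem[OF that] unfolding ds(1) by blast
  \<comment> \<open>Constant \<Delta>_k are absent from \<open>ds\<close>, so their reciprocals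
    enter as numbers; the point of evaluation is arbitrary.\<close>
  define inv where "inv = (\<lambda>k. if poly_vars (\<Delta> k) = {}
    then Poly_Mapping.single 0 (1 / poly_eval (\<lambda>_. 0) (\<Delta> k)) else poly_var (N + position ds (\<Delta> k)))"
  have inv_vars: "poly_vars (inv k) \<subseteq> {..<N + length ds}" for k
    using pos[of k] by (auto simp: inv_def poly_vars_single)
  \<comment> \<open>Valid for every z: where \<Delta>_k vanishes, both sides are 0 by the convention
    1 / 0 = 0.\<close>
  have inv_eval: "poly_eval (beta_vec N ds z) (inv k) = 1 / poly_eval z (\<Delta> k)" for z k
    using pos[of k] poly_eval_const[of "\<Delta> k" "\<lambda>_. 0" z]
    by (simp add: inv_def beta_vec_def)
  define Ft where "Ft = (\<lambda>j k. num j k * inv k ^ ex j k)"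
  \<comment> \<open>This is -(1/d)^2 times the derivative of d, with coordinate N + i standing for
    1/d.\<close>
  define Gt where "Gt = (\<lambda>i j. Poly_Mapping.single 0 (- 1) *
    (poly_var (N + i) * poly_var (N + i) * poly_pderiv j (ds ! i)))"
  have "construction_P N \<Delta> num ex ds Ft Gt"
    unfolding construction_P_def
  proof (intro conjI allI impI ballI)
    show "enumerates ds {\<Delta> k |k. poly_vars (\<Delta> k) \<noteq> {}}"
      using ds by (simp add: enumerates_def)
  next
    fix j k assume "j < N"
    have "poly_vars (inv k ^ ex j k) \<subseteq> {..<N + length ds}"
      by (rule subset_trans[OF poly_vars_power inv_vars])
    moreover have "poly_vars (num j k) \<subseteq> {..<N + length ds}"
      using num_vars[OF \<open>j < N\<close>, of k] by auto
    ultimately show "poly_vars (Ft j k) \<subseteq> {..<N + length ds}"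
      unfolding Ft_def by (intro subset_trans[OF poly_vars_mult] Un_least)
    show "F_R \<Delta> num ex z j k = poly_eval (beta_vec N ds z) (Ft j k)" for z
      using num_vars[OF \<open>j < N\<close>, of k]
      by (simp add: F_R_def Ft_def inv_eval poly_eval_beta_vec power_divide)
  next
    fix i j assume i: "i < length ds" and j: "j < N"
    obtain k where k: "ds ! i = \<Delta> k" using ds_nth[OF i] ..
    have pv: "poly_vars (poly_pderiv j (ds ! i)) \<subseteq> {..<N}"
      unfolding k by (rule subset_trans[OF poly_vars_pderiv \<Delta>_vars])
    have "poly_vars (poly_var (N + i)) \<subseteq> {..<N + length ds}"
      using i by simp
    then show "poly_vars (Gt i j) \<subseteq> {..<N + length ds}"
      unfolding Gt_def using pv
      by (intro subset_trans[OF poly_vars_mult] Un_least) (auto simp: poly_vars_single)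
    fix z assume "z \<in> Z_R N \<Delta>"
    then have "poly_eval z (ds ! i) \<noteq> 0" by (simp add: Z_R_def k)
    moreover have "poly_eval (beta_vec N ds z) (Gt i j)
        = - (poly_eval z (poly_pderiv j (ds ! i)) / (poly_eval z (ds ! i))\<^sup>2)"
      using i by (simp add: Gt_def poly_eval_beta_vec[OF pv]) (simp add: beta_vec_def power2_eq_square)
    ultimately show "((\<lambda>t. 1 / poly_eval (z(j := t)) (ds ! i)) has_real_derivative
        poly_eval (beta_vec N ds z) (Gt i j)) (at (z j))"
      using has_derivative_reciprocal_upd by metis
  qed
  then show ?thesis by blast
qed

section \<open>The polynomial system for arbitrary data of step (P)\<close>

context
  fixes ds :: "nat rpoly list" and Ft :: "nat \<Rightarrow> 'n \<Rightarrow> nat rpoly" and Gt :: "nat \<Rightarrow> nat \<Rightarrow> nat rpoly"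
  assumes P: "construction_P N \<Delta> num ex ds Ft Gt"
begin

lemma length_denominators: "length ds \<le> CARD('n)"
proof -
  have "distinct ds" "set ds = {\<Delta> k |k. poly_vars (\<Delta> k) \<noteq> {}}"
    using P by (auto simp: construction_P_def enumerates_def)
  then have "length ds = card {\<Delta> k |k. poly_vars (\<Delta> k) \<noteq> {}}"
    by (metis distinct_card)
  also have "\<dots> \<le> card (range \<Delta>)"
    by (rule card_mono) auto
  also have "\<dots> \<le> CARD('n)"
    by (rule card_image_le) simp
  finally show ?thesis .
qed

lemma denominator_nth:
  assumes "i < length ds"
  shows "\<exists>k. ds ! i = \<Delta> k"
proof -
  have "set ds = {\<Delta> k |k. poly_vars (\<Delta> k) \<noteq> {}}"
    using P by (simp add: construction_P_def enumerates_def)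
  then show ?thesis using nth_mem[OF assms] by auto
qed

lemma F_P_vars:
  assumes "j < N + length ds"
  shows "poly_vars (F_P N Ft Gt j k) \<subseteq> {..<N + length ds}"
proof (cases "j < N")
  case True
  then show ?thesis using P by (simp add: F_P_def construction_P_def)
next
  case False
  have "poly_vars (Gt (j - N) l * Ft l k) \<subseteq> {..<N + length ds}" if "l < N" for l
    using P False assms that
    by (intro subset_trans[OF poly_vars_mult] Un_least) (auto simp: construction_P_def)
  then have "(\<Union>l<N. poly_vars (Gt (j - N) l * Ft l k)) \<subseteq> {..<N + length ds}"
    by blast
  with False show ?thesis
    unfolding F_P_def by (simp add: subset_trans[OF poly_vars_sum])
qed

text \<open>The curve y stays in \<open>Z_R\<close>, where the identities for \<open>Ft\<close> and
  \<open>Gt\<close> hold; the reciprocals then evolve by the chain rule along y.\<close>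

lemma beta_curve:
  assumes y: "ode_solution N (Z_R N \<Delta>) (F_R \<Delta> num ex) z0 \<xi> y"
  shows "ode_solution (N + length ds) (topspace (Euclidean_space (N + length ds)))
    (\<lambda>z j k. poly_eval z (F_P N Ft Gt j k)) (beta_vec N ds z0) \<xi> (\<lambda>\<tau>. beta_vec N ds (y \<tau>))"
  unfolding ode_solution_def
proof (intro conjI ballI allI impI)
  show "beta_vec N ds (y 0) = beta_vec N ds z0"
    using y by (simp add: ode_solution_def)
  fix \<tau> :: real assume \<tau>: "\<tau> \<in> {0..1}"
  show "beta_vec N ds (y \<tau>) \<in> topspace (Euclidean_space (N + length ds))"
    by (simp add: topspace_Euclidean_space beta_vec_def)
  have yZ: "y \<tau> \<in> Z_R N \<Delta>" and dy: "\<And>l. l < N \<Longrightarrow> ((\<lambda>t. y t l) has_real_derivative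
      (\<Sum>k\<in>UNIV. F_R \<Delta> num ex (y \<tau>) l k * \<xi> $ k)) (at \<tau> within {0..1})"
    using y \<tau> by (auto simp: ode_solution_def)
  have Ft: "F_R \<Delta> num ex (y \<tau>) l k = poly_eval (beta_vec N ds (y \<tau>)) (Ft l k)" if "l < N" for l k
    using P yZ that by (simp add: construction_P_def)
  fix j assume j: "j < N + length ds"
  show "((\<lambda>t. beta_vec N ds (y t) j) has_real_derivative
      (\<Sum>k\<in>UNIV. poly_eval (beta_vec N ds (y \<tau>)) (F_P N Ft Gt j k) * \<xi> $ k)) (at \<tau> within {0..1})"
  proof (cases "j < N")
    case True
    then show ?thesis using dy[of j] Ft[of j] by (simp add: beta_vec_def F_P_def)
  next
    case False
    define i where "i = j - N"
    have i: "i < length ds" using False j by (simp add: i_def)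
    let ?d = "ds ! i"
    obtain k0 where k0: "?d = \<Delta> k0" using denominator_nth[OF i] ..
    have nz: "poly_eval (y \<tau>) ?d \<noteq> 0" using yZ by (simp add: Z_R_def k0)
    \<comment> \<open>\<open>Gt\<close> is known only through the derivatives it computes in each
      single coordinate; their uniqueness turns this into a formula for its value.\<close>
    have Gt: "poly_eval (beta_vec N ds (y \<tau>)) (Gt i l)
        = - (poly_eval (y \<tau>) (poly_pderiv l ?d) / (poly_eval (y \<tau>) ?d)\<^sup>2)" if "l < N" for l
    proof (rule DERIV_unique[OF _ has_derivative_reciprocal_upd[OF nz]])
      show "((\<lambda>t. 1 / poly_eval ((y \<tau>)(l := t)) ?d) has_real_derivative
          poly_eval (beta_vec N ds (y \<tau>)) (Gt i l)) (at (y \<tau> l))"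
        using P yZ i that by (simp add: construction_P_def)
    qed
    have "((\<lambda>t. poly_eval (y t) ?d) has_real_derivative
        (\<Sum>l<N. poly_eval (y \<tau>) (poly_pderiv l ?d) * (\<Sum>k\<in>UNIV. F_R \<Delta> num ex (y \<tau>) l k * \<xi> $ k)))
        (at \<tau> within {0..1})"
      by (rule poly_eval_chain) (use dy \<Delta>_vars k0 in auto)
    then have "((\<lambda>t. 1 / poly_eval (y t) ?d) has_real_derivative
        - ((\<Sum>l<N. poly_eval (y \<tau>) (poly_pderiv l ?d) * (\<Sum>k\<in>UNIV. F_R \<Delta> num ex (y \<tau>) l k * \<xi> $ k))
          / (poly_eval (y \<tau>) ?d)\<^sup>2)) (at \<tau> within {0..1})"
      using nz by (auto intro!: derivative_eq_intros simp: power2_eq_square)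
    moreover have "- ((\<Sum>l<N. poly_eval (y \<tau>) (poly_pderiv l ?d) * (\<Sum>k\<in>UNIV. F_R \<Delta> num ex (y \<tau>) l k * \<xi> $ k))
          / (poly_eval (y \<tau>) ?d)\<^sup>2)
      = (\<Sum>l<N. poly_eval (beta_vec N ds (y \<tau>)) (Gt i l) *
          (\<Sum>k\<in>UNIV. poly_eval (beta_vec N ds (y \<tau>)) (Ft l k) * \<xi> $ k))"
      unfolding sum_divide_distrib sum_negf[symmetric]
      by (rule sum.cong) (simp_all add: Gt Ft)
    ultimately show ?thesis
      using False j by (simp add: beta_vec_def F_P_def i_def sum_matrix_product)
  qed
qed

text \<open>Without denominators the whole Euclidean space can be the state space. That no other
  solution leaves the graph of the reciprocals is part of the uniqueness for polynomial
  fields.\<close>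

lemma P_FISCIDS_beta:
  assumes y: "\<And>\<xi>. \<xi> \<in> X \<Longrightarrow> ode_solution N (Z_R N \<Delta>) (F_R \<Delta> num ex) z0 \<xi> (y \<xi>)"
    and l: "l < N" "\<And>\<xi>. \<xi> \<in> X \<Longrightarrow> y \<xi> 1 l = \<phi> \<xi>"
  shows "P_FISCIDS (N + length ds) (topspace (Euclidean_space (N + length ds)))
    (\<lambda>z j k. poly_eval z (F_P N Ft Gt j k)) (coord_proj l) (beta_vec N ds z0) X (\<lambda>\<xi>. vec (\<phi> \<xi>))"
proof -
  let ?NP = "N + length ds"
  have F: "polynomial_fun ?NP (topspace (Euclidean_space ?NP)) (\<lambda>z. poly_eval z (F_P N Ft Gt j k))"
    if "j < ?NP" for j k
    unfolding polynomial_fun_def using F_P_vars[OF that] by blast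
  have h: "polynomial_fun ?NP (topspace (Euclidean_space ?NP)) (\<lambda>z. coord_proj l z $ i)" for i
    unfolding polynomial_fun_def using l(1)
    by (intro exI[of _ "poly_var l"]) (simp add: coord_proj_def)
  have "FISCIDS ?NP (topspace (Euclidean_space ?NP)) (\<lambda>z j k. poly_eval z (F_P N Ft Gt j k))
      (coord_proj l) (beta_vec N ds z0) X (\<lambda>\<xi>. vec (\<phi> \<xi>))"
  proof (rule FISCIDS_I)
    show "ode_solution ?NP (topspace (Euclidean_space ?NP)) (\<lambda>z j k. poly_eval z (F_P N Ft Gt j k))
        (beta_vec N ds z0) \<xi> (\<lambda>\<tau>. beta_vec N ds (y \<xi> \<tau>))" if "\<xi> \<in> X" for \<xi>
      by (rule beta_curve[OF y[OF that]])
    show "beta_vec N ds z0 \<in> topspace (Euclidean_space ?NP)"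
      by (simp add: topspace_Euclidean_space beta_vec_def)
    show "coord_proj l (beta_vec N ds (y \<xi> 1)) = vec (\<phi> \<xi>)" if "\<xi> \<in> X" for \<xi>
      using l that by (simp add: coord_proj_def beta_vec_def)
  qed (use F polynomial_fun_imp_rational_fun in auto)
  then show ?thesis
    unfolding P_FISCIDS_def using F h by blast
qed

end

end

section \<open>Step (Q)\<close>

definition bounded_expos :: "nat \<Rightarrow> nat \<Rightarrow> nat expo set" where
  "bounded_expos N d = {m. Poly_Mapping.keys m \<subseteq> {..<N} \<and> expo_degree m \<le> d}"

lemma
  shows finite_bounded_expos: "finite (bounded_expos N d)"
    and card_bounded_expos: "card (bounded_expos N d) \<le> (N + d) choose d"
proof -
  define L where "L = {l::nat list. size l = Suc N \<and> sum_list l = d}"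
  have cardL: "card L = (N + d) choose d"
    unfolding L_def card_length_sum_list by (simp add: add.commute)
  \<comment> \<open>\<open>card\<close> is 0 on infinite sets, so positivity of the binomial
    coefficient yields finiteness of \<open>L\<close>.\<close>
  have "0 < (N + d) choose d"
    by (simp add: zero_less_binomial_iff)
  then have finL: "finite L"
    using cardL by (metis card.infinite less_numeral_extra(3))
  \<comment> \<open>The last entry is a slack variable, turning degree \<open>\<le> d\<close> into a composition of \<open>d\<close>.\<close>
  define f where "f = (\<lambda>m::nat expo. map (Poly_Mapping.lookup m) [0..<N] @ [d - expo_degree m])"
  have inj: "inj_on f (bounded_expos N d)"
  proof (rule inj_onI)
    fix m n assume mn: "m \<in> bounded_expos N d" "n \<in> bounded_expos N d" "f m = f n"
    show "m = n"
    proof (rule poly_mapping_eqI)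
      fix i
      show "Poly_Mapping.lookup m i = Poly_Mapping.lookup n i"
      proof (cases "i < N")
        case True
        then show ?thesis using mn(3) by (simp add: f_def)
      next
        case False
        then have "i \<notin> Poly_Mapping.keys m" "i \<notin> Poly_Mapping.keys n"
          using mn(1,2) by (auto simp: bounded_expos_def)
        then show ?thesis by (simp add: in_keys_iff)
      qed
    qed
  qed
  have img: "f ` bounded_expos N d \<subseteq> L"
  proof (rule image_subsetI)
    fix m assume m: "m \<in> bounded_expos N d"
    then have "expo_degree m = (\<Sum>i<N. Poly_Mapping.lookup m i)"
      by (intro expo_degree_superset) (auto simp: bounded_expos_def)
    also have "\<dots> = sum_list (map (Poly_Mapping.lookup m) [0..<N])"
      by (simp add: interv_sum_list_conv_sum_set_nat atLeast0LessThan)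
    finally show "f m \<in> L"
      using m by (simp add: L_def f_def bounded_expos_def)
  qed
  show "finite (bounded_expos N d)"
    using inj_on_finite[OF inj img finL] .
  show "card (bounded_expos N d) \<le> (N + d) choose d"
    using card_inj_on_le[OF inj img finL] cardL by simp
qed

lemma lookup_le_imp_expo_degree_le:
  assumes "\<And>i. Poly_Mapping.lookup m i \<le> Poly_Mapping.lookup n i"
  shows "expo_degree m \<le> expo_degree n"
proof -
  let ?V = "Poly_Mapping.keys m \<union> Poly_Mapping.keys n"
  have "(\<Sum>v\<in>?V. Poly_Mapping.lookup m v) \<le> (\<Sum>v\<in>?V. Poly_Mapping.lookup n v)"
    by (rule sum_mono) (rule assms)
  then show ?thesis
    using expo_degree_superset[of ?V m] expo_degree_superset[of ?V n] by simp
qed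

lemma down_closure_downward:
  assumes "m \<in> down_closure E" "\<And>i. Poly_Mapping.lookup m' i \<le> Poly_Mapping.lookup m i"
  shows "m' \<in> down_closure E"
  using assms unfolding down_closure_def by (blast intro: order_trans)

lemma subset_down_closure: "E \<subseteq> down_closure E"
  by (auto simp: down_closure_def)

lemma down_closure_subset_bounded_expos:
  assumes "E \<subseteq> bounded_expos N d"
  shows "down_closure E \<subseteq> bounded_expos N d"
proof
  fix m assume "m \<in> down_closure E"
  then obtain n where n: "n \<in> E" "\<And>i. Poly_Mapping.lookup m i \<le> Poly_Mapping.lookup n i"
    by (auto simp: down_closure_def)
  have "expo_degree m \<le> expo_degree n"
    by (rule lookup_le_imp_expo_degree_le[OF n(2)])
  moreover have "Poly_Mapping.keys m \<subseteq> Poly_Mapping.keys n"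
  proof
    fix i assume "i \<in> Poly_Mapping.keys m"
    with n(2)[of i] show "i \<in> Poly_Mapping.keys n" by (simp add: in_keys_iff)
  qed
  ultimately show "m \<in> bounded_expos N d"
    using n(1) assms by (auto simp: bounded_expos_def)
qed

lemma mono_eval_upd_deriv:
  "((\<lambda>t. mono_eval (z(j := t)) m) has_real_derivative
    Poly_Mapping.lookup m j * mono_eval z (m - Poly_Mapping.single j 1)) (at (z j))"
  using poly_eval_upd_deriv[of z j "Poly_Mapping.single m 1"] by (simp add: poly_eval_pderiv)

text \<open>The exponent 0 is excluded from \<open>gs\<close>, so its monomial has to be the
  constant 1; hence the maps of step (Q) are affine rather than linear.\<close>

definition mono_affine :: "nat expo list \<Rightarrow> nat expo \<Rightarrow> nat rpoly" where
  "mono_affine gs m = (if m = 0 then 1 else poly_var (position gs m))"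

context
  fixes N :: nat and F :: "nat \<Rightarrow> 'n::finite \<Rightarrow> nat rpoly" and l :: nat
  assumes F_vars: "\<And>j k. j < N \<Longrightarrow> poly_vars (F j k) \<subseteq> {..<N}" and l: "l < N"
begin

text \<open>Each exponent comes from an entry whose degree enters the maximum, and the maximum is
  over a finite set because rows and columns are finite in number.\<close>

lemma exps_P_bounded: "exps_P N F (poly_var l) \<subseteq> bounded_expos N (max_degree_P N F (poly_var l))"
proof -
  let ?S = "insert (total_degree (poly_var l)) {total_degree (F j k) |j k. j < N}"
  have "{total_degree (F j k) |j k. j < N} = (\<lambda>(j, k). total_degree (F j k)) ` ({..<N} \<times> UNIV)"
    by auto
  then have fin: "finite ?S" by simp
  have deg: "total_degree (F j k) \<le> max_degree_P N F (poly_var l)" if "j < N" for j k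
    unfolding max_degree_P_def by (rule Max_ge[OF fin]) (use that in auto)
  have deg_l: "total_degree (poly_var l) \<le> max_degree_P N F (poly_var l)"
    unfolding max_degree_P_def by (rule Max_ge[OF fin]) auto
  show ?thesis
  proof
    fix m assume "m \<in> exps_P N F (poly_var l)"
    then consider (F) j k where "j < N" "m \<in> Poly_Mapping.keys (F j k)"
      | (h) "m \<in> Poly_Mapping.keys (poly_var l)"
      by (auto simp: exps_P_def)
    then show "m \<in> bounded_expos N (max_degree_P N F (poly_var l))"
    proof cases
      case F
      then show ?thesis
        using deg[OF F(1), of k] F_vars[OF F(1), of k]
        by (auto simp: bounded_expos_def total_degree_le_iff poly_vars_def)
    next
      case h
      then show ?thesis
        using deg_l l unfolding total_degree_le_iff by (auto simp: bounded_expos_def poly_var_def)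
    qed
  qed
qed

lemma down_closure_exps_P_bounded:
  "down_closure (exps_P N F (poly_var l)) \<subseteq> bounded_expos N (max_degree_P N F (poly_var l))"
  by (rule down_closure_subset_bounded_expos[OF exps_P_bounded])

lemma finite_down_closure_exps_P: "finite (down_closure (exps_P N F (poly_var l)))"
  by (rule finite_subset[OF down_closure_exps_P_bounded finite_bounded_expos])

lemma card_down_closure_exps_P:
  "card (down_closure (exps_P N F (poly_var l)))
    \<le> (N + max_degree_P N F (poly_var l)) choose max_degree_P N F (poly_var l)"
  using card_mono[OF finite_bounded_expos down_closure_exps_P_bounded]
    card_bounded_expos[of N "max_degree_P N F (poly_var l)"] by (rule order_trans)

text \<open>Contributed by h_P even if the output coordinate does not occur in \<open>F\<close>;
  this guarantees h_Q a coordinate to project to.\<close>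

lemma var_in_down_closure: "Poly_Mapping.single l 1 \<in> down_closure (exps_P N F (poly_var l))"
  by (rule subsetD[OF subset_down_closure]) (simp add: exps_P_def poly_var_def)

text \<open>Dropping 0 thus removes exactly one exponent, the - 1 in the formula for N_Q.\<close>

lemma zero_in_down_closure: "0 \<in> down_closure (exps_P N F (poly_var l))"
  by (rule down_closure_downward[OF var_in_down_closure]) simp

context
  fixes gs :: "nat expo list"
  assumes gs: "enumerates gs (down_closure (exps_P N F (poly_var l)) - {0})"
begin

lemma length_gs: "length gs = card (down_closure (exps_P N F (poly_var l))) - 1"
proof -
  have "length gs = card (down_closure (exps_P N F (poly_var l)) - {0})"
    using gs by (metis distinct_card enumerates_def)
  then show ?thesis by (simp add: zero_in_down_closure)
qed

lemma length_gs_le: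
  "length gs \<le> ((N + max_degree_P N F (poly_var l)) choose max_degree_P N F (poly_var l)) - 1"
  unfolding length_gs by (rule diff_le_mono[OF card_down_closure_exps_P])

lemma position_gs:
  assumes "m \<in> down_closure (exps_P N F (poly_var l))" "m \<noteq> 0"
  shows "position gs m < length gs" "gs ! position gs m = m"
proof -
  have "distinct gs" "m \<in> set gs"
    using gs assms by (auto simp: enumerates_def)
  then show "position gs m < length gs" "gs ! position gs m = m"
    by (rule nth_position)+
qed

lemma gs_nth:
  assumes "i < length gs"
  shows "gs ! i \<in> down_closure (exps_P N F (poly_var l))"
proof -
  have "set gs = down_closure (exps_P N F (poly_var l)) - {0}"
    using gs unfolding enumerates_def by (rule conjunct2)
  with nth_mem[OF assms] show ?thesis by blast
qed

lemma
  assumes "m \<in> down_closure (exps_P N F (poly_var l))"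
  shows eval_mono_affine: "poly_eval (gamma_vec gs z) (mono_affine gs m) = mono_eval z m"
    and vars_scaled_mono_affine: "poly_vars (Poly_Mapping.single 0 c * mono_affine gs m) \<subseteq> {..<length gs}"
    and degree_scaled_mono_affine: "total_degree (Poly_Mapping.single 0 c * mono_affine gs m) \<le> 1"
proof -
  show "poly_eval (gamma_vec gs z) (mono_affine gs m) = mono_eval z m"
    using position_gs[OF assms] by (simp add: mono_affine_def gamma_vec_def)
  have "poly_vars (Poly_Mapping.single 0 c) \<subseteq> {..<length gs}"
    by (simp add: poly_vars_single)
  moreover have "poly_vars (mono_affine gs m) \<subseteq> {..<length gs}"
    using position_gs(1)[OF assms] by (simp add: mono_affine_def)
  ultimately show "poly_vars (Poly_Mapping.single 0 c * mono_affine gs m) \<subseteq> {..<length gs}"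
    by (intro subset_trans[OF poly_vars_mult] Un_least)
  have "total_degree (mono_affine gs m) \<le> 1"
    by (auto simp: mono_affine_def total_degree_le_iff poly_var_def)
  moreover have "total_degree (Poly_Mapping.single (0::nat expo) c) \<le> 0"
    unfolding total_degree_le_iff by simp
  ultimately show "total_degree (Poly_Mapping.single 0 c * mono_affine gs m) \<le> 1"
    using total_degree_mult[of "Poly_Mapping.single 0 c" 0 "mono_affine gs m" 1] by simp
qed

text \<open>Downward closure is what makes this work: lowering one entry of an exponent stays in the
  closure, so derivatives of listed monomials are multiples of listed monomials or
  constants.\<close>

lemma construction_Q_exists: "\<exists>Fb Gb. construction_Q N F (poly_var l) gs Fb Gb"
proof -
  define Fb where "Fb = (\<lambda>j k. \<Sum>m\<in>Poly_Mapping.keys (F j k).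
    Poly_Mapping.single 0 (Poly_Mapping.lookup (F j k) m) * mono_affine gs m)"
  define Gb where "Gb = (\<lambda>i j. Poly_Mapping.single 0 (real (Poly_Mapping.lookup (gs ! i) j)) *
    mono_affine gs (gs ! i - Poly_Mapping.single j 1))"
  have F_mem: "m \<in> down_closure (exps_P N F (poly_var l))" if "j < N" "m \<in> Poly_Mapping.keys (F j k)" for j k m
    by (rule subsetD[OF subset_down_closure]) (use that in \<open>auto simp: exps_P_def\<close>)
  \<comment> \<open>If j does not occur in the exponent, the truncated difference leaves it
    unchanged, and its coefficient in \<open>Gb\<close> is 0.\<close>
  have G_mem: "gs ! i - Poly_Mapping.single j 1 \<in> down_closure (exps_P N F (poly_var l))"
    if "i < length gs" for i j
    by (rule down_closure_downward[OF gs_nth[OF that]]) (simp add: lookup_minus)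
  have "construction_Q N F (poly_var l) gs Fb Gb"
    unfolding construction_Q_def
  proof (intro conjI allI impI ballI gs)
    fix j k assume j: "j < N"
    have "(\<Union>m\<in>Poly_Mapping.keys (F j k). poly_vars (Poly_Mapping.single 0 (Poly_Mapping.lookup (F j k) m) * mono_affine gs m))
        \<subseteq> {..<length gs}"
      by (intro UN_least vars_scaled_mono_affine F_mem[OF j])
    then show "poly_vars (Fb j k) \<subseteq> {..<length gs}"
      unfolding Fb_def by (rule subset_trans[OF poly_vars_sum])
    show "total_degree (Fb j k) \<le> 1"
      unfolding Fb_def by (intro total_degree_sum degree_scaled_mono_affine F_mem[OF j])
    show "poly_eval z (F j k) = poly_eval (gamma_vec gs z) (Fb j k)" for z
      unfolding Fb_def poly_eval_sum poly_eval_def[of z "F j k"]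
      by (rule sum.cong) (simp_all add: eval_mono_affine[OF F_mem[OF j]])
  next
    fix i j assume i: "i < length gs"
    show "poly_vars (Gb i j) \<subseteq> {..<length gs}" "total_degree (Gb i j) \<le> 1"
      unfolding Gb_def by (intro vars_scaled_mono_affine degree_scaled_mono_affine G_mem i)+
    show "((\<lambda>t. mono_eval (z(j := t)) (gs ! i)) has_real_derivative
        poly_eval (gamma_vec gs z) (Gb i j)) (at (z j))" for z
      unfolding Gb_def poly_eval_mult poly_eval_single eval_mono_affine[OF G_mem[OF i]] mono_eval_0 mult_1_right
      by (rule mono_eval_upd_deriv)
  qed
  then show ?thesis by blast
qed

context
  fixes Fb :: "nat \<Rightarrow> 'n \<Rightarrow> nat rpoly" and Gb :: "nat \<Rightarrow> nat \<Rightarrow> nat rpoly"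
  assumes Q: "construction_Q N F (poly_var l) gs Fb Gb"
begin

text \<open>The chain rule for monomials along y, with the values of \<open>Gb\<close> again
  identified by uniqueness of derivatives. The identities of step (Q) hold on the whole space, so no
  open subset has to be respected.\<close>

lemma gamma_curve:
  assumes y: "ode_solution N (topspace (Euclidean_space N)) (\<lambda>z j k. poly_eval z (F j k)) z0 \<xi> y"
  shows "ode_solution (length gs) (topspace (Euclidean_space (length gs)))
    (F_Q N Fb Gb) (gamma_vec gs z0) \<xi> (\<lambda>\<tau>. gamma_vec gs (y \<tau>))"
  unfolding ode_solution_def
proof (intro conjI ballI allI impI)
  show "gamma_vec gs (y 0) = gamma_vec gs z0"
    using y by (simp add: ode_solution_def)
  fix \<tau> :: real assume \<tau>: "\<tau> \<in> {0..1}"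
  show "gamma_vec gs (y \<tau>) \<in> topspace (Euclidean_space (length gs))"
    by (simp add: topspace_Euclidean_space gamma_vec_def)
  let ?g = "gamma_vec gs (y \<tau>)"
  have yZ: "y \<tau> \<in> topspace (Euclidean_space N)" and dy: "\<And>j. j < N \<Longrightarrow> ((\<lambda>t. y t j) has_real_derivative
      (\<Sum>k\<in>UNIV. poly_eval (y \<tau>) (F j k) * \<xi> $ k)) (at \<tau> within {0..1})"
    using y \<tau> by (auto simp: ode_solution_def)
  have Fb: "poly_eval (y \<tau>) (F j k) = poly_eval ?g (Fb j k)" if "j < N" for j k
    using Q yZ that by (simp add: construction_Q_def)
  fix i assume i: "i < length gs"
  let ?m = "gs ! i"
  have keys: "Poly_Mapping.keys ?m \<subseteq> {..<N}"
    using gs_nth[OF i] down_closure_exps_P_bounded by (auto simp: bounded_expos_def)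
  have Gb: "poly_eval ?g (Gb i j)
      = Poly_Mapping.lookup ?m j * mono_eval (y \<tau>) (?m - Poly_Mapping.single j 1)" if "j < N" for j
  proof (rule DERIV_unique[OF _ mono_eval_upd_deriv])
    show "((\<lambda>t. mono_eval ((y \<tau>)(j := t)) ?m) has_real_derivative poly_eval ?g (Gb i j)) (at (y \<tau> j))"
      using Q yZ i that by (simp add: construction_Q_def)
  qed
  have "((\<lambda>t. mono_eval (y t) ?m) has_real_derivative
      (\<Sum>j<N. Poly_Mapping.lookup ?m j * mono_eval (y \<tau>) (?m - Poly_Mapping.single j 1) *
        (\<Sum>k\<in>UNIV. poly_eval (y \<tau>) (F j k) * \<xi> $ k))) (at \<tau> within {0..1})"
    by (rule mono_eval_chain) (use dy keys in auto)
  also have "(\<Sum>j<N. Poly_Mapping.lookup ?m j * mono_eval (y \<tau>) (?m - Poly_Mapping.single j 1) *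
        (\<Sum>k\<in>UNIV. poly_eval (y \<tau>) (F j k) * \<xi> $ k))
      = (\<Sum>j<N. poly_eval ?g (Gb i j) * (\<Sum>k\<in>UNIV. poly_eval ?g (Fb j k) * \<xi> $ k))"
    by (rule sum.cong) (simp_all add: Gb Fb)
  finally show "((\<lambda>t. gamma_vec gs (y t) i) has_real_derivative
      (\<Sum>k\<in>UNIV. F_Q N Fb Gb ?g i k * \<xi> $ k)) (at \<tau> within {0..1})"
    using i by (simp add: gamma_vec_def F_Q_def sum_matrix_product)
qed

lemma Q_FISCIDS_gamma:
  assumes y: "\<And>\<xi>. \<xi> \<in> X \<Longrightarrow> ode_solution N (topspace (Euclidean_space N))
      (\<lambda>z j k. poly_eval z (F j k)) z0 \<xi> (y \<xi>)"
    and phi: "\<And>\<xi>. \<xi> \<in> X \<Longrightarrow> y \<xi> 1 l = \<phi> \<xi>"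
  shows "Q_FISCIDS (length gs) (topspace (Euclidean_space (length gs))) (F_Q N Fb Gb)
    (coord_proj (position gs (Poly_Mapping.single l 1))) (gamma_vec gs z0) X (\<lambda>\<xi>. vec (\<phi> \<xi>))"
proof -
  let ?q = "position gs (Poly_Mapping.single l 1)"
  let ?NQ = "length gs"
  \<comment> \<open>The exponent of the output coordinate must survive the removal of 0 to have a
    position in \<open>gs\<close>.\<close>
  have nz: "Poly_Mapping.single l (1::nat) \<noteq> 0"
    by (metis lookup_single_eq lookup_zero zero_neq_one)
  have q: "?q < ?NQ" "gs ! ?q = Poly_Mapping.single l 1"
    using position_gs[OF var_in_down_closure nz] .
  have F: "polynomial_fun_deg_le 2 ?NQ (topspace (Euclidean_space ?NQ)) (\<lambda>z. F_Q N Fb Gb z i k)"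
    if i: "i < ?NQ" for i k
    unfolding polynomial_fun_deg_le_def
  proof (intro exI conjI ballI)
    have "poly_vars (Gb i j * Fb j k) \<subseteq> {..<?NQ}" if "j < N" for j
      using Q i that
      by (intro subset_trans[OF poly_vars_mult] Un_least) (auto simp: construction_Q_def)
    then have "(\<Union>j<N. poly_vars (Gb i j * Fb j k)) \<subseteq> {..<?NQ}"
      by blast
    then show "poly_vars (\<Sum>j<N. Gb i j * Fb j k) \<subseteq> {..<?NQ}"
      by (rule subset_trans[OF poly_vars_sum])
    \<comment> \<open>A product of two affine maps: this is the only source of the degree
      two.\<close>
    have "total_degree (Gb i j * Fb j k) \<le> 1 + 1" if "j < N" for j
      using Q i that by (intro total_degree_mult) (auto simp: construction_Q_def)
    then show "total_degree (\<Sum>j<N. Gb i j * Fb j k) \<le> 2"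
      by (intro total_degree_sum) (simp add: numeral_2_eq_2)
  qed (simp add: F_Q_def)
  have h: "polynomial_fun_deg_le 1 ?NQ (topspace (Euclidean_space ?NQ)) (\<lambda>z. coord_proj ?q z $ i)" for i
    unfolding polynomial_fun_deg_le_def using q(1)
    by (intro exI[of _ "poly_var ?q"])
      (simp add: coord_proj_def total_degree_le_iff, simp add: poly_var_def)
  have "FISCIDS ?NQ (topspace (Euclidean_space ?NQ)) (F_Q N Fb Gb)
      (coord_proj ?q) (gamma_vec gs z0) X (\<lambda>\<xi>. vec (\<phi> \<xi>))"
  proof (rule FISCIDS_I)
    show "ode_solution ?NQ (topspace (Euclidean_space ?NQ)) (F_Q N Fb Gb)
        (gamma_vec gs z0) \<xi> (\<lambda>\<tau>. gamma_vec gs (y \<xi> \<tau>))" if "\<xi> \<in> X" for \<xi>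
      by (rule gamma_curve[OF y[OF that]])
    show "gamma_vec gs z0 \<in> topspace (Euclidean_space ?NQ)"
      by (simp add: topspace_Euclidean_space gamma_vec_def)
    show "coord_proj ?q (gamma_vec gs (y \<xi> 1)) = vec (\<phi> \<xi>)" if "\<xi> \<in> X" for \<xi>
      using q phi[OF that] by (simp add: coord_proj_def gamma_vec_def)
    show "rational_fun ?NQ (topspace (Euclidean_space ?NQ)) (\<lambda>z. F_Q N Fb Gb z j k)" if "j < ?NQ" for j k
      by (rule polynomial_fun_imp_rational_fun[OF polynomial_fun_deg_le_imp_polynomial_fun[OF F[OF that]]])
  qed simp
  then show ?thesis
    unfolding Q_FISCIDS_def using F h by blast
qed

end

end

end

text \<open>Enumeration orders and polynomial data are left free by the construction, so each stage
  is claimed for every admissible choice, together with the existence of one, lest the claim be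
  vacuous. \<open>vec\<close> turns the scalar \<phi> into a map to real^1.\<close>

theorem mainTheorem6:
  fixes X :: "(real^'n) set" and \<phi> :: "real^'n \<Rightarrow> real"
    and p :: "'n \<Rightarrow> ('n + nat) rpoly" and \<rho> :: "'n \<Rightarrow> nat"
  assumes "open X" and "X \<noteq> {}" and "star_shaped_at X 0"
    and "nonsingular_DA_certificate X \<phi> p \<rho>"
  shows "(\<exists>\<alpha> num ex. construction_R X \<phi> p \<rho> \<alpha> num ex) \<and>
    (\<forall>\<alpha> num ex. construction_R X \<phi> p \<rho> \<alpha> num ex \<longrightarrow>
      (let N\<^sub>R = length \<alpha>; \<Delta> = Delta X \<phi> p \<rho> \<alpha>;
           l = position \<alpha> (restrict \<phi> X); z0 = alpha_vec \<alpha> 0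
       in
        R_FISCIDS N\<^sub>R (Z_R N\<^sub>R \<Delta>) (F_R \<Delta> num ex) (coord_proj l) z0 X (\<lambda>\<xi>. vec (\<phi> \<xi>)) \<and>
        N\<^sub>R \<le> CARD('n) + (\<Prod>i\<in>UNIV. \<rho> i + 1) \<and>
        (\<exists>ds Ft Gt. construction_P N\<^sub>R \<Delta> num ex ds Ft Gt) \<and>
        (\<forall>ds Ft Gt. construction_P N\<^sub>R \<Delta> num ex ds Ft Gt \<longrightarrow>
          (let M\<^sub>R = length ds; N\<^sub>P = N\<^sub>R + M\<^sub>R; FP = F_P N\<^sub>R Ft Gt; hP = poly_var l;
               zt0 = beta_vec N\<^sub>R ds z0; d\<^sub>P = max_degree_P N\<^sub>P FP hP
           in
            P_FISCIDS N\<^sub>P (topspace (Euclidean_space N\<^sub>P)) (\<lambda>z j k. poly_eval z (FP j k))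
              (coord_proj l) zt0 X (\<lambda>\<xi>. vec (\<phi> \<xi>)) \<and>
            N\<^sub>P \<le> N\<^sub>R + CARD('n) \<and>
            (\<exists>gs Fb Gb. construction_Q N\<^sub>P FP hP gs Fb Gb) \<and>
            (\<forall>gs Fb Gb. construction_Q N\<^sub>P FP hP gs Fb Gb \<longrightarrow>
              (let N\<^sub>Q = length gs; q = position gs (Poly_Mapping.single l 1)
               in
                Q_FISCIDS N\<^sub>Q (topspace (Euclidean_space N\<^sub>Q)) (F_Q N\<^sub>P Fb Gb)
                  (coord_proj q) (gamma_vec gs zt0) X (\<lambda>\<xi>. vec (\<phi> \<xi>)) \<and>
                N\<^sub>Q = card (down_closure (exps_P N\<^sub>P FP hP)) - 1 \<and>
                N\<^sub>Q \<le> ((N\<^sub>P + d\<^sub>P) choose d\<^sub>P) - 1))))))"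
  unfolding Let_def
proof (intro conjI allI impI)
  note X = assms(1) and star = assms(3) and cert = assms(4)
  obtain \<alpha> where "enumerates \<alpha> (A_all X \<phi> \<rho>)"
    unfolding enumerates_def using finite_distinct_list[OF finite_A_all[of X \<phi> \<rho>]] by blast
  then show "\<exists>\<alpha> num ex. construction_R X \<phi> p \<rho> \<alpha> num ex"
    using construction_R_exists[OF X cert] by blast
next
  note X = assms(1) and star = assms(3) and cert = assms(4)
  fix \<alpha> num ex assume R: "construction_R X \<phi> p \<rho> \<alpha> num ex"
  then have enum: "enumerates \<alpha> (A_all X \<phi> \<rho>)"
    by (simp add: construction_R_def)
  let ?N = "length \<alpha>" and ?D = "Delta X \<phi> p \<rho> \<alpha>" and ?l = "position \<alpha> (restrict \<phi> X)"
  let ?z0 = "alpha_vec \<alpha> 0"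
  show "R_FISCIDS ?N (Z_R ?N ?D) (F_R ?D num ex) (coord_proj ?l) ?z0 X (\<lambda>\<xi>. vec (\<phi> \<xi>))"
    by (rule R_FISCIDS_alpha[OF X cert enum star assms(2) R])
  have "?N = card (A_all X \<phi> \<rho>)"
    using enum by (metis distinct_card enumerates_def)
  then show "?N \<le> CARD('n) + (\<Prod>i\<in>UNIV. \<rho> i + 1)"
    using card_A_all[of X \<phi> \<rho>] by simp
  note D_vars = Delta_vars[OF X cert enum]
  have l: "?l < ?N"
    by (rule position_phi(1)[OF X cert enum])
  show "\<exists>ds Ft Gt. construction_P ?N ?D num ex ds Ft Gt"
    by (rule construction_P_exists[OF D_vars]) (use R in \<open>simp add: construction_R_def\<close>)
  fix ds Ft Gt assume P: "construction_P ?N ?D num ex ds Ft Gt"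
  let ?NP = "?N + length ds" and ?FP = "F_P ?N Ft Gt" and ?zt0 = "beta_vec ?N ds ?z0"
  have alpha: "ode_solution ?N (Z_R ?N ?D) (F_R ?D num ex) ?z0 \<xi> (\<lambda>\<tau>. alpha_vec \<alpha> (\<tau> *\<^sub>R \<xi>))"
    if "\<xi> \<in> X" for \<xi>
    by (rule alpha_curve[OF X cert enum star R that])
  have phi: "alpha_vec \<alpha> (1 *\<^sub>R \<xi>) ?l = \<phi> \<xi>" if "\<xi> \<in> X" for \<xi>
    using position_phi(2)[OF X cert enum that] by simp
  show "P_FISCIDS ?NP (topspace (Euclidean_space ?NP)) (\<lambda>z j k. poly_eval z (?FP j k))
      (coord_proj ?l) ?zt0 X (\<lambda>\<xi>. vec (\<phi> \<xi>))"
    by (rule P_FISCIDS_beta[OF D_vars P alpha l phi])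
  show "?NP \<le> ?N + CARD('n)"
    using length_denominators[OF D_vars P] by simp
  have FP_vars: "poly_vars (?FP j k) \<subseteq> {..<?NP}" if "j < ?NP" for j k
    by (rule F_P_vars[OF D_vars P that])
  have l': "?l < ?NP" using l by simp
  let ?E = "down_closure (exps_P ?NP ?FP (poly_var ?l))"
  have "finite ?E"
    by (rule finite_down_closure_exps_P[OF FP_vars l'])
  then have "finite (?E - {0})" by simp
  then obtain gs where "enumerates gs (?E - {0})"
    unfolding enumerates_def using finite_distinct_list by blast
  from construction_Q_exists[OF FP_vars l' this]
  show "\<exists>gs Fb Gb. construction_Q ?NP ?FP (poly_var ?l) gs Fb Gb" by blast
  fix gs Fb Gb assume Q: "construction_Q ?NP ?FP (poly_var ?l) gs Fb Gb"
  then have gs: "enumerates gs (?E - {0})"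
    by (simp add: construction_Q_def)
  have curve: "ode_solution ?NP (topspace (Euclidean_space ?NP)) (\<lambda>z j k. poly_eval z (?FP j k)) ?zt0 \<xi>
      (\<lambda>\<tau>. beta_vec ?N ds (alpha_vec \<alpha> (\<tau> *\<^sub>R \<xi>)))" if "\<xi> \<in> X" for \<xi>
    by (rule beta_curve[OF D_vars P alpha[OF that]])
  have val: "beta_vec ?N ds (alpha_vec \<alpha> (1 *\<^sub>R \<xi>)) ?l = \<phi> \<xi>" if "\<xi> \<in> X" for \<xi>
    using phi[OF that] l by (simp add: beta_vec_def)
  show "Q_FISCIDS (length gs) (topspace (Euclidean_space (length gs)))
      (F_Q ?NP Fb Gb) (coord_proj (position gs (Poly_Mapping.single ?l 1)))
      (gamma_vec gs ?zt0) X (\<lambda>\<xi>. vec (\<phi> \<xi>))"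
    by (rule Q_FISCIDS_gamma[where y = "\<lambda>\<xi> \<tau>. beta_vec ?N ds (alpha_vec \<alpha> (\<tau> *\<^sub>R \<xi>))",
          OF FP_vars l' gs Q curve val])
  show "length gs = card ?E - 1"
    by (rule length_gs[OF FP_vars l' gs])
  show "length gs \<le> ((?NP + max_degree_P ?NP ?FP (poly_var ?l))
      choose max_degree_P ?NP ?FP (poly_var ?l)) - 1"
    by (rule length_gs_le[OF FP_vars l' gs])
qed

end
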